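(* Consider the dual risk model with proportional gains and generalized-FGM dependence described in the context, with ruin probability $R(x)$ and Laplace transform $\rho(s)=\int_0^\infty e^{-sx}R(x)\,dx$. Put $$J(s;\theta)=\frac{\mu\phi(s)}{\mu(1+a)-s}+\theta(\phi(s)-g_Z^{*}(s))\mu\sum_{i=0}^{c-1}\binom{c-1}{i}(-1)^{i}\left[\frac{c+d}{\mu(1+a)(c+d-i)-s}-\frac{d}{\mu(1+a)(c+d-i-1)-s}\right],$$ $$\begin{aligned}H(s;\theta)=\;&\frac{1-\phi(s)}{s}-\frac{\mu\phi(s)\rho(\mu)}{\mu(1+a)-s}\\&+\theta(\phi(s)-g_Z^{*}(s))\mu\sum_{i=0}^{c-1}\binom{c-1}{i}(-1)^{i}\left\{\frac{(c+d)\rho(\mu(c+d-i))}{s-\mu(1+a)(c+d-i)}-\frac{d\,\rho(\mu(c+d-i-1))}{s-\mu(1+a)(c+d-i-1)}\right\}.\end{aligned}$$ Then $$\rho(s)=\sum_{k=0}^{\infty}\Big(\prod_{j=0}^{k-1}J\big(\tfrac{s}{(1+a)^{j}};\theta\big)\Big)H\big(\tfrac{s}{(1+a)^{k}};\theta\big),$$ an empty product being $1$. The values of $\rho(\mu)$ and $\rho(\mu(c+d-i))$, $i=0,\dots,c$, can be derived by substituting $s=\mu$ and $s=\mu(c+d-i)$, $i=0,\dots,c$, in this identity and solving a system of $c+2$ equations.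
   Context: Model. The surplus $U(t)$ starts at $U(0)=x>0$ and decreases at unit rate between gain arrivals. Let $(B_i,C_i)$, $i\ge1$, be i.i.d. random vectors distributed as $(B,C)$; $B_i$ are the gain interarrival times and $C_i$ the gain sizes. If the surplus just before the $i$-th gain is $u$, it jumps to $(1+a)u+C_i$, where $a>0$ is a constant. Ruin occurs when the surplus hits $0$, and $R(x)$ is the probability that ruin ever occurs starting from $x$. $B$ has c.d.f. $F_B$, density $f_B$ and Laplace–Stieltjes transform $\phi(s)=E(e^{-sB})$. $C\sim\exp(\mu)$ with c.d.f. $F_C$ and density $f_C$. The components of $(B,C)$ are dependent through the generalized Farlie–Gumbel–Morgenstern (FGM) copula $C(u,v)=uv+\theta p(u)g(v)$, with $p(u)=u^{k}(1-u)^{b}$, $g(v)=v^{c}(1-v)^{d}$, $k,b,c,d\ge1$ ($c$ an integer), and $\theta$ such that this is a copula; hence $(B,C)$ has joint density $f_{B,C}(x,t)=f_B(x)f_C(t)\,[1+\theta p'(F_B(x))g'(F_C(t))]$. Notation: $g_Z(t)=f_B(t)-f_B(t)p'(F_B(t))$ and $g_Z^{*}(s)=\int_0^\infty e^{-st}g_Z(t)\,dt$.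
   Formalization: The sign (-1)^i in J and H is corrected to (-1)^{c-1-i} (the printed sign is wrong for even c), and points s (also the substituted ones) where some s/(1+a)^j is a pole μ(1+a) or μ(1+a)(c+d-i), i=0,…,c, are excluded. *)

theory Defs
  imports "HOL-Probability.Probability"
begin

section \<open>The surplus process\<close>

text \<open>
  The functions of this section act on one realisation: \<open>bs n\<close> is the interarrival time that ends
  with the \<open>(n+1)\<close>-st gain and \<open>cs n\<close> is the corresponding gain size.
\<close>

primrec post_gain :: "real \<Rightarrow> real \<Rightarrow> (nat \<Rightarrow> real) \<Rightarrow> (nat \<Rightarrow> real) \<Rightarrow> nat \<Rightarrow> real" where
  "post_gain a x bs cs 0 = x"
| "post_gain a x bs cs (Suc n) = (1 + a) * (post_gain a x bs cs n - bs n) + cs n"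

definition gain_time :: "(nat \<Rightarrow> real) \<Rightarrow> nat \<Rightarrow> real" where
  "gain_time bs n = (\<Sum>i<n. bs i)"

text \<open>
  The number of gains up to and including time \<open>t\<close>. Only realisations with positive interarrival
  times and \<open>gain_time bs n\<close> tending to infinity matter (the others form a null set), and for these
  the least number exists.
\<close>

definition num_gains :: "(nat \<Rightarrow> real) \<Rightarrow> real \<Rightarrow> nat" where
  "num_gains bs t = (LEAST n. t < gain_time bs (Suc n))"

definition surplus :: "real \<Rightarrow> real \<Rightarrow> (nat \<Rightarrow> real) \<Rightarrow> (nat \<Rightarrow> real) \<Rightarrow> real \<Rightarrow> real" where
  "surplus a x bs cs t =
     (let n = num_gains bs t in post_gain a x bs cs n - (t - gain_time bs n))"

text \<open>
  \<open>surplus\<close> is not stopped at ruin; this does not affect whether it ever hits \<open>0\<close>.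
\<close>

definition ruin_prob ::
  "'w measure \<Rightarrow> real \<Rightarrow> (nat \<Rightarrow> 'w \<Rightarrow> real) \<Rightarrow> (nat \<Rightarrow> 'w \<Rightarrow> real) \<Rightarrow> real \<Rightarrow> real" where
  "ruin_prob M a B C x =
     measure M {\<omega> \<in> space M. \<exists>t\<ge>0. surplus a x (\<lambda>n. B n \<omega>) (\<lambda>n. C n \<omega>) t = 0}"


section \<open>Generalized Farlie--Gumbel--Morgenstern copulas\<close>

definition is_copula :: "(real \<Rightarrow> real \<Rightarrow> real) \<Rightarrow> bool" where
  "is_copula K \<longleftrightarrow>
     (\<forall>u\<in>{0..1}. K u 0 = 0 \<and> K 0 u = 0 \<and> K u 1 = u \<and> K 1 u = u) \<and>
     (\<forall>u1 u2 v1 v2. 0 \<le> u1 \<and> u1 \<le> u2 \<and> u2 \<le> 1 \<and> 0 \<le> v1 \<and> v1 \<le> v2 \<and> v2 \<le> 1 \<longrightarrow>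
        0 \<le> K u2 v2 - K u2 v1 - K u1 v2 + K u1 v1)"

definition fgm_p :: "real \<Rightarrow> real \<Rightarrow> real \<Rightarrow> real" where
  "fgm_p k b u = u powr k * (1 - u) powr b"

definition fgm_g :: "nat \<Rightarrow> real \<Rightarrow> real \<Rightarrow> real" where
  "fgm_g c d v = v ^ c * (1 - v) powr d"

definition fgm_copula ::
  "real \<Rightarrow> real \<Rightarrow> real \<Rightarrow> nat \<Rightarrow> real \<Rightarrow> real \<Rightarrow> real \<Rightarrow> real" where
  "fgm_copula \<theta> k b c d u v = u * v + \<theta> * fgm_p k b u * fgm_g c d v"

text \<open>
  \<open>deriv (fgm_p k b)\<close> is the classical derivative on the open unit interval. At \<open>0\<close> and \<open>1\<close> it may
  be a junk value, but \<open>fB\<close> vanishes almost everywhere on the set where \<open>FB\<close> is \<open>0\<close> or \<open>1\<close>.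
\<close>

definition g_Z :: "real \<Rightarrow> real \<Rightarrow> (real \<Rightarrow> real) \<Rightarrow> (real \<Rightarrow> real) \<Rightarrow> real \<Rightarrow> real" where
  "g_Z k b fB FB t = fB t - fB t * deriv (fgm_p k b) (FB t)"


section \<open>Transforms and the kernel functions\<close>

definition laplace :: "(real \<Rightarrow> real) \<Rightarrow> complex \<Rightarrow> complex" where
  "laplace f s = (LINT x:{0<..}|lborel. exp (- s * complex_of_real x) * complex_of_real (f x))"

definition laplace_stieltjes :: "'w measure \<Rightarrow> ('w \<Rightarrow> real) \<Rightarrow> complex \<Rightarrow> complex" where
  "laplace_stieltjes M X s = (LINT \<omega>|M. exp (- s * complex_of_real (X \<omega>)))"

text \<open>
  The sums below come from the expansion of \<open>g'(v)\<close> in powers of \<open>w = 1 - v\<close>, which equals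
  \<open>exp (-\<mu> t)\<close> for \<open>v = F_C(t)\<close>:
  \<open>g'(v) = (1-w)^(c-1) w^(d-1) ((c+d) w - d)
         = (\<Sum>i<c. binom(c-1,i) (-1)^(c-1-i) ((c+d) w^(c+d-i-1) - d w^(c+d-i-2)))\<close>.
  The sign is therefore \<open>(-1)^(c-1-i)\<close>; it agrees with \<open>(-1)^i\<close> exactly when \<open>c\<close> is odd.
\<close>

definition J_fun ::
  "real \<Rightarrow> real \<Rightarrow> real \<Rightarrow> nat \<Rightarrow> real \<Rightarrow> (complex \<Rightarrow> complex) \<Rightarrow> (complex \<Rightarrow> complex) \<Rightarrow>
   complex \<Rightarrow> complex" where
  "J_fun a \<mu> \<theta> c d \<phi> gZs s =
     of_real \<mu> * \<phi> s / (of_real (\<mu> * (1 + a)) - s)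
     + of_real \<theta> * (\<phi> s - gZs s) * of_real \<mu> *
       (\<Sum>i<c. of_nat ((c - 1) choose i) * (- 1) ^ (c - 1 - i) *
          (of_real (real c + d) / (of_real (\<mu> * (1 + a) * (real c + d - real i)) - s)
           - of_real d / (of_real (\<mu> * (1 + a) * (real c + d - real i - 1)) - s)))"

text \<open>
  In \<open>H_fun\<close> the argument \<open>r\<close> stands for \<open>\<rho>\<close>; it is a parameter because the values of \<open>\<rho>\<close> at the
  points of \<open>nodes\<close> are the unknowns of a system of equations.
\<close>

definition H_fun ::
  "real \<Rightarrow> real \<Rightarrow> real \<Rightarrow> nat \<Rightarrow> real \<Rightarrow> (complex \<Rightarrow> complex) \<Rightarrow> (complex \<Rightarrow> complex) \<Rightarrow>
   (complex \<Rightarrow> complex) \<Rightarrow> complex \<Rightarrow> complex" where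
  "H_fun a \<mu> \<theta> c d \<phi> gZs r s =
     (1 - \<phi> s) / s
     - of_real \<mu> * \<phi> s * r (of_real \<mu>) / (of_real (\<mu> * (1 + a)) - s)
     + of_real \<theta> * (\<phi> s - gZs s) * of_real \<mu> *
       (\<Sum>i<c. of_nat ((c - 1) choose i) * (- 1) ^ (c - 1 - i) *
          (of_real (real c + d) * r (of_real (\<mu> * (real c + d - real i)))
             / (s - of_real (\<mu> * (1 + a) * (real c + d - real i)))
           - of_real d * r (of_real (\<mu> * (real c + d - real i - 1)))
             / (s - of_real (\<mu> * (1 + a) * (real c + d - real i - 1)))))"

definition nodes :: "real \<Rightarrow> nat \<Rightarrow> real \<Rightarrow> complex set" where
  "nodes \<mu> c d =
     insert (of_real \<mu>) ((\<lambda>i. of_real (\<mu> * (real c + d - real i))) ` {0..c})"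

text \<open>
  The points at which no term of the series has a vanishing denominator: the poles of \<open>J_fun\<close> and
  \<open>H_fun\<close> in the right half plane lie in \<open>(1 + a) * \<sigma>\<close> with \<open>\<sigma>\<close> in \<open>nodes\<close>, and the \<open>j\<close>-th factor is
  evaluated at \<open>s / (1 + a) ^ j\<close>.
\<close>

definition regular_point :: "real \<Rightarrow> real \<Rightarrow> nat \<Rightarrow> real \<Rightarrow> complex \<Rightarrow> bool" where
  "regular_point a \<mu> c d s \<longleftrightarrow>
     (\<forall>j. \<forall>\<sigma>\<in>nodes \<mu> c d. s / of_real ((1 + a) ^ j) \<noteq> of_real (1 + a) * \<sigma>)"

end

theory Submission
  imports Defs "Jordan_Normal_Form.Determinant"
begin

text \<open>
  Conditioning on the first gain gives \<open>\<rho>(s) = J(s) \<rho>(s/(1+a)) + H(s)\<close>, and iterating leaves the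
  remainder \<open>J(s) J(s/(1+a)) \<cdots> J(s/(1+a)^(n-1)) \<rho>(s/(1+a)^n)\<close>. Let \<open>q\<^sub>n(t)\<close> be the product of
  \<open>\<phi>(t/(1+a)^j)\<close> over \<open>j < n\<close> with limit \<open>L(t)\<close>, where \<open>t = Re s\<close>. The product of the \<open>J\<close> is
  \<open>O(q\<^sub>n(t) (1+a)^(-n))\<close>, because \<open>(1+a) J(s) = \<phi>(s) + O(s)\<close> near \<open>0\<close>. Ruin from \<open>x\<close> forces
  \<open>\<Sum>i. B\<^sub>i/(1+a)^i > x\<close>, so \<open>t |\<rho>(s)| \<le> 1 - L(t)\<close>. Since \<open>q\<^sub>n(t) L(t/(1+a)^n) = L(t)\<close>, the
  remainder is \<open>O(q\<^sub>n(t) - L(t))\<close> and vanishes, whether or not \<open>L(t) = 0\<close>.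

  The linear system at the nodes is nonsingular by duality. The adjoint of the first-gain operator
  is \<open>(T G)(u) = E(G(B + (u-C)/(1+a)); C \<le> u) / (1+a)\<close>, a contraction for the supremum norm on
  \<open>[0,\<infinity>)\<close>. A left null vector \<open>x\<close> of the system yields a fixed point of \<open>T\<close>, namely
  \<open>\<Sum>\<sigma>. x\<^sub>\<sigma> \<Sum>n. J(\<sigma>) \<cdots> J(\<sigma>/(1+a)^(n-1)) exp(-\<sigma> u/(1+a)^n)\<close>. It therefore vanishes, and so does
  the coefficient \<open>x\<^sub>\<sigma>\<close> of its largest exponent.
\<close>

section \<open>Linear algebra and exponential integrals\<close>

text \<open>The crude bound |\<rho>(s)| \<le> 1/Re s would leave a remainder of order q_n(t) only:
  the growth of 1/Re(s/(1+a)^n) uses up the whole decay (1+a)^(-n) of the product of the J, so this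
  settles just the case L(t) = 0. Now L(t) > 0 holds exactly when E log(1+B) is finite. No moment of
  B is assumed, so both cases occur, and the bound (1 - L(t))/t covers them together.

  Uniqueness for the linear system cannot be read off from a count of equations and unknowns. The
  nodes are therefore kept as a set of distinct numbers; for d = 1 the last one coincides with
  \<mu>, so that there are only c+1 of them. The factor 1/(1+a) that makes T a contraction is the
  Jacobian of the map x -> (1+a)(x-B)+C.

  Since J has poles and division by zero yields zero in the logic, both halves of the result are
  confined to regular points, where no denominator of the series vanishes.\<close>

lemma left_kernel_trivial_imp_kernel_trivial:
  fixes A :: "'a \<Rightarrow> 'a \<Rightarrow> complex"
  assumes fin: "finite S"
    and left: "\<And>x. (\<And>\<tau>. \<tau> \<in> S \<Longrightarrow> x \<tau> = (\<Sum>\<sigma>\<in>S. x \<sigma> * A \<sigma> \<tau>)) \<Longrightarrow> \<forall>\<sigma>\<in>S. x \<sigma> = 0"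
    and y: "\<And>\<sigma>. \<sigma> \<in> S \<Longrightarrow> y \<sigma> = (\<Sum>\<tau>\<in>S. A \<sigma> \<tau> * y \<tau>)"
    and \<sigma>: "\<sigma> \<in> S"
  shows "y \<sigma> = 0"
proof (rule ccontr)
  assume ny: "y \<sigma> \<noteq> 0"
  obtain e where e: "bij_betw e {0..<card S} S"
    using ex_bij_betw_nat_finite[OF fin] by blast
  define n where "n = card S"
  define P where "P = mat n n (\<lambda>(i, j). (if i = j then 1 else 0) - A (e i) (e j))"
  have P: "P \<in> carrier_mat n n" by (simp add: P_def)
  have eS: "e i \<in> S" if "i < n" for i using e that by (auto simp: bij_betw_def n_def)
  have sum_e: "(\<Sum>i = 0..<n. f (e i)) = (\<Sum>\<tau>\<in>S. f \<tau>)" for f :: "'a \<Rightarrow> complex"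
    using sum.reindex_bij_betw[OF e] by (simp add: n_def)
  have "P *\<^sub>v vec n (y \<circ> e) = 0\<^sub>v n"
  proof (rule eq_vecI)
    fix i assume "i < dim_vec (0\<^sub>v n)"
    hence i: "i < n" by simp
    have "vec_index (P *\<^sub>v vec n (y \<circ> e)) i
        = (\<Sum>j = 0..<n. ((if i = j then 1 else 0) - A (e i) (e j)) * y (e j))"
      using i by (auto simp: P_def scalar_prod_def intro!: sum.cong)
    also have "\<dots> = y (e i) - (\<Sum>j = 0..<n. A (e i) (e j) * y (e j))"
      using i by (simp add: left_diff_distrib sum_subtractf if_distrib[of "\<lambda>u. u * _"] cong: if_cong)
    also have "\<dots> = 0"
      using sum_e[of "\<lambda>\<tau>. A (e i) \<tau> * y \<tau>"] y[OF eS[OF i]] by simp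
    finally show "vec_index (P *\<^sub>v vec n (y \<circ> e)) i = vec_index (0\<^sub>v n) i" using i by simp
  qed (simp add: P_def)
  moreover obtain i where "i < n" "e i = \<sigma>"
    using e \<sigma> unfolding bij_betw_def n_def by (metis atLeastLessThan_iff imageE)
  hence "vec n (y \<circ> e) \<noteq> 0\<^sub>v n"
    using ny by (auto dest!: arg_cong[where f="\<lambda>v. vec_index v i"])
  ultimately have "det P = 0"
    unfolding det_0_iff_vec_prod_zero[OF P] by (intro exI[of _ "vec n (y \<circ> e)"]) auto
  \<comment> \<open>The matrix of 1 - A is square, so a nonzero right null vector forces a nonzero
    left one. Below, \<open>x\<close> carries the latter back to \<open>S\<close> along the inverse
    of \<open>e\<close>.\<close>
  hence "det (transpose_mat P) = 0" by (simp add: det_transpose[OF P])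
  then obtain v where v: "v \<in> carrier_vec n" "v \<noteq> 0\<^sub>v n" "transpose_mat P *\<^sub>v v = 0\<^sub>v n"
    using det_0_iff_vec_prod_zero[of "transpose_mat P" n] P by auto
  define x where "x \<tau> = vec_index v (the_inv_into {0..<n} e \<tau>)" for \<tau>
  have xe: "x (e i) = vec_index v i" if "i < n" for i
    using e that unfolding x_def n_def by (subst the_inv_into_f_f) (auto simp: bij_betw_def)
  have "x \<tau> = (\<Sum>\<sigma>\<in>S. x \<sigma> * A \<sigma> \<tau>)" if \<tau>: "\<tau> \<in> S" for \<tau>
  proof -
    obtain j where j: "j < n" "e j = \<tau>"
      using e \<tau> unfolding bij_betw_def n_def by (metis atLeastLessThan_iff imageE)
    have "0 = vec_index (transpose_mat P *\<^sub>v v) j" using v(3) j by simp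
    also have "\<dots> = (\<Sum>i = 0..<n. ((if i = j then 1 else 0) - A (e i) (e j)) * vec_index v i)"
      using j v(1) by (auto simp: P_def scalar_prod_def intro!: sum.cong)
    also have "\<dots> = vec_index v j - (\<Sum>i = 0..<n. A (e i) (e j) * vec_index v i)"
      using j by (simp add: left_diff_distrib sum_subtractf if_distrib[of "\<lambda>u. u * _"] cong: if_cong)
    also have "(\<Sum>i = 0..<n. A (e i) (e j) * vec_index v i) = (\<Sum>i = 0..<n. x (e i) * A (e i) \<tau>)"
      by (intro sum.cong) (auto simp: xe j mult.commute)
    finally show ?thesis using sum_e[of "\<lambda>\<sigma>. x \<sigma> * A \<sigma> \<tau>"] j xe[of j] by simp
  qed
  hence "\<forall>\<sigma>\<in>S. x \<sigma> = 0" by (rule left)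
  hence "vec_index v i = 0" if "i < n" for i using xe[OF that] eS[OF that] by simp
  with v(1,2) show False by (auto intro!: eq_vecI)
qed

lemma nn_integral_exp_Ioi:
  assumes "0 < (t::real)"
  shows "(\<integral>\<^sup>+x. indicator {0<..} x * ennreal (exp (- (t * x))) \<partial>lborel) = ennreal (1 / t)"
proof -
  have "(\<integral>\<^sup>+x. indicator {0<..} x * ennreal (exp (- (t * x))) \<partial>lborel)
      = (\<integral>\<^sup>+x. ennreal (exp (- (t * x))) * indicator {0..} x \<partial>lborel)"
    using AE_lborel_singleton[of "0::real"]
    by (intro nn_integral_cong_AE) (auto elim!: eventually_mono split: split_indicator)
  also have "\<dots> = ennreal (0 - (- exp (- (t * 0)) / t))"
  proof (rule nn_integral_FTC_atLeast)
    show "((\<lambda>x. - exp (- (t * x)) / t) has_real_derivative exp (- (t * x))) (at x)" for x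
      using assms by (auto intro!: derivative_eq_intros)
    have "((\<lambda>x. exp (- (t * x))) \<longlongrightarrow> 0) at_top"
      using assms by (intro filterlim_compose[OF exp_at_bot])
        (auto simp: filterlim_uminus_at_bot intro!: filterlim_tendsto_pos_mult_at_top filterlim_ident)
    from tendsto_divide[OF tendsto_minus[OF this] tendsto_const[of t]]
    show "((\<lambda>x. - exp (- (t * x)) / t) \<longlongrightarrow> 0) at_top" using assms by simp
  qed auto
  finally show ?thesis by simp
qed

lemma integrable_exp_Ioi:
  assumes "0 < (t::real)"
  shows "integrable lborel (\<lambda>x. indicator {0<..} x * exp (- (t * x)))"
    and "(\<integral>x. indicator {0<..} x * exp (- (t * x)) \<partial>lborel) = 1 / t"
proof -
  have *: "(\<integral>\<^sup>+x. ennreal (indicator {0<..} x * exp (- (t * x))) \<partial>lborel) = ennreal (1 / t)"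
    unfolding nn_integral_exp_Ioi[OF assms, symmetric]
    by (intro nn_integral_cong) (auto split: split_indicator)
  show "integrable lborel (\<lambda>x. indicator {0<..} x * exp (- (t * x)))"
    using * by (intro integrableI_nonneg) auto
  show "(\<integral>x. indicator {0<..} x * exp (- (t * x)) \<partial>lborel) = 1 / t"
    using * assms by (subst integral_eq_nn_integral) auto
qed

lemma integrable_exp_Ioi_bounded:
  assumes s: "0 < Re s" and f [measurable]: "f \<in> borel_measurable borel"
    and K: "\<And>x. 0 < x \<Longrightarrow> norm (f x) \<le> K"
  shows "integrable lborel (\<lambda>x. indicator {0<..} x *\<^sub>R (exp (- s * complex_of_real x) * f x))"
proof (rule Bochner_Integration.integrable_bound)
  show "integrable lborel (\<lambda>x. K * (indicator {0<..} x * exp (- (Re s * x))))"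
    by (intro integrable_mult_right integrable_exp_Ioi s)
  have "0 \<le> K" using order_trans[OF norm_ge_zero K[of 1]] by simp
  thus "AE x in lborel. norm (indicator {0<..} x *\<^sub>R (exp (- s * complex_of_real x) * f x))
      \<le> norm (K * (indicator {0<..} x * exp (- (Re s * x))))"
    using K by (intro AE_I2)
      (auto simp: norm_mult mult.commute[of K] intro!: mult_left_mono split: split_indicator)
qed measurable

lemma integral_exp_Icc:
  assumes z: "z \<noteq> 0" and u: "0 \<le> u"
  shows "(\<integral>x. indicator {0..u} x *\<^sub>R exp (complex_of_real x * z) \<partial>lborel)
       = (exp (complex_of_real u * z) - 1) / z"
proof -
  have "(\<integral>x. indicator {0..u} x *\<^sub>R exp (complex_of_real x * z) \<partial>lborel)
     = exp (complex_of_real u * z) / z - exp (complex_of_real 0 * z) / z"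
  proof (rule integral_FTC_Icc[OF u])
    fix x :: real
    have "((\<lambda>x. exp (x * z) / z) has_field_derivative exp (complex_of_real x * z)) (at (of_real x))"
      using z by (auto intro!: derivative_eq_intros)
    from has_vector_derivative_real_field[OF this]
    show "((\<lambda>x. exp (complex_of_real x * z) / z) has_vector_derivative exp (complex_of_real x * z))
        (at x within {0..u})" .
  qed (auto intro!: continuous_intros)
  thus ?thesis by (simp add: diff_divide_distrib)
qed

section \<open>The transform equation\<close>

text \<open>
  \<open>D\<close> is the law of \<open>(B, C)\<close>. The dependence enters only through \<open>kernel\<close>: the complex measure
  \<open>F \<mapsto> E(exp(-s B) F(C))\<close> has the density \<open>\<Sum>i\<in>I. w\<^sub>i(s) exp(-\<nu>\<^sub>i t)\<close> on \<open>(0,\<infinity>)\<close>.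
\<close>

locale dual_risk =
  fixes D :: "(real \<times> real) measure" and a :: real and I :: "'i set"
    and \<nu> :: "'i \<Rightarrow> real" and w :: "'i \<Rightarrow> complex \<Rightarrow> complex"
  assumes prob_D: "prob_space D" and sets_D [measurable_cong]: "sets D = sets (borel \<Otimes>\<^sub>M borel)"
    and a_pos: "0 < a" and fin: "finite I" and nu_pos: "\<And>i. i \<in> I \<Longrightarrow> 0 < \<nu> i"
    and D_pos: "AE z in D. 0 < fst z \<and> 0 < snd z"
    and kernel: "\<And>s F K. 0 < Re s \<Longrightarrow> F \<in> borel_measurable borel \<Longrightarrow> (\<And>t. norm (F t) \<le> K) \<Longrightarrow>
       (\<integral>z. exp (- s * complex_of_real (fst z)) * F (snd z) \<partial>D)
     = (\<Sum>i\<in>I. w i s * (LINT t:{0<..}|lborel. exp (- complex_of_real (\<nu> i) * complex_of_real t) * F t))"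
    and w_bdd: "\<exists>W. \<forall>i\<in>I. \<forall>s. 0 < Re s \<longrightarrow> norm (w i s) \<le> W"
begin

sublocale D: prob_space D by (rule prob_D)

definition phi :: "complex \<Rightarrow> complex" where
  "phi s = (\<integral>z. exp (- s * complex_of_real (fst z)) \<partial>D)"

definition phir :: "real \<Rightarrow> real" where
  "phir t = (\<integral>z. exp (- t * fst z) \<partial>D)"

text \<open>A sum over the poles (1+a) \<nu>_i. The choice f = 1 gives J, f = \<rho> gives the part
  of H that contains \<rho>, and f(\<nu>) = 1/\<nu> gives the error term in the comparison of J with
  phi.\<close>

definition ksum :: "complex \<Rightarrow> (complex \<Rightarrow> complex) \<Rightarrow> complex" where
  "ksum s f = (\<Sum>i\<in>I. w i s * f (of_real (\<nu> i)) / (of_real ((1 + a) * \<nu> i) - s))"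

definition J :: "complex \<Rightarrow> complex" where "J s = ksum s (\<lambda>_. 1)"

definition regular :: "complex \<Rightarrow> bool" where
  "regular s \<longleftrightarrow> (\<forall>j. \<forall>i\<in>I. s / of_real ((1 + a) ^ j) \<noteq> of_real ((1 + a) * \<nu> i))"

definition coef :: "nat \<Rightarrow> complex \<Rightarrow> complex" where
  "coef n s = (\<Prod>j<n. J (s / of_real ((1 + a) ^ j)))"

lemma fst_measurable_D [measurable]: "fst \<in> borel_measurable D"
  and snd_measurable_D [measurable]: "snd \<in> borel_measurable D"
  by (simp_all cong: measurable_cong_sets[OF sets_D refl])

lemma pow_pos [simp]: "0 < (1 + a) ^ j" and one_plus_pos [simp]: "0 < 1 + a"
  using a_pos by auto

lemma of_real_one_plus_nonzero [simp]: "1 + complex_of_real a \<noteq> 0"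
  using a_pos by (simp add: complex_eq_iff)

lemma Re_scaled [simp]: "Re (s / of_real ((1 + a) ^ j)) = Re s / (1 + a) ^ j"
  by (simp only: Re_divide_of_real)

text \<open>The case F = 1 of \<open>kernel\<close>: each exponential integrates to 1/\<nu>_i. This
  ties the weights to phi.\<close>

lemma phi_eq_kernel:
  assumes "0 < Re s"
  shows "phi s = (\<Sum>i\<in>I. w i s / of_real (\<nu> i))"
proof -
  have "phi s = (\<integral>z. exp (- s * complex_of_real (fst z)) * 1 \<partial>D)" by (simp add: phi_def)
  also have "\<dots> = (\<Sum>i\<in>I. w i s * (LINT t:{0<..}|lborel. exp (- complex_of_real (\<nu> i) * complex_of_real t) * 1))"
    by (rule kernel[OF assms, where K = 1]) auto
  also have "\<dots> = (\<Sum>i\<in>I. w i s / of_real (\<nu> i))"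
  proof (rule sum.cong[OF refl])
    fix i assume i: "i \<in> I"
    have "(LINT t:{0<..}|lborel. exp (- complex_of_real (\<nu> i) * complex_of_real t) * 1)
        = (\<integral>t. complex_of_real (indicator {0<..} t * exp (- (\<nu> i * t))) \<partial>lborel)"
      unfolding set_lebesgue_integral_def
      by (intro Bochner_Integration.integral_cong) (auto simp: exp_of_real[symmetric] split: split_indicator)
    also have "\<dots> = 1 / of_real (\<nu> i)"
      unfolding integral_complex_of_real integrable_exp_Ioi(2)[OF nu_pos[OF i]] by simp
    finally show "w i s * (LINT t:{0<..}|lborel. exp (- complex_of_real (\<nu> i) * complex_of_real t) * 1)
       = w i s / of_real (\<nu> i)" by simp
  qed
  finally show ?thesis .
qed

text \<open>Partial fractions: (1+a)/((1+a) \<nu> - s) = 1/\<nu> + s/(\<nu> ((1+a) \<nu> - s)). The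
  first terms add up to phi s by \<open>phi_eq_kernel\<close>; the rest carries the factor s, which
  is small at s/(1+a)^j for large j.\<close>

lemma J_eq:
  assumes s: "0 < Re s" and reg: "\<And>i. i \<in> I \<Longrightarrow> s \<noteq> of_real ((1 + a) * \<nu> i)"
  shows "of_real (1 + a) * J s = phi s + s * ksum s (\<lambda>\<nu>. 1 / \<nu>)"
proof -
  have "of_real (1 + a) * (w i s * 1 / (of_real ((1 + a) * \<nu> i) - s))
      = w i s / of_real (\<nu> i) + s * (w i s * (1 / of_real (\<nu> i)) / (of_real ((1 + a) * \<nu> i) - s))"
    if i: "i \<in> I" for i
  proof -
    have "of_real ((1 + a) * \<nu> i) - s \<noteq> 0" "complex_of_real (\<nu> i) \<noteq> 0"
      using reg[OF i] nu_pos[OF i] by auto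
    thus ?thesis by (simp add: divide_simps) (simp add: algebra_simps)
  qed
  thus ?thesis
    unfolding J_def ksum_def phi_eq_kernel[OF s] sum_distrib_left sum.distrib[symmetric]
    by (intro sum.cong) auto
qed

lemma norm_exp_le_1: "norm (exp (- s * complex_of_real x)) \<le> 1" if "0 \<le> Re s" "0 \<le> x"
  using that by simp

lemma phir_integrable: "0 < t \<Longrightarrow> integrable D (\<lambda>z. exp (- t * fst z))"
  by (rule D.integrable_const_bound[of _ 1]) (use D_pos in \<open>auto elim!: eventually_mono\<close>)

lemma phi_integrable: "0 < Re s \<Longrightarrow> integrable D (\<lambda>z. exp (- s * complex_of_real (fst z)))"
  by (rule D.integrable_const_bound[of _ 1]) (use D_pos in \<open>auto elim!: eventually_mono\<close>)

lemma norm_phi_le: "norm (phi s) \<le> phir (Re s)"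
  unfolding phi_def phir_def
  by (rule order_trans[OF Bochner_Integration.integral_norm_bound]) simp

lemma phir_less_1: "0 < t \<Longrightarrow> phir t < 1"
  unfolding phir_def by (rule D.expectation_less) (use D_pos phir_integrable in \<open>auto elim!: eventually_mono\<close>)

lemma phir_pos: assumes "0 < t" shows "0 < phir t"
proof -
  have "0 \<le> phir t" unfolding phir_def by (rule Bochner_Integration.integral_nonneg) simp
  moreover have "phir t \<noteq> 0"
  proof
    assume "phir t = 0"
    hence "AE z in D. exp (- t * fst z) = 0"
      unfolding phir_def using integral_nonneg_eq_0_iff_AE[OF phir_integrable[OF assms]] by simp
    thus False using D.AE_False by simp
  qed
  ultimately show ?thesis by linarith
qed

lemma phir_antimono: assumes "0 < t" "t \<le> t'" shows "phir t' \<le> phir t"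
  unfolding phir_def
  by (rule integral_mono_AE) (use D_pos assms phir_integrable in \<open>auto elim!: eventually_mono\<close>)


text \<open>
  The adjoint of the first-gain operator \<open>W \<mapsto> (\<lambda>x. E(W((1+a)(x-B)+C); B \<le> x))\<close> with respect to
  Lebesgue measure on \<open>(0,\<infinity>)\<close>.
\<close>

definition adj :: "(real \<Rightarrow> complex) \<Rightarrow> real \<Rightarrow> complex" where
  "adj G u = (\<integral>z. indicator {..u} (snd z) *\<^sub>R G (fst z + (u - snd z) / (1 + a)) \<partial>D) / of_real (1 + a)"

text \<open>A convolution on [0,u] of two exponentials with rates n and r = s/(1+a). The assumption
  on s says that the rates differ; equal rates would produce u exp(-n u) in place of a difference of
  exponentials.\<close>

lemma integral_kernel_exp:
  assumes n: "0 < n" and u: "0 \<le> u" and reg: "s \<noteq> of_real ((1 + a) * n)"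
  shows "(LINT t:{0<..}|lborel. exp (- complex_of_real n * complex_of_real t) *
            (indicator {0..u} t *\<^sub>R exp (- s * complex_of_real ((u - t) / (1 + a)))))
       = of_real (1 + a) * (exp (- (s / of_real (1 + a)) * of_real u) - exp (- of_real n * of_real u))
          / (of_real ((1 + a) * n) - s)"
proof -
  define r where "r = s / of_real (1 + a)"
  have s: "s = r * of_real (1 + a)" by (simp add: r_def)
  have z: "r - of_real n \<noteq> 0" using reg unfolding s by (auto simp: mult.commute)
  have "(LINT t:{0<..}|lborel. exp (- complex_of_real n * complex_of_real t) *
            (indicator {0..u} t *\<^sub>R exp (- s * complex_of_real ((u - t) / (1 + a)))))
      = (\<integral>t. exp (- r * of_real u) * (indicator {0..u} t *\<^sub>R exp (complex_of_real t * (r - of_real n))) \<partial>lborel)"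
    unfolding set_lebesgue_integral_def
  proof (rule integral_cong_AE)
    show "AE t in lborel. indicator {0<..} t *\<^sub>R (exp (- complex_of_real n * complex_of_real t) *
            (indicator {0..u} t *\<^sub>R exp (- s * complex_of_real ((u - t) / (1 + a)))))
        = exp (- r * of_real u) * (indicator {0..u} t *\<^sub>R exp (complex_of_real t * (r - of_real n)))"
      using AE_lborel_singleton[of "0::real"]
    proof eventually_elim
      case (elim t)
      have "- s * complex_of_real ((u - t) / (1 + a)) = - r * of_real (u - t)"
        by (simp add: s del: of_real_diff)
      hence "exp (- complex_of_real n * complex_of_real t) * exp (- s * complex_of_real ((u - t) / (1 + a)))
          = exp (- r * of_real u) * exp (complex_of_real t * (r - of_real n))"
        by (simp add: exp_add[symmetric] algebra_simps del: of_real_divide)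
      with elim show ?case by (auto split: split_indicator)
    qed
  qed auto
  also have "\<dots> = exp (- r * of_real u) * ((exp (complex_of_real u * (r - of_real n)) - 1) / (r - of_real n))"
    by (simp only: integral_mult_right_zero integral_exp_Icc[OF z u])
  also have "\<dots> = (exp (- of_real n * of_real u) - exp (- r * of_real u)) / (r - of_real n)"
    by (simp add: algebra_simps exp_add[symmetric] diff_divide_distrib)
  also have "\<dots> = of_real (1 + a) * (exp (- r * of_real u) - exp (- of_real n * of_real u))
          / (of_real ((1 + a) * n) - s)"
  proof -
    have e: "of_real ((1 + a) * n) - s = - (of_real (1 + a) * (r - of_real n))" unfolding s by (simp add: algebra_simps)
    show ?thesis unfolding e using z by (simp add: divide_simps)
  qed
  finally show ?thesis by (simp add: r_def)
qed

text \<open>The function exp(-s (B + (u-C)/(1+a))) factors into a function of B and one of C, so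
  \<open>kernel\<close> applies and leaves one convolution per index. The exponentials of rate
  s/(1+a) collect to J s, those of rate \<nu>_i to \<open>ksum\<close>. Both the functional equation
  and the uniqueness proof rest on this formula.\<close>

lemma adj_exp:
  assumes s: "0 < Re s" and u: "0 \<le> u" and reg: "\<And>i. i \<in> I \<Longrightarrow> s \<noteq> of_real ((1 + a) * \<nu> i)"
  shows "adj (\<lambda>x. exp (- s * of_real x)) u
       = J s * exp (- (s / of_real (1 + a)) * of_real u) - ksum s (\<lambda>\<nu>. exp (- \<nu> * of_real u))"
proof -
  \<comment> \<open>On [0,u] the exponent has nonpositive real part, so F is bounded by 1 as
    \<open>kernel\<close> demands. The lower end 0 agrees with the event C \<le> u in
    \<open>adj\<close> almost surely, because C > 0.\<close>
  define F where "F t = indicator {0..u} t *\<^sub>R exp (- s * complex_of_real ((u - t) / (1 + a)))" for t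
  have [measurable]: "F \<in> borel_measurable borel" unfolding F_def by measurable
  have "of_real (1 + a) * adj (\<lambda>x. exp (- s * of_real x)) u
      = (\<integral>z. exp (- s * complex_of_real (fst z)) * F (snd z) \<partial>D)"
    unfolding adj_def
  proof (simp, rule integral_cong_AE)
    show "AE z in D. indicator {..u} (snd z) *\<^sub>R
        exp (- (s * (complex_of_real (fst z) + (complex_of_real u - complex_of_real (snd z)) / (1 + complex_of_real a))))
      = exp (- (s * complex_of_real (fst z))) * F (snd z)"
      using D_pos
    proof eventually_elim
      case (elim z)
      have "exp (- (s * (complex_of_real (fst z) + (complex_of_real u - complex_of_real (snd z)) / (1 + complex_of_real a))))
        = exp (- (s * complex_of_real (fst z))) * exp (- s * complex_of_real ((u - snd z) / (1 + a)))"
        by (simp add: exp_add[symmetric] distrib_left)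
      with elim show ?case by (auto simp: F_def split: split_indicator)
    qed
  qed auto
  also have "\<dots> = (\<Sum>i\<in>I. w i s * (LINT t:{0<..}|lborel. exp (- complex_of_real (\<nu> i) * complex_of_real t) * F t))"
  proof (rule kernel[OF s, where K = 1])
    show "norm (F t) \<le> 1" for t
      unfolding F_def using s a_pos by (auto split: split_indicator)
  qed measurable
  also have "\<dots> = (\<Sum>i\<in>I. w i s * (of_real (1 + a) * (exp (- (s / of_real (1 + a)) * of_real u)
       - exp (- of_real (\<nu> i) * of_real u)) / (of_real ((1 + a) * \<nu> i) - s)))"
    unfolding F_def by (intro sum.cong refl, subst integral_kernel_exp[OF nu_pos u reg]) auto
  also have "\<dots> = of_real (1 + a) * (J s * exp (- (s / of_real (1 + a)) * of_real u)
       - ksum s (\<lambda>\<nu>. exp (- \<nu> * of_real u)))"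
    unfolding J_def ksum_def sum_distrib_left sum_distrib_right sum_subtractf[symmetric]
    by (intro sum.cong) (auto simp: diff_divide_distrib algebra_simps)
  finally show ?thesis unfolding mult_cancel_left using of_real_one_plus_nonzero by simp
qed

lemma adj_args_nonneg:
  assumes "0 \<le> u"
  shows "AE z in D. snd z \<le> u \<longrightarrow> 0 \<le> fst z + (u - snd z) / (1 + a)"
  using D_pos by eventually_elim (use a_pos in simp)

lemma integrable_adj:
  fixes G :: "real \<Rightarrow> complex"
  assumes [measurable]: "G \<in> borel_measurable borel" and K: "\<And>x. 0 \<le> x \<Longrightarrow> norm (G x) \<le> K" and u: "0 \<le> u"
  shows "integrable D (\<lambda>z. indicator {..u} (snd z) *\<^sub>R G (fst z + (u - snd z) / (1 + a)))"
proof (rule D.integrable_const_bound)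
  have "0 \<le> K" by (rule order_trans[OF norm_ge_zero K[OF order_refl]])
  thus "AE z in D. norm (indicator {..u} (snd z) *\<^sub>R G (fst z + (u - snd z) / (1 + a))) \<le> K"
    using adj_args_nonneg[OF u] by (auto elim!: eventually_mono intro!: K split: split_indicator)
qed measurable

text \<open>On the event C \<le> u the argument of G is almost surely nonnegative, so a bound on [0,
  infinity) suffices. The contraction factor is the normalisation in \<open>adj\<close>.\<close>

lemma norm_adj_le:
  fixes G :: "real \<Rightarrow> complex"
  assumes [measurable]: "G \<in> borel_measurable borel" and K: "\<And>x. 0 \<le> x \<Longrightarrow> norm (G x) \<le> K" and u: "0 \<le> u"
  shows "norm (adj G u) \<le> K / (1 + a)"
proof -
  let ?f = "\<lambda>z. indicator {..u} (snd z) *\<^sub>R G (fst z + (u - snd z) / (1 + a))"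
  have "0 \<le> K" by (rule order_trans[OF norm_ge_zero K[OF order_refl]])
  have "norm (\<integral>z. ?f z \<partial>D) \<le> (\<integral>z. norm (?f z) \<partial>D)" by (rule Bochner_Integration.integral_norm_bound)
  also have "\<dots> \<le> K"
  proof (rule D.integral_le_const)
    show "integrable D (\<lambda>z. norm (?f z))" by (intro integrable_norm integrable_adj[OF _ K u]) auto
    show "AE z in D. norm (?f z) \<le> K"
      using adj_args_nonneg[OF u] \<open>0 \<le> K\<close> by (auto elim!: eventually_mono intro!: K split: split_indicator)
  qed
  finally show ?thesis
    unfolding adj_def norm_divide using a_pos by (simp add: divide_right_mono del: of_real_add)
qed

lemma adj_linear:
  assumes fin: "finite A" and G: "\<And>k. k \<in> A \<Longrightarrow> G k \<in> borel_measurable borel"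
    and K: "\<And>k x. k \<in> A \<Longrightarrow> 0 \<le> x \<Longrightarrow> norm (G k x) \<le> K" and u: "0 \<le> u"
  shows "adj (\<lambda>x. \<Sum>k\<in>A. c k * G k x) u = (\<Sum>k\<in>A. c k * adj (G k) u)"
proof -
  have "(\<integral>z. indicator {..u} (snd z) *\<^sub>R (\<Sum>k\<in>A. c k * G k (fst z + (u - snd z) / (1 + a))) \<partial>D)
     = (\<integral>z. (\<Sum>k\<in>A. c k * (indicator {..u} (snd z) *\<^sub>R G k (fst z + (u - snd z) / (1 + a)))) \<partial>D)"
    by (intro Bochner_Integration.integral_cong) (auto simp: scaleR_sum_right)
  also have "\<dots> = (\<Sum>k\<in>A. c k * (\<integral>z. indicator {..u} (snd z) *\<^sub>R G k (fst z + (u - snd z) / (1 + a)) \<partial>D))"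
    by (subst Bochner_Integration.integral_sum)
       (auto intro!: integrable_mult_right integrable_adj[OF G K u] simp only: integral_mult_right_zero)
  finally show ?thesis unfolding adj_def by (simp add: sum_divide_distrib)
qed

text \<open>The supremum m of the norm of G on [0, infinity) satisfies m \<le> e + m/(1+a). K serves
  to make m finite and is absent from the conclusion, so the estimate can be applied to all
  truncations of a series at once.\<close>

lemma almost_fixed_point_small:
  fixes G :: "real \<Rightarrow> complex"
  assumes [measurable]: "G \<in> borel_measurable borel" and K: "\<And>x. 0 \<le> x \<Longrightarrow> norm (G x) \<le> K"
    and e: "\<And>x. 0 \<le> x \<Longrightarrow> norm (G x - adj G x) \<le> e" and u: "0 \<le> u"
  shows "norm (G u) \<le> e * (1 + a) / a"
proof -
  define m where "m = (SUP x\<in>{0..}. norm (G x))"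
  have bdd: "bdd_above ((\<lambda>x. norm (G x)) ` {0..})" using K by (auto intro!: bdd_aboveI2)
  have Gm: "norm (G x) \<le> m" if "0 \<le> x" for x unfolding m_def using that by (intro cSUP_upper bdd) auto
  have "norm (G x) \<le> e + m / (1 + a)" if x: "0 \<le> x" for x
    using norm_triangle_sub[of "G x" "adj G x"] e[OF x] norm_adj_le[OF assms(1) Gm x] by auto
  hence "m \<le> e + m / (1 + a)" unfolding m_def by (intro cSUP_least) (auto simp: m_def)
  hence "m * a \<le> e * (1 + a)" using a_pos by (simp add: field_simps)
  hence "m \<le> e * (1 + a) / a" using a_pos by (simp add: field_simps)
  with Gm[OF u] show ?thesis by simp
qed

subsection \<open>Iterating the transform equation\<close>

lemma coef_Suc:
  "coef (Suc n) s = coef n s * J (s / of_real ((1 + a) ^ n))"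
  by (simp add: coef_def mult.commute)

lemma regular_ne:
  assumes "regular s" "i \<in> I"
  shows "s / of_real ((1 + a) ^ j) \<noteq> of_real ((1 + a) * \<nu> i)"
  using assms unfolding regular_def by blast

lemma scaled_tendsto_0: "(\<lambda>n. s / of_real ((1 + a) ^ n)) \<longlonglongrightarrow> (0::complex)"
proof -
  have "(\<lambda>n. s * of_real ((inverse (1 + a)) ^ n)) \<longlonglongrightarrow> s * of_real 0"
    using a_pos by (intro tendsto_intros LIMSEQ_power_zero) (auto simp: field_simps)
  thus ?thesis by (simp add: divide_inverse power_inverse del: of_real_power)
qed

text \<open>The arguments s/(1+a)^n tend to 0, so the denominators converge to (1+a) \<nu>_i > 0 and
  each quotient is bounded as a convergent sequence. The weights are controlled by
  \<open>w_bdd\<close>.\<close>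

lemma ksum_scaled_bounded:
  assumes s: "0 < Re s" "regular s"
  shows "\<exists>K. \<forall>n. norm (ksum (s / of_real ((1 + a) ^ n)) f) \<le> K"
proof -
  obtain W where W: "\<And>i s. i \<in> I \<Longrightarrow> 0 < Re s \<Longrightarrow> norm (w i s) \<le> W" using w_bdd by blast
  have "\<exists>K. \<forall>n. norm (f (of_real (\<nu> i)) / (of_real ((1 + a) * \<nu> i) - s / of_real ((1 + a) ^ n))) \<le> K"
    if i: "i \<in> I" for i
  proof -
    have "complex_of_real ((1 + a) * \<nu> i) - 0 \<noteq> 0" using nu_pos[OF i] by simp
    hence "(\<lambda>n. f (of_real (\<nu> i)) / (of_real ((1 + a) * \<nu> i) - s / of_real ((1 + a) ^ n)))
        \<longlonglongrightarrow> f (of_real (\<nu> i)) / (of_real ((1 + a) * \<nu> i) - 0)"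
      by (intro tendsto_intros scaled_tendsto_0)
    thus ?thesis using convergent_imp_Bseq BseqD unfolding convergent_def by metis
  qed
  then obtain K where K: "\<And>i n. i \<in> I \<Longrightarrow>
      norm (f (of_real (\<nu> i)) / (of_real ((1 + a) * \<nu> i) - s / of_real ((1 + a) ^ n))) \<le> K i" by metis
  have "norm (ksum (s / of_real ((1 + a) ^ n)) f) \<le> (\<Sum>i\<in>I. W * K i)" for n
    unfolding ksum_def
  proof (rule sum_norm_le)
    fix i assume i: "i \<in> I"
    have "norm (w i (s / of_real ((1 + a) ^ n)) *
        (f (of_real (\<nu> i)) / (of_real ((1 + a) * \<nu> i) - s / of_real ((1 + a) ^ n)))) \<le> W * K i"
      unfolding norm_mult using s W[OF i, of 1]
      by (intro mult_mono W i K order_trans[OF norm_ge_zero W[OF i, of 1]]) (simp_all del: of_real_power)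
    thus "norm (w i (s / of_real ((1 + a) ^ n)) * f (of_real (\<nu> i)) / (of_real ((1 + a) * \<nu> i) - s / of_real ((1 + a) ^ n))) \<le> W * K i"
      by simp
  qed
  thus ?thesis by blast
qed

text \<open>This is q_n(t): the Laplace transform at t of the discounted sum of B_j/(1+a)^j over j <
  n, with independent copies B_j of B.\<close>

definition pprod :: "nat \<Rightarrow> real \<Rightarrow> real" where
  "pprod n t = (\<Prod>j<n. phir (t / (1 + a) ^ j))"

lemma pprod_bounds: assumes "0 < t" shows "0 < pprod n t" "pprod n t \<le> 1"
  unfolding pprod_def
  using assms by (auto intro!: prod_pos prod_le_1 phir_pos less_imp_le[OF phir_less_1] less_imp_le[OF phir_pos])

text \<open>By \<open>J_eq\<close>, (1+a) |J| at s/(1+a)^j is at most phir plus an error of order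
  (1+a)^(-j). Written as a relative error 1 + C r^j \<le> exp(C r^j), the errors multiply to a
  constant, and the product of the phir is kept intact for the later comparison with its
  limit.\<close>

lemma norm_coef_le:
  assumes s: "0 < Re s" "regular s"
  obtains M where "0 \<le> M" "\<And>n. norm (coef n s) \<le> M * pprod n (Re s) / (1 + a) ^ n"
proof -
  obtain K where K: "\<And>n. norm (ksum (s / of_real ((1 + a) ^ n)) (\<lambda>\<nu>. 1 / \<nu>)) \<le> K"
    using ksum_scaled_bounded[OF s] by blast
  have K0: "0 \<le> K" by (rule order_trans[OF norm_ge_zero K[of 0]])
  define r where "r = inverse (1 + a)"
  have r: "0 < r" "r < 1" using a_pos by (auto simp: r_def field_simps)
  define t where "t = Re s"
  \<comment> \<open>As phir is decreasing, phir t bounds every phir(t/(1+a)^j) from below; dividing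
    by it makes the additive error relative.\<close>
  define C where "C = norm s * K / phir t"
  have C0: "0 \<le> C" unfolding C_def using K0 phir_pos[of t] s by (simp add: t_def)
  have step: "(1 + a) * norm (J (s / of_real ((1 + a) ^ j))) \<le> phir (t / (1 + a) ^ j) * exp (C * r ^ j)" for j
  proof -
    let ?s = "s / of_real ((1 + a) ^ j)"
    have sj: "0 < Re ?s" using s by simp
    have "(1 + a) * norm (J ?s) = norm (of_real (1 + a) * J ?s)"
      unfolding norm_mult norm_of_real using a_pos by simp
    also have "\<dots> \<le> norm (phi ?s) + norm ?s * norm (ksum ?s (\<lambda>\<nu>. 1 / \<nu>))"
    proof -
      have "of_real (1 + a) * J ?s = phi ?s + ?s * ksum ?s (\<lambda>\<nu>. 1 / \<nu>)"
        by (rule J_eq[OF sj]) (rule regular_ne[OF s(2)])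
      thus ?thesis by (metis norm_triangle_ineq norm_mult)
    qed
    also have "\<dots> \<le> phir (t / (1 + a) ^ j) + (norm s * r ^ j) * K"
    proof (intro add_mono mult_mono K)
      show "norm (phi ?s) \<le> phir (t / (1 + a) ^ j)"
        using norm_phi_le[of ?s] by (simp only: Re_scaled t_def)
      show "norm ?s \<le> norm s * r ^ j"
        unfolding norm_divide norm_of_real using less_imp_le[OF pow_pos[of j]]
        by (simp add: r_def divide_inverse power_inverse)
    qed (use r in auto)
    also have "(norm s * r ^ j) * K = phir t * (C * r ^ j)"
      using phir_pos[of t] s by (simp add: C_def t_def)
    also have "\<dots> \<le> phir (t / (1 + a) ^ j) * (C * r ^ j)"
      using s a_pos C0 r
      by (intro mult_right_mono phir_antimono) (auto simp: t_def divide_le_eq one_le_power mult_le_cancel_left1)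
    also have "phir (t / (1 + a) ^ j) + phir (t / (1 + a) ^ j) * (C * r ^ j)
        = phir (t / (1 + a) ^ j) * (1 + C * r ^ j)" by (simp add: algebra_simps)
    also have "\<dots> \<le> phir (t / (1 + a) ^ j) * exp (C * r ^ j)"
      using s by (intro mult_left_mono less_imp_le[OF phir_pos]) (auto simp: t_def)
    finally show ?thesis by simp
  qed
  show thesis
  proof (rule that[of "exp (C / (1 - r))"])
    fix n
    have "(1 + a) ^ n * norm (coef n s) = (\<Prod>j<n. (1 + a) * norm (J (s / of_real ((1 + a) ^ j))))"
      by (simp add: coef_def prod_norm prod.distrib)
    also have "\<dots> \<le> (\<Prod>j<n. phir (t / (1 + a) ^ j) * exp (C * r ^ j))"
      using a_pos by (intro prod_mono conjI step mult_nonneg_nonneg) auto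
    also have "\<dots> = pprod n t * exp (C * (\<Sum>j<n. r ^ j))"
      by (simp add: pprod_def prod.distrib exp_sum sum_distrib_left)
    also have "\<dots> \<le> pprod n t * exp (C * (1 / (1 - r)))"
    proof (intro mult_left_mono C0 iffD2[OF exp_le_cancel_iff])
      show "(\<Sum>j<n. r ^ j) \<le> 1 / (1 - r)"
        using r by (simp add: sum_gp_strict divide_right_mono)
      show "0 \<le> pprod n t" using pprod_bounds(1)[of t n] s by (simp add: t_def)
    qed
    finally show "norm (coef n s) \<le> exp (C / (1 - r)) * pprod n (Re s) / (1 + a) ^ n"
      using a_pos by (simp add: field_simps t_def)
  qed simp
qed

lemma norm_coef_le':
  assumes s: "0 < Re s" "regular s"
  obtains M where "0 \<le> M" "\<And>n. norm (coef n s) \<le> M * inverse (1 + a) ^ n"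
proof -
  obtain M where M: "0 \<le> M" "\<And>n. norm (coef n s) \<le> M * pprod n (Re s) / (1 + a) ^ n"
    using norm_coef_le[OF s] by blast
  have "norm (coef n s) \<le> M * inverse (1 + a) ^ n" for n
  proof (rule order_trans[OF M(2)])
    have "M * pprod n (Re s) / (1 + a) ^ n \<le> M * 1 / (1 + a) ^ n"
      using pprod_bounds[OF s(1), of n] M(1) by (intro divide_right_mono mult_left_mono) (auto intro: less_imp_le[OF pow_pos])
    thus "M * pprod n (Re s) / (1 + a) ^ n \<le> M * inverse (1 + a) ^ n"
      by (simp add: divide_inverse power_inverse)
  qed
  with M(1) that show ?thesis by blast
qed

lemma summable_geometric_a: "summable (\<lambda>n. M * inverse (1 + a) ^ n)"
  using a_pos by (intro summable_mult summable_geometric) (auto simp: field_simps)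

lemma summable_coef:
  assumes s: "0 < Re s" "regular s"
  shows "summable (\<lambda>n. norm (coef n s))"
proof -
  obtain M where M: "\<And>n. norm (coef n s) \<le> M * inverse (1 + a) ^ n" using norm_coef_le'[OF s] by blast
  show ?thesis by (rule summable_comparison_test'[OF summable_geometric_a[of M], of 0]) (use M in simp)
qed

lemma summable_coef_ksum:
  assumes s: "0 < Re s" "regular s"
  shows "summable (\<lambda>n. coef n s * ksum (s / of_real ((1 + a) ^ n)) f)"
proof -
  obtain K where K: "\<And>n. norm (ksum (s / of_real ((1 + a) ^ n)) f) \<le> K"
    using ksum_scaled_bounded[OF s] by blast
  show ?thesis
  proof (rule summable_comparison_test'[OF summable_mult2[OF summable_coef[OF s], of K], of 0])
    show "norm (coef n s * ksum (s / of_real ((1 + a) ^ n)) f) \<le> norm (coef n s) * K" for n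
      unfolding norm_mult by (intro mult_left_mono K) auto
  qed
qed

section \<open>The linear system at the nodes\<close>

definition H :: "(complex \<Rightarrow> complex) \<Rightarrow> complex \<Rightarrow> complex" where
  "H r s = (1 - phi s) / s - ksum s r"

definition N :: "complex set" where "N = (\<lambda>i. of_real (\<nu> i)) ` I"

text \<open>The equation at the node \<open>\<sigma>\<close> reads \<open>r \<sigma> = h \<sigma> + (\<Sum>\<tau>\<in>N. resp \<sigma> \<tau> * r \<tau>)\<close> with \<open>h\<close> independent of \<open>r\<close>.\<close>

definition resp :: "complex \<Rightarrow> complex \<Rightarrow> complex" where
  "resp \<sigma> \<tau> = - (\<Sum>n. coef n \<sigma> * ksum (\<sigma> / of_real ((1 + a) ^ n)) (\<lambda>\<nu>. if \<nu> = \<tau> then 1 else 0))"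

lemma finite_N: "finite N" using fin by (simp add: N_def)

text \<open>Different indices may share an exponent. Their weights are collected here, so that the
  system has one unknown per distinct node. In the FGM model the second exponential of one summand
  is the first exponential of the next.\<close>

lemma ksum_expand: "ksum s f = (\<Sum>\<tau>\<in>N. f \<tau> * ksum s (\<lambda>\<nu>. if \<nu> = \<tau> then 1 else 0))"
proof -
  have "(\<Sum>\<tau>\<in>N. f \<tau> * ksum s (\<lambda>\<nu>. if \<nu> = \<tau> then 1 else 0))
      = (\<Sum>i\<in>I. \<Sum>\<tau>\<in>N. if \<tau> = of_real (\<nu> i) then w i s * f \<tau> / (of_real ((1 + a) * \<nu> i) - s) else 0)"
    unfolding ksum_def sum_distrib_left by (subst sum.swap) (auto intro!: sum.cong)
  also have "\<dots> = ksum s f"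
    unfolding ksum_def using finite_N by (intro sum.cong refl) (subst sum.delta, auto simp: N_def)
  finally show ?thesis by simp
qed

lemma ksum_diff: "ksum s (\<lambda>x. f x - g x) = ksum s f - ksum s g"
  unfolding ksum_def sum_subtractf[symmetric] by (intro sum.cong) (auto simp: right_diff_distrib diff_divide_distrib)


text \<open>The candidate fixed point of \<open>adj\<close>, truncated after n terms for each node.
  Being a finite sum, it calls for finite linearity of \<open>adj\<close> and for no interchange
  with a series.\<close>

definition dsum :: "(complex \<Rightarrow> complex) \<Rightarrow> nat \<Rightarrow> real \<Rightarrow> complex" where
  "dsum x n u = (\<Sum>\<sigma>\<in>N. x \<sigma> * (\<Sum>k<n. coef k \<sigma> * exp (- (\<sigma> / of_real ((1 + a) ^ k)) * of_real u)))"

lemma N_cases: "\<sigma> \<in> N \<Longrightarrow> 0 < Re \<sigma> \<and> \<sigma> = of_real (Re \<sigma>)"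
  using nu_pos by (auto simp: N_def)

text \<open>By \<open>adj_exp\<close>, the k-th term goes to the (k+1)-st, since
  \<open>coef (Suc k)\<close> absorbs the factor J, minus a combination of node exponentials.
  Telescoping leaves the n-th term and the node exponentials, and the coefficients of the latter
  tend to 0 for a left null vector.\<close>

lemma dsum_minus_adj:
  assumes u: "0 \<le> u" and reg: "\<And>\<sigma>. \<sigma> \<in> N \<Longrightarrow> regular \<sigma>"
  shows "dsum x n u - adj (dsum x n) u =
    (\<Sum>\<tau>\<in>N. exp (- \<tau> * of_real u) * (x \<tau> + (\<Sum>\<sigma>\<in>N. x \<sigma> *
        (\<Sum>k<n. coef k \<sigma> * ksum (\<sigma> / of_real ((1 + a) ^ k)) (\<lambda>\<nu>. if \<nu> = \<tau> then 1 else 0)))))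
    - (\<Sum>\<sigma>\<in>N. x \<sigma> * (coef n \<sigma> * exp (- (\<sigma> / of_real ((1 + a) ^ n)) * of_real u)))"
proof -
  define e where "e \<sigma> k = exp (- (\<sigma> / of_real ((1 + a) ^ k)) * of_real u)" for \<sigma> :: complex and k
  define q where "q \<sigma> k = ksum (\<sigma> / of_real ((1 + a) ^ k)) (\<lambda>\<nu>. exp (- \<nu> * of_real u))" for \<sigma> k
  have bnd: "norm (exp (- (\<sigma> / of_real ((1 + a) ^ k)) * complex_of_real y)) \<le> 1" if "\<sigma> \<in> N" "0 \<le> y" for \<sigma> k y
    
    using N_cases[OF that(1)] that(2) by (intro norm_exp_le_1, unfold Re_scaled) (auto intro: less_imp_le[OF divide_pos_pos])
  have Te: "adj (\<lambda>x. exp (- (\<sigma> / of_real ((1 + a) ^ k)) * of_real x)) u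
      = J (\<sigma> / of_real ((1 + a) ^ k)) * e \<sigma> (Suc k) - q \<sigma> k" if s: "\<sigma> \<in> N" for \<sigma> k
  proof -
    have "0 < Re (\<sigma> / of_real ((1 + a) ^ k))" using N_cases[OF s] by (simp only: Re_scaled) simp
    from adj_exp[OF this u regular_ne[OF reg[OF s]]] show ?thesis
      by (simp add: e_def q_def mult.commute)
  qed
  \<comment> \<open>The double sum is flattened to one sum over pairs, to which
    \<open>adj_linear\<close> applies.\<close>
  have "dsum x n = (\<lambda>y. \<Sum>(\<sigma>, k)\<in>N \<times> {..<n}. (x \<sigma> * coef k \<sigma>) * exp (- (\<sigma> / of_real ((1 + a) ^ k)) * of_real y))"
    unfolding dsum_def by (simp add: sum.cartesian_product[symmetric] sum_distrib_left mult.assoc del: of_real_power)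
  hence "adj (dsum x n) u = adj (\<lambda>y. \<Sum>p\<in>N \<times> {..<n}. (x (fst p) * coef (snd p) (fst p)) *
      exp (- (fst p / of_real ((1 + a) ^ snd p)) * of_real y)) u" by (simp add: case_prod_beta)
  also have "\<dots> = (\<Sum>p\<in>N \<times> {..<n}. (x (fst p) * coef (snd p) (fst p)) *
      adj (\<lambda>y. exp (- (fst p / of_real ((1 + a) ^ snd p)) * of_real y)) u)"
    by (rule adj_linear[where K = 1]) (use finite_N u bnd in auto)
  also have "\<dots> = (\<Sum>\<sigma>\<in>N. x \<sigma> * (\<Sum>k<n. coef k \<sigma> * (J (\<sigma> / of_real ((1 + a) ^ k)) * e \<sigma> (Suc k) - q \<sigma> k)))"
    unfolding sum_distrib_left sum.cartesian_product
    by (intro sum.cong refl, clarify, unfold fst_conv snd_conv) (subst Te, auto)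
  finally have T: "adj (dsum x n) u = \<dots>" .
  have "dsum x n u - adj (dsum x n) u = (\<Sum>\<sigma>\<in>N. x \<sigma> *
      (\<Sum>k<n. (coef k \<sigma> * e \<sigma> k - coef (Suc k) \<sigma> * e \<sigma> (Suc k)) + coef k \<sigma> * q \<sigma> k))"
    unfolding T dsum_def sum_subtractf[symmetric] right_diff_distrib[symmetric] e_def[symmetric] coef_Suc
    by (intro sum.cong refl arg_cong2[where f="(*)"]) (simp add: algebra_simps)
  also have "\<dots> = (\<Sum>\<sigma>\<in>N. x \<sigma> * (e \<sigma> 0 - coef n \<sigma> * e \<sigma> n + (\<Sum>k<n. coef k \<sigma> * q \<sigma> k)))"
  proof (intro sum.cong refl arg_cong2[where f="(*)"])
    fix \<sigma>
    have "(\<Sum>k<n. coef k \<sigma> * e \<sigma> k - coef (Suc k) \<sigma> * e \<sigma> (Suc k)) = e \<sigma> 0 - coef n \<sigma> * e \<sigma> n"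
      by (subst sum_lessThan_telescope'[of "\<lambda>k. coef k \<sigma> * e \<sigma> k"]) (simp add: coef_def)
    thus "(\<Sum>k<n. (coef k \<sigma> * e \<sigma> k - coef (Suc k) \<sigma> * e \<sigma> (Suc k)) + coef k \<sigma> * q \<sigma> k)
        = e \<sigma> 0 - coef n \<sigma> * e \<sigma> n + (\<Sum>k<n. coef k \<sigma> * q \<sigma> k)"
      by (simp only: sum.distrib)
  qed
  also have "\<dots> = (\<Sum>\<sigma>\<in>N. x \<sigma> * e \<sigma> 0) + (\<Sum>\<sigma>\<in>N. x \<sigma> * (\<Sum>k<n. coef k \<sigma> * q \<sigma> k)) - (\<Sum>\<sigma>\<in>N. x \<sigma> * (coef n \<sigma> * e \<sigma> n))"
    by (simp add: ring_distribs sum.distrib sum_subtractf)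
  also have "(\<Sum>\<sigma>\<in>N. x \<sigma> * (\<Sum>k<n. coef k \<sigma> * q \<sigma> k)) =
     (\<Sum>\<tau>\<in>N. exp (- \<tau> * of_real u) * (\<Sum>\<sigma>\<in>N. x \<sigma> * (\<Sum>k<n. coef k \<sigma> * ksum (\<sigma> / of_real ((1 + a) ^ k)) (\<lambda>\<nu>. if \<nu> = \<tau> then 1 else 0))))"
  proof -
    have "(\<Sum>\<sigma>\<in>N. x \<sigma> * (\<Sum>k<n. coef k \<sigma> * q \<sigma> k))
      = (\<Sum>\<sigma>\<in>N. \<Sum>k<n. \<Sum>\<tau>\<in>N. exp (- \<tau> * of_real u) * (x \<sigma> * (coef k \<sigma> * ksum (\<sigma> / of_real ((1 + a) ^ k)) (\<lambda>\<nu>. if \<nu> = \<tau> then 1 else 0))))"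
      unfolding q_def by (subst ksum_expand) (simp add: sum_distrib_left mult_ac del: of_real_power)
    also have "\<dots> = (\<Sum>\<sigma>\<in>N. \<Sum>\<tau>\<in>N. \<Sum>k<n. exp (- \<tau> * of_real u) * (x \<sigma> * (coef k \<sigma> * ksum (\<sigma> / of_real ((1 + a) ^ k)) (\<lambda>\<nu>. if \<nu> = \<tau> then 1 else 0))))"
      by (intro sum.cong refl sum.swap)
    also have "\<dots> = (\<Sum>\<tau>\<in>N. \<Sum>\<sigma>\<in>N. \<Sum>k<n. exp (- \<tau> * of_real u) * (x \<sigma> * (coef k \<sigma> * ksum (\<sigma> / of_real ((1 + a) ^ k)) (\<lambda>\<nu>. if \<nu> = \<tau> then 1 else 0))))"
      by (rule sum.swap)
    finally show ?thesis by (simp add: sum_distrib_left del: of_real_power)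
  qed
  also have "(\<Sum>\<sigma>\<in>N. x \<sigma> * e \<sigma> 0) = (\<Sum>\<tau>\<in>N. exp (- \<tau> * of_real u) * x \<tau>)"
    by (simp add: e_def mult.commute)
  finally show ?thesis by (simp add: e_def sum.distrib ring_distribs del: of_real_power)
qed

lemma coef_tendsto_0:
  assumes "0 < Re s" "regular s"
  shows "(\<lambda>n. norm (coef n s)) \<longlonglongrightarrow> 0"
  using summable_LIMSEQ_zero[OF summable_coef[OF assms]] .

text \<open>The defect \<open>dsum - adj dsum\<close> is bounded by \<open>e n\<close>, uniformly on
  [0, infinity) because all exponentials are at most 1. In \<open>e n\<close>, the coefficient
  \<open>d n \<tau>\<close> tends to x \<tau> minus the sum of x \<sigma>
  \<open>resp \<sigma> \<tau>\<close>, which is 0 by hypothesis, and \<open>coef n\<close> tends to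
  0. Then \<open>almost_fixed_point_small\<close> passes from the defect to
  \<open>dsum\<close>.\<close>

lemma dsum_tendsto_0:
  assumes reg: "\<And>\<sigma>. \<sigma> \<in> N \<Longrightarrow> regular \<sigma>" and u: "0 \<le> u"
    and fix_x: "\<And>\<tau>. \<tau> \<in> N \<Longrightarrow> x \<tau> = (\<Sum>\<sigma>\<in>N. x \<sigma> * resp \<sigma> \<tau>)"
  shows "(\<lambda>n. dsum x n u) \<longlonglongrightarrow> 0"
proof -
  define d where "d n \<tau> = x \<tau> + (\<Sum>\<sigma>\<in>N. x \<sigma> *
        (\<Sum>k<n. coef k \<sigma> * ksum (\<sigma> / of_real ((1 + a) ^ k)) (\<lambda>\<nu>. if \<nu> = \<tau> then 1 else 0)))" for n \<tau>
  define e where "e n = (\<Sum>\<tau>\<in>N. norm (d n \<tau>)) + (\<Sum>\<sigma>\<in>N. norm (x \<sigma>) * norm (coef n \<sigma>))" for n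
  have pos: "0 < Re \<sigma>" if "\<sigma> \<in> N" for \<sigma> using N_cases[OF that] by simp
  have le1: "norm (exp (- (\<sigma> / of_real ((1 + a) ^ k)) * complex_of_real y)) \<le> 1" if "\<sigma> \<in> N" "0 \<le> y" for \<sigma> k y
    
    using pos[OF that(1)] that(2) by (intro norm_exp_le_1, unfold Re_scaled) (auto intro: less_imp_le[OF divide_pos_pos])
  have le1': "norm (exp (- \<sigma> * complex_of_real y)) \<le> 1" if "\<sigma> \<in> N" "0 \<le> y" for \<sigma> y
    using pos[OF that(1)] that(2) by (intro norm_exp_le_1) auto
  have d: "(\<lambda>n. d n \<tau>) \<longlonglongrightarrow> x \<tau> + (\<Sum>\<sigma>\<in>N. x \<sigma> * (- resp \<sigma> \<tau>))" if "\<tau> \<in> N" for \<tau>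
    unfolding d_def resp_def minus_minus
    by (intro tendsto_intros summable_LIMSEQ summable_coef_ksum pos reg)
  have d0: "(\<lambda>n. d n \<tau>) \<longlonglongrightarrow> 0" if "\<tau> \<in> N" for \<tau>
    using d[OF that] fix_x[OF that] by (simp add: sum_negf)
  have "e \<longlonglongrightarrow> (\<Sum>\<tau>\<in>N. norm (0::complex)) + (\<Sum>\<sigma>\<in>N. norm (x \<sigma>) * 0)"
    unfolding e_def by (intro tendsto_intros tendsto_norm d0 coef_tendsto_0 pos reg)
  hence e0: "(\<lambda>n. e n * (1 + a) / a) \<longlonglongrightarrow> 0"
    using tendsto_mult_right_zero[of e sequentially "(1 + a) / a"] by (simp add: mult.commute)
  have meas: "dsum x n \<in> borel_measurable borel" for n unfolding dsum_def by measurable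
  have bnd: "norm (dsum x n y) \<le> (\<Sum>\<sigma>\<in>N. norm (x \<sigma>) * (\<Sum>k<n. norm (coef k \<sigma>)))" if "0 \<le> y" for n y
    unfolding dsum_def
  proof (rule sum_norm_le)
    fix \<sigma> assume s: "\<sigma> \<in> N"
    have "norm (coef k \<sigma> * exp (- (\<sigma> / of_real ((1 + a) ^ k)) * complex_of_real y)) \<le> norm (coef k \<sigma>)" for k
      unfolding norm_mult[of "coef k \<sigma>"] by (intro mult_left_le le1 s that) auto
    thus "norm (x \<sigma> * (\<Sum>k<n. coef k \<sigma> * exp (- (\<sigma> / of_real ((1 + a) ^ k)) * complex_of_real y)))
        \<le> norm (x \<sigma>) * (\<Sum>k<n. norm (coef k \<sigma>))"
      unfolding norm_mult[of "x \<sigma>"] by (intro mult_left_mono sum_norm_le) auto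
  qed
  have small: "norm (dsum x n y - adj (dsum x n) y) \<le> e n" if y: "0 \<le> y" for n y
  proof (subst dsum_minus_adj[OF y reg], assumption, unfold d_def[symmetric] e_def, rule order_trans[OF norm_triangle_ineq4], rule add_mono; rule sum_norm_le)
    fix \<tau> assume "\<tau> \<in> N"
    thus "norm (exp (- \<tau> * complex_of_real y) * d n \<tau>) \<le> norm (d n \<tau>)"
      unfolding norm_mult[of _ "d n \<tau>"] by (intro mult_left_le_one_le le1' y) auto
  next
    fix \<sigma> assume s: "\<sigma> \<in> N"
    show "norm (x \<sigma> * (coef n \<sigma> * exp (- (\<sigma> / of_real ((1 + a) ^ n)) * complex_of_real y))) \<le> norm (x \<sigma>) * norm (coef n \<sigma>)"
      unfolding norm_mult[of "x \<sigma>"] norm_mult[of "coef n \<sigma>"]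
      by (intro mult_left_mono mult_left_le le1 s y) auto
  qed
  have "norm (dsum x n u) \<le> e n * (1 + a) / a" for n
    by (rule almost_fixed_point_small[OF meas bnd small u])
  thus ?thesis by (intro Lim_null_comparison[OF _ e0]) auto
qed

lemma binomial_exp:
  "(1 - exp (- s))^m = (\<Sum>l\<le>m. of_nat (m choose l) * (-1)^l * exp (- s * of_real (real l)))" for s :: complex
proof -
  have "(- exp (- s) + 1)^m = (\<Sum>l\<le>m. of_nat (m choose l) * (- exp (- s))^l * 1 ^ (m - l))"
    by (rule binomial_ring)
  also have "\<dots> = (\<Sum>l\<le>m. of_nat (m choose l) * (-1)^l * exp (- s * of_real (real l)))"
  proof (intro sum.cong refl)
    fix l
    have "exp (- s * of_real (real l)) = exp (- s) ^ l"
      using exp_of_nat_mult[of l "- s"] by (simp add: mult.commute)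
    thus "of_nat (m choose l) * (- exp (- s))^l * 1 ^ (m - l) = of_nat (m choose l) * (-1)^l * exp (- s * of_real (real l))"
      by (simp add: power_minus[of "exp (- s)"])
  qed
  finally show ?thesis by simp
qed

lemma norm_one_minus_exp:
  assumes "0 < Re s" "s = of_real (Re s)"
  shows "norm (1 - exp (- (s / of_real ((1 + a) ^ k)))) = 1 - exp (- (Re s / (1 + a) ^ k))"
proof -
  have "s / of_real ((1 + a) ^ k) = of_real (Re s / (1 + a) ^ k)" by (subst assms(2)) simp
  hence "1 - exp (- (s / of_real ((1 + a) ^ k))) = of_real (1 - exp (- (Re s / (1 + a) ^ k)))"
    by (simp only: of_real_minus[symmetric] exp_of_real of_real_diff of_real_1)
  moreover have "exp (- (Re s / (1 + a) ^ k)) \<le> 1"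
    using divide_pos_pos[OF assms(1) pow_pos, of k] by simp
  ultimately show ?thesis by (simp only: norm_of_real abs_of_nonneg diff_ge_0_iff_ge)
qed

text \<open>
  The \<open>m\<close>-th finite difference over the integers turns \<open>exp(-y u)\<close> into \<open>(1 - exp(-y))^m\<close>; for large
  \<open>m\<close> the largest exponent \<open>y\<close>, which is a node, dominates.
\<close>

lemma left_kernel_resp:
  assumes reg: "\<And>\<sigma>. \<sigma> \<in> N \<Longrightarrow> regular \<sigma>"
    and fix_x: "\<And>\<tau>. \<tau> \<in> N \<Longrightarrow> x \<tau> = (\<Sum>\<sigma>\<in>N. x \<sigma> * resp \<sigma> \<tau>)"
  shows "\<forall>\<sigma>\<in>N. x \<sigma> = 0"
proof (rule ccontr)
  assume nz: "\<not> (\<forall>\<sigma>\<in>N. x \<sigma> = 0)"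
  define P where "P = {\<sigma> \<in> N. x \<sigma> \<noteq> 0}"
  have P: "finite P" "P \<noteq> {}" using finite_N nz by (auto simp: P_def)
  define t where "t = Max (Re ` P)"
  have "t \<in> Re ` P" unfolding t_def using P by (intro Max_in) auto
  then obtain \<rho> where \<rho>: "\<rho> \<in> P" "Re \<rho> = t" by auto
  have \<rho>N: "\<rho> \<in> N" "x \<rho> \<noteq> 0" using \<rho> by (auto simp: P_def)
  have t_pos: "0 < t" using N_cases[OF \<rho>N(1)] \<rho> by auto
  have less_t: "Re \<sigma> < t" if "\<sigma> \<in> P" "\<sigma> \<noteq> \<rho>" for \<sigma>
  proof -
    have "Re \<sigma> \<le> t" unfolding t_def using P that by auto
    moreover have "Re \<sigma> \<noteq> t" using that \<rho> N_cases[of \<sigma>] N_cases[of \<rho>] by (auto simp: P_def)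
    ultimately show ?thesis by simp
  qed
  \<comment> \<open>An upper bound for all exponents but the leading one t: other nodes with nonzero
    coefficient lie below t, and the later exponents of \<rho> itself are at most t/(1+a). Inserting
    t/(1+a) also keeps the set nonempty.\<close>
  define y where "y = Max (insert (t / (1 + a)) (Re ` (P - {\<rho>})))"
  have y_less: "y < t" unfolding y_def using P less_t t_pos a_pos by (subst Max_less_iff) (auto simp: field_simps)
  have y_ge: "t / (1 + a) \<le> y" "\<And>\<sigma>. \<sigma> \<in> P \<Longrightarrow> \<sigma> \<noteq> \<rho> \<Longrightarrow> Re \<sigma> \<le> y" unfolding y_def using P by (auto intro!: Max_ge)
  have y_pos: "0 < y" using y_ge(1) t_pos a_pos by (meson divide_pos_pos less_le_trans one_plus_pos)
  define q where "q = 1 - exp (- y)"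
  define z where "z = 1 - exp (- t)"
  have q: "0 < q" "q < z" using y_less y_pos by (auto simp: q_def z_def)
  define C where "C = (\<Sum>\<sigma>\<in>N. norm (x \<sigma>) * (\<Sum>k. norm (coef k \<sigma>)))"
  \<comment> \<open>The limit of large u cannot isolate the largest exponent: exp(-t u) is then the
    smallest term, and the exponents accumulate at 0. The factor (1 - exp(-y))^m increases with y
    and singles out the leading term instead.\<close>
  define g where "g m n = (\<Sum>\<sigma>\<in>N. x \<sigma> * (\<Sum>k<n. coef k \<sigma> * (1 - exp (- (\<sigma> / of_real ((1 + a) ^ k)))) ^ m))" for m n
  have g_eq: "g m n = (\<Sum>l\<le>m. of_nat (m choose l) * (-1)^l * dsum x n (real l))" for m n
  proof -
    have "(\<Sum>l\<le>m. of_nat (m choose l) * (-1)^l * dsum x n (real l))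
       = (\<Sum>\<sigma>\<in>N. \<Sum>l\<le>m. of_nat (m choose l) * (-1)^l * (x \<sigma> * (\<Sum>k<n. coef k \<sigma> * exp (- (\<sigma> / of_real ((1 + a) ^ k)) * of_real (real l)))))"
      unfolding dsum_def sum_distrib_left by (rule sum.swap)
    also have "\<dots> = (\<Sum>\<sigma>\<in>N. x \<sigma> * (\<Sum>l\<le>m. \<Sum>k<n. coef k \<sigma> * (of_nat (m choose l) * (-1)^l * exp (- (\<sigma> / of_real ((1 + a) ^ k)) * of_real (real l)))))"
      by (simp add: sum_distrib_left mult_ac del: of_real_power)
    also have "\<dots> = (\<Sum>\<sigma>\<in>N. x \<sigma> * (\<Sum>k<n. \<Sum>l\<le>m. coef k \<sigma> * (of_nat (m choose l) * (-1)^l * exp (- (\<sigma> / of_real ((1 + a) ^ k)) * of_real (real l)))))"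
      by (intro sum.cong refl arg_cong2[where f="(*)"] sum.swap)
    finally show ?thesis unfolding g_def by (simp add: binomial_exp sum_distrib_left del: of_real_power)
  qed
  have g0: "g m \<longlonglongrightarrow> 0" for m
  proof -
    have "g m \<longlonglongrightarrow> (\<Sum>l\<le>m. of_nat (m choose l) * (-1)^l * 0)"
      unfolding g_eq by (intro tendsto_intros dsum_tendsto_0 reg fix_x) auto
    thus ?thesis by simp
  qed
  \<comment> \<open>The leading term is \<sigma> = \<rho>, k = 0, where \<open>coef\<close> is the
    empty product 1. Every other term has an exponent of at most y and hence a factor of at most
    q^m.\<close>
  have main: "norm (x \<rho>) * z ^ m \<le> C * q ^ m + norm (g m n)" if n: "0 < n" for m n
  proof -
    have split: "g m n - x \<rho> * (1 - exp (- \<rho>)) ^ m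
       = (\<Sum>\<sigma>\<in>N. x \<sigma> * (\<Sum>k<n. if \<sigma> = \<rho> \<and> k = 0 then 0 else coef k \<sigma> * (1 - exp (- (\<sigma> / of_real ((1 + a) ^ k)))) ^ m))"
    proof -
      have "x \<rho> * (1 - exp (- \<rho>)) ^ m = (\<Sum>\<sigma>\<in>N. if \<sigma> = \<rho> then x \<sigma> * (1 - exp (- \<sigma>)) ^ m else 0)"
        using finite_N \<rho>N by simp
      also have "\<dots> = (\<Sum>\<sigma>\<in>N. x \<sigma> * (\<Sum>k<n. if k = 0 then (if \<sigma> = \<rho> then coef k \<sigma> * (1 - exp (- (\<sigma> / of_real ((1 + a) ^ k)))) ^ m else 0) else 0))"
        using n by (intro sum.cong refl) (simp add: coef_def)
      finally show ?thesis
        unfolding g_def by (simp only: sum_subtractf[symmetric] right_diff_distrib[symmetric])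
          (auto intro!: sum.cong arg_cong2[where f="(*)"])
    qed
    have "norm (g m n - x \<rho> * (1 - exp (- \<rho>)) ^ m) \<le> (\<Sum>\<sigma>\<in>N. norm (x \<sigma>) * ((\<Sum>k. norm (coef k \<sigma>)) * q ^ m))"
      unfolding split
    proof (rule sum_norm_le)
      fix \<sigma> assume s: "\<sigma> \<in> N"
      show "norm (x \<sigma> * (\<Sum>k<n. if \<sigma> = \<rho> \<and> k = 0 then 0 else coef k \<sigma> * (1 - exp (- (\<sigma> / of_real ((1 + a) ^ k)))) ^ m))
         \<le> norm (x \<sigma>) * ((\<Sum>k. norm (coef k \<sigma>)) * q ^ m)"
      proof (cases "x \<sigma> = 0")
        case False
        hence sP: "\<sigma> \<in> P" using s by (simp add: P_def)
        have "norm (\<Sum>k<n. if \<sigma> = \<rho> \<and> k = 0 then 0 else coef k \<sigma> * (1 - exp (- (\<sigma> / of_real ((1 + a) ^ k)))) ^ m)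
           \<le> (\<Sum>k<n. norm (coef k \<sigma>) * q ^ m)"
        proof (rule sum_norm_le)
          fix k
          show "norm (if \<sigma> = \<rho> \<and> k = 0 then 0 else coef k \<sigma> * (1 - exp (- (\<sigma> / of_real ((1 + a) ^ k)))) ^ m)
             \<le> norm (coef k \<sigma>) * q ^ m"
          proof (cases "\<sigma> = \<rho> \<and> k = 0")
            case False
            have "Re \<sigma> / (1 + a) ^ k \<le> y"
            proof (cases "\<sigma> = \<rho>")
              case True
              with False obtain k' where k: "k = Suc k'" by (cases k) auto
              have "t / (1 + a) ^ k \<le> t / (1 + a)"
                unfolding k using t_pos a_pos by (intro divide_left_mono) (auto simp: mult_le_cancel_left1 one_le_power)
              thus ?thesis using True \<rho> y_ge by simp
            next
              case False
              have "Re \<sigma> / (1 + a) ^ k \<le> Re \<sigma>"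
                using N_cases[OF s] a_pos by (simp add: divide_le_eq mult_le_cancel_left1 one_le_power)
              thus ?thesis using y_ge(2)[OF sP False] by simp
            qed
            moreover have "0 \<le> Re \<sigma> / (1 + a) ^ k"
              using N_cases[OF s] by (intro less_imp_le divide_pos_pos) auto
            ultimately have "norm (1 - exp (- (\<sigma> / of_real ((1 + a) ^ k)))) ^ m \<le> q ^ m"
              unfolding norm_one_minus_exp[OF N_cases[OF s, THEN conjunct1] N_cases[OF s, THEN conjunct2]]
              by (intro power_mono) (auto simp: q_def)
            with False show ?thesis
              by (auto simp: norm_mult norm_power intro!: mult_left_mono simp del: of_real_power)
          qed (use q in auto)
        qed
        also have "\<dots> \<le> (\<Sum>k. norm (coef k \<sigma>)) * q ^ m"
          unfolding sum_distrib_right[symmetric] using N_cases[OF s] q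
          by (intro mult_right_mono sum_le_suminf summable_coef reg s) auto
        finally show ?thesis unfolding norm_mult by (intro mult_left_mono) auto
      qed simp
    qed
    also have "\<dots> = C * q ^ m" by (simp add: C_def sum_distrib_right mult.assoc)
    finally have "norm (g m n - x \<rho> * (1 - exp (- \<rho>)) ^ m) \<le> C * q ^ m" .
    moreover have "norm (x \<rho> * (1 - exp (- \<rho>)) ^ m) = norm (x \<rho>) * z ^ m"
      using norm_one_minus_exp[of \<rho> 0] N_cases[OF \<rho>N(1)] \<rho> by (simp add: norm_mult norm_power z_def)
    ultimately show ?thesis
      using norm_triangle_sub[of "x \<rho> * (1 - exp (- \<rho>)) ^ m" "g m n"] by (simp add: norm_minus_commute)
  qed
  \<comment> \<open>The limit in n is taken at fixed m, since \<open>g m n\<close> is not controlled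
    uniformly in m. Only afterwards does m grow, and q < z forces x \<rho> = 0.\<close>
  have le: "norm (x \<rho>) * z ^ m \<le> C * q ^ m" for m
  proof (rule tendsto_lowerbound)
    show "(\<lambda>n. C * q ^ m + norm (g m n)) \<longlonglongrightarrow> C * q ^ m"
      using tendsto_add[OF tendsto_const tendsto_norm_zero[OF g0[of m]]] by simp
    show "\<forall>\<^sub>F n in sequentially. norm (x \<rho>) * z ^ m \<le> C * q ^ m + norm (g m n)"
      using eventually_gt_at_top[of 0] by eventually_elim (rule main)
  qed simp
  have "norm (x \<rho>) \<le> C * (q / z) ^ m" for m
    using le[of m] q by (simp add: power_divide field_simps)
  moreover have "(\<lambda>m. C * (q / z) ^ m) \<longlonglongrightarrow> C * 0"
    using q by (intro tendsto_intros LIMSEQ_power_zero) auto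
  ultimately have "norm (x \<rho>) \<le> 0"
    using tendsto_lowerbound[of "\<lambda>m. C * (q / z) ^ m" "C * 0" sequentially "norm (x \<rho>)"] by simp
  with \<rho>N(2) show False by simp
qed

text \<open>The part (1 - phi s)/s of H cancels in the difference of two solutions, which therefore
  solves the homogeneous system with matrix \<open>resp\<close>. Its left null vectors vanish by
  \<open>left_kernel_resp\<close>, hence so do the right ones.\<close>

theorem node_system_unique:
  assumes reg: "\<And>\<sigma>. \<sigma> \<in> N \<Longrightarrow> regular \<sigma>"
    and r1: "\<And>\<sigma>. \<sigma> \<in> N \<Longrightarrow> (\<lambda>n. coef n \<sigma> * H r1 (\<sigma> / of_real ((1 + a) ^ n))) sums r1 \<sigma>"
    and r2: "\<And>\<sigma>. \<sigma> \<in> N \<Longrightarrow> (\<lambda>n. coef n \<sigma> * H r2 (\<sigma> / of_real ((1 + a) ^ n))) sums r2 \<sigma>"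
    and s: "\<sigma> \<in> N"
  shows "r1 \<sigma> = r2 \<sigma>"
proof -
  define y where "y = (\<lambda>\<sigma>. r1 \<sigma> - r2 \<sigma>)"
  have "y \<sigma> = 0"
  proof (rule left_kernel_trivial_imp_kernel_trivial[OF finite_N _ _ s, of resp])
    show "\<forall>\<sigma>\<in>N. x \<sigma> = 0" if "\<And>\<tau>. \<tau> \<in> N \<Longrightarrow> x \<tau> = (\<Sum>\<sigma>\<in>N. x \<sigma> * resp \<sigma> \<tau>)" for x
      using left_kernel_resp[OF reg that] .
    fix \<sigma> assume s: "\<sigma> \<in> N"
    have "(\<lambda>n. coef n \<sigma> * H r1 (\<sigma> / of_real ((1 + a) ^ n)) - coef n \<sigma> * H r2 (\<sigma> / of_real ((1 + a) ^ n))) sums y \<sigma>"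
      unfolding y_def by (intro sums_diff r1 r2 s)
    moreover have "coef n \<sigma> * H r1 (\<sigma> / of_real ((1 + a) ^ n)) - coef n \<sigma> * H r2 (\<sigma> / of_real ((1 + a) ^ n))
       = (\<Sum>\<tau>\<in>N. - (coef n \<sigma> * ksum (\<sigma> / of_real ((1 + a) ^ n)) (\<lambda>\<nu>. if \<nu> = \<tau> then 1 else 0)) * y \<tau>)" for n
    proof -
      have "coef n \<sigma> * H r1 (\<sigma> / of_real ((1 + a) ^ n)) - coef n \<sigma> * H r2 (\<sigma> / of_real ((1 + a) ^ n))
         = - (coef n \<sigma> * ksum (\<sigma> / of_real ((1 + a) ^ n)) y)"
        unfolding y_def ksum_diff by (simp add: H_def ring_distribs del: of_real_power)
      thus ?thesis
        by (subst (asm) ksum_expand) (simp add: sum_distrib_left sum_negf mult_ac del: of_real_power)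
    qed
    ultimately have 1: "(\<lambda>n. \<Sum>\<tau>\<in>N. - (coef n \<sigma> * ksum (\<sigma> / of_real ((1 + a) ^ n)) (\<lambda>\<nu>. if \<nu> = \<tau> then 1 else 0)) * y \<tau>) sums y \<sigma>"
      by simp
    have "(\<lambda>n. \<Sum>\<tau>\<in>N. - (coef n \<sigma> * ksum (\<sigma> / of_real ((1 + a) ^ n)) (\<lambda>\<nu>. if \<nu> = \<tau> then 1 else 0)) * y \<tau>)
        sums (\<Sum>\<tau>\<in>N. resp \<sigma> \<tau> * y \<tau>)"
      unfolding resp_def using N_cases[OF s]
      by (intro sums_sum sums_mult2 sums_minus summable_sums summable_coef_ksum reg s) auto
    with 1 show "y \<sigma> = (\<Sum>\<tau>\<in>N. resp \<sigma> \<tau> * y \<tau>)" by (rule sums_unique2)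
  qed
  thus ?thesis by (simp add: y_def)
qed


section \<open>The functional equation from conditioning on the first gain\<close>

sublocale DL: pair_sigma_finite D "lborel :: real measure" ..

lemma integrable_D_lborel:
  fixes g :: "(real \<times> real) \<times> real \<Rightarrow> complex"
  assumes g [measurable]: "g \<in> borel_measurable (D \<Otimes>\<^sub>M lborel)"
    and b: "AE z in D. (\<integral>\<^sup>+x. norm (g (z, x)) \<partial>lborel) \<le> ennreal C"
  shows "integrable (D \<Otimes>\<^sub>M lborel) g"
proof (rule integrableI_bounded)
  have "(\<integral>\<^sup>+p. norm (g p) \<partial>(D \<Otimes>\<^sub>M lborel)) = (\<integral>\<^sup>+z. \<integral>\<^sup>+x. norm (g (z, x)) \<partial>lborel \<partial>D)"
    by (subst lborel.nn_integral_fst[symmetric]) auto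
  also have "\<dots> \<le> (\<integral>\<^sup>+z. ennreal C \<partial>D)" by (rule nn_integral_mono_AE[OF b])
  also have "\<dots> < \<infinity>" by (simp add: D.emeasure_space_1)
  finally show "(\<integral>\<^sup>+p. norm (g p) \<partial>(D \<Otimes>\<^sub>M lborel)) < \<infinity>" .
qed (rule g)

lemma nn_integral_exp_shifted:
  assumes "0 < t"
  shows "(\<integral>\<^sup>+u. ennreal (indicator {c..} u * exp (- (t * ((u - c) / (1 + a))))) \<partial>lborel) = ennreal ((1 + a) / t)"
proof -
  have "(\<integral>\<^sup>+u. ennreal (indicator {c..} u * exp (- (t * ((u - c) / (1 + a))))) \<partial>lborel)
     = ennreal \<bar>1 + a\<bar> * (\<integral>\<^sup>+v. ennreal (indicator {c..} (c + (1 + a) * v) * exp (- (t * ((c + (1 + a) * v - c) / (1 + a))))) \<partial>lborel)"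
    using a_pos by (intro nn_integral_real_affine) auto
  also have "(\<integral>\<^sup>+v. ennreal (indicator {c..} (c + (1 + a) * v) * exp (- (t * ((c + (1 + a) * v - c) / (1 + a))))) \<partial>lborel)
     = (\<integral>\<^sup>+v. indicator {0<..} v * ennreal (exp (- (t * v))) \<partial>lborel)"
    using AE_lborel_singleton[of "0::real"] a_pos
    by (intro nn_integral_cong_AE)
       (auto elim!: eventually_mono split: split_indicator simp: zero_le_mult_iff)
  finally show ?thesis
    unfolding nn_integral_exp_Ioi[OF assms] using a_pos assms
    by (simp add: ennreal_mult[symmetric] del: ennreal_plus)
qed

text \<open>The recursion is integrated against exp(-s x). The part x < B contributes (1 - exp(-s
  B))/s; on the rest, the substitution u = (1+a)(x-B)+C moves the first-gain operator from R to the
  exponential, where \<open>adj_exp\<close> evaluates it.\<close>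

lemma laplace_functional_equation:
  fixes R :: "real \<Rightarrow> real"
  assumes s: "0 < Re s" and reg: "\<And>i. i \<in> I \<Longrightarrow> s \<noteq> of_real ((1 + a) * \<nu> i)"
    and R [measurable]: "R \<in> borel_measurable borel" and R01: "\<And>x. 0 \<le> R x" "\<And>x. R x \<le> 1"
    and rec: "\<And>x. 0 < x \<Longrightarrow> R x = (\<integral>z. (if x < fst z then 1 else R ((1 + a) * (x - fst z) + snd z)) \<partial>D)"
  shows "laplace R s = J s * laplace R (s / of_real (1 + a)) + H (laplace R) s"
proof -
  define g where "g z x = indicator {0<..} x *\<^sub>R (exp (- s * complex_of_real x) *
     complex_of_real (if x < fst z then 1 else R ((1 + a) * (x - fst z) + snd z)))" for z :: "real \<times> real" and x
  \<comment> \<open>The part x \<ge> B of the integrand in the variable u: the condition becomes C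
    \<le> u, and 1/(1+a) is the Jacobian.\<close>
  define h where "h z u = (if snd z \<le> u then
     exp (- s * complex_of_real (fst z + (u - snd z) / (1 + a))) * complex_of_real (R u) / of_real (1 + a) else 0)" for z :: "real \<times> real" and u
  have nR: "norm (complex_of_real (R x)) \<le> 1" for x using R01[of x] by simp
  have [measurable]: "case_prod g \<in> borel_measurable (D \<Otimes>\<^sub>M lborel)"
    unfolding g_def by measurable
  have [measurable]: "case_prod h \<in> borel_measurable (D \<Otimes>\<^sub>M lborel)"
    unfolding h_def by measurable
  have ig: "integrable (D \<Otimes>\<^sub>M lborel) (case_prod g)"
  proof (rule integrable_D_lborel[where C = "1 / Re s"])
    show "AE z in D. (\<integral>\<^sup>+x. norm (case_prod g (z, x)) \<partial>lborel) \<le> ennreal (1 / Re s)"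
    proof (rule AE_I2)
      fix z
      have "(\<integral>\<^sup>+x. norm (case_prod g (z, x)) \<partial>lborel) \<le> (\<integral>\<^sup>+x. indicator {0<..} x * ennreal (exp (- (Re s * x))) \<partial>lborel)"
        using R01 by (intro nn_integral_mono)
          (auto simp: g_def norm_mult abs_of_nonneg intro!: ennreal_leI mult_left_le split: split_indicator)
      thus "(\<integral>\<^sup>+x. norm (case_prod g (z, x)) \<partial>lborel) \<le> ennreal (1 / Re s)"
        unfolding nn_integral_exp_Ioi[OF s] .
    qed
  qed measurable
  have ih: "integrable (D \<Otimes>\<^sub>M lborel) (case_prod h)"
  proof (rule integrable_D_lborel[where C = "(1 + a) / Re s"])
    show "AE z in D. (\<integral>\<^sup>+u. norm (case_prod h (z, u)) \<partial>lborel) \<le> ennreal ((1 + a) / Re s)"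
      using D_pos
    proof eventually_elim
      case (elim z)
      have "norm (h z u) \<le> indicator {snd z..} u * exp (- (Re s * ((u - snd z) / (1 + a))))" for u
      proof (cases "snd z \<le> u")
        case True
        have "norm (h z u) \<le> (exp (- (Re s * (fst z + (u - snd z) / (1 + a)))) * 1) / 1"
          unfolding h_def if_P[OF True] norm_divide norm_mult norm_of_real
          using True a_pos R01[of u] by (intro frac_le mult_mono) auto
        also have "\<dots> \<le> exp (- (Re s * ((u - snd z) / (1 + a))))"
          using elim s by (simp add: distrib_left)
        finally show ?thesis using True by simp
      qed (simp add: h_def)
      hence "(\<integral>\<^sup>+u. norm (case_prod h (z, u)) \<partial>lborel)
          \<le> (\<integral>\<^sup>+u. ennreal (indicator {snd z..} u * exp (- (Re s * ((u - snd z) / (1 + a))))) \<partial>lborel)"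
        by (intro nn_integral_mono ennreal_leI) simp
      thus ?case unfolding nn_integral_exp_shifted[OF s] .
    qed
  qed measurable
  have gh: "AE z in D. (\<integral>x. g z x \<partial>lborel) = (1 - exp (- s * complex_of_real (fst z))) / s + (\<integral>u. h z u \<partial>lborel)"
    using D_pos
  proof eventually_elim
    case (elim z)
    define g2 where "g2 x = indicator {fst z..} x *\<^sub>R
        (exp (- s * complex_of_real x) * complex_of_real (R ((1 + a) * (x - fst z) + snd z)))" for x
    have [measurable]: "g2 \<in> borel_measurable borel" unfolding g2_def by measurable
    have 1: "(\<integral>x. g z x \<partial>lborel) = (\<integral>x. indicator {0..fst z} x *\<^sub>R exp (complex_of_real x * (- s)) + g2 x \<partial>lborel)"
    proof (rule integral_cong_AE)
      show "AE x in lborel. g z x = indicator {0..fst z} x *\<^sub>R exp (complex_of_real x * (- s)) + g2 x"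
        using AE_lborel_singleton[of 0] AE_lborel_singleton[of "fst z"]
        by eventually_elim (use elim in \<open>auto simp: g_def g2_def mult.commute split: split_indicator\<close>)
    qed (auto simp: g_def g2_def)
    have i2: "integrable lborel g2"
    proof (rule Bochner_Integration.integrable_bound)
      have "integrable lborel (\<lambda>x. indicator {0<..} x *\<^sub>R (exp (- s * complex_of_real x) *
          complex_of_real (R ((1 + a) * (x - fst z) + snd z))))"
        by (rule integrable_exp_Ioi_bounded[OF s _ nR]) measurable
      thus "integrable lborel (\<lambda>x. indicator {0<..} x *\<^sub>R (exp (- s * complex_of_real x) *
          complex_of_real (R ((1 + a) * (x - fst z) + snd z))))" .
      show "AE x in lborel. norm (g2 x) \<le> norm (indicator {0<..} x *\<^sub>R (exp (- s * complex_of_real x) *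
          complex_of_real (R ((1 + a) * (x - fst z) + snd z))))"
        using elim by (auto simp: g2_def split: split_indicator)
    qed measurable
    have i1: "integrable lborel (\<lambda>x. indicator {0..fst z} x *\<^sub>R exp (complex_of_real x * (- s)))"
      by (rule borel_integrable_compact) (auto intro!: continuous_intros)
    have s0: "- s \<noteq> 0" using s by auto
    have "(\<integral>x. g2 x \<partial>lborel) = (\<integral>u. g2 ((fst z - snd z / (1 + a)) + (1 / (1 + a)) * u) \<partial>lborel) /\<^sub>R (1 + a)"
      using a_pos by (subst lborel_integral_real_affine[where c = "1 / (1 + a)" and t = "fst z - snd z / (1 + a)"])
        (auto simp: divide_inverse)
    also have "\<dots> = (\<integral>u. g2 ((fst z - snd z / (1 + a)) + (1 / (1 + a)) * u) /\<^sub>R (1 + a) \<partial>lborel)"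
      by simp
    also have "\<dots> = (\<integral>u. h z u \<partial>lborel)"
    proof (intro Bochner_Integration.integral_cong refl)
      fix u
      have e: "(fst z - snd z / (1 + a)) + (1 / (1 + a)) * u = fst z + (u - snd z) / (1 + a)"
        by (simp add: diff_divide_distrib)
      have "(1 + a) * ((fst z + (u - snd z) / (1 + a)) - fst z) + snd z = u" using a_pos by simp
      moreover have "fst z \<le> fst z + (u - snd z) / (1 + a) \<longleftrightarrow> snd z \<le> u"
        using a_pos by (simp add: zero_le_divide_iff)
      ultimately show "g2 ((fst z - snd z / (1 + a)) + (1 / (1 + a)) * u) /\<^sub>R (1 + a) = h z u"
        unfolding e g2_def h_def
        by (simp add: scaleR_conv_of_real divide_inverse split: split_indicator del: of_real_add of_real_diff)
    qed
    finally have 2: "(\<integral>x. g2 x \<partial>lborel) = (\<integral>u. h z u \<partial>lborel)" .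
    have "(exp (complex_of_real (fst z) * - s) - 1) / (- s) = (1 - exp (- s * complex_of_real (fst z))) / s"
      using s0 by (simp add: divide_simps mult.commute)
    thus ?case
      unfolding 1 Bochner_Integration.integral_add[OF i1 i2] 2
      using integral_exp_Icc[OF s0, of "fst z"] elim by simp
  qed
  have "laplace R s = (\<integral>x. (\<integral>z. g z x \<partial>D) \<partial>lborel)"
    unfolding laplace_def set_lebesgue_integral_def
  proof (intro Bochner_Integration.integral_cong refl)
    fix x
    show "indicator {0<..} x *\<^sub>R (exp (- s * complex_of_real x) * complex_of_real (R x)) = (\<integral>z. g z x \<partial>D)"
    proof (cases "0 < x")
      case True
      show ?thesis
        unfolding g_def integral_scaleR_right integral_mult_right_zero integral_complex_of_real rec[OF True, symmetric] ..
    qed (simp add: g_def)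
  qed
  also have "\<dots> = (\<integral>z. (\<integral>x. g z x \<partial>lborel) \<partial>D)" by (rule DL.Fubini_integral[OF ig])
  also have "\<dots> = (\<integral>z. (1 - exp (- s * complex_of_real (fst z))) / s + (\<integral>u. h z u \<partial>lborel) \<partial>D)"
    by (rule integral_cong_AE[OF _ _ gh]) measurable
  also have "\<dots> = (\<integral>z. (1 - exp (- s * complex_of_real (fst z))) / s \<partial>D) + (\<integral>z. (\<integral>u. h z u \<partial>lborel) \<partial>D)"
    using DL.integrable_fst'[OF ih] phi_integrable[OF s] by (intro Bochner_Integration.integral_add) auto
  also have "(\<integral>z. (1 - exp (- s * complex_of_real (fst z))) / s \<partial>D) = (1 - phi s) / s"
    unfolding phi_def using phi_integrable[OF s] by (simp add: D.prob_space)
  also have "(\<integral>z. (\<integral>u. h z u \<partial>lborel) \<partial>D) = (\<integral>u. (\<integral>z. h z u \<partial>D) \<partial>lborel)"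
    by (rule DL.Fubini_integral[OF ih, symmetric])
  also have "\<dots> = (\<integral>u. J s * (indicator {0<..} u *\<^sub>R (exp (- (s / of_real (1 + a)) * of_real u) * complex_of_real (R u)))
      - (\<Sum>i\<in>I. w i s * (indicator {0<..} u *\<^sub>R (exp (- of_real (\<nu> i) * of_real u) * complex_of_real (R u))) / (of_real ((1 + a) * \<nu> i) - s)) \<partial>lborel)"
  proof (intro Bochner_Integration.integral_cong refl)
    fix u
    show "(\<integral>z. h z u \<partial>D) = J s * (indicator {0<..} u *\<^sub>R (exp (- (s / of_real (1 + a)) * of_real u) * complex_of_real (R u)))
      - (\<Sum>i\<in>I. w i s * (indicator {0<..} u *\<^sub>R (exp (- of_real (\<nu> i) * of_real u) * complex_of_real (R u))) / (of_real ((1 + a) * \<nu> i) - s))"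
    proof (cases "0 < u")
      case True
      \<comment> \<open>For fixed u, the value R u is constant in z; the other factor is the
        integrand of \<open>adj\<close> for the exponential.\<close>
      have "(\<integral>z. h z u \<partial>D) = of_real (R u) * adj (\<lambda>x. exp (- s * of_real x)) u"
      proof -
        have "(\<integral>z. h z u \<partial>D) = (\<integral>z. of_real (R u) * (indicator {..u} (snd z) *\<^sub>R
            exp (- s * of_real (fst z + (u - snd z) / (1 + a))) / of_real (1 + a)) \<partial>D)"
          by (intro Bochner_Integration.integral_cong) (auto simp: h_def)
        thus ?thesis unfolding adj_def by (simp only: integral_mult_right_zero integral_divide_zero)
      qed
      also have "\<dots> = of_real (R u) * (J s * exp (- (s / of_real (1 + a)) * of_real u) - ksum s (\<lambda>\<nu>. exp (- \<nu> * of_real u)))"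
        by (subst adj_exp[OF s _ reg]) (use True in auto)
      finally show ?thesis using True
        by (simp add: ksum_def right_diff_distrib sum_distrib_left mult_ac)
    next
      case False
      have "(\<integral>z. h z u \<partial>D) = (\<integral>z. 0 \<partial>D)"
      proof (rule integral_cong_AE)
        show "AE z in D. h z u = 0"
          using D_pos by eventually_elim (use False in \<open>auto simp: h_def\<close>)
      qed measurable
      thus ?thesis using False by simp
    qed
  qed
  also have "\<dots> = J s * laplace R (s / of_real (1 + a)) - ksum s (laplace R)"
  proof -
    have s': "0 < Re (s / of_real (1 + a))" unfolding Re_divide_of_real using s by simp
    define E where "E \<sigma> u = indicator {0<..} u *\<^sub>R (exp (- \<sigma> * of_real u) * complex_of_real (R u))" for \<sigma> :: complex and u
    have lap: "laplace R \<sigma> = (\<integral>u. E \<sigma> u \<partial>lborel)" for \<sigma>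
      by (simp add: laplace_def set_lebesgue_integral_def E_def)
    have int: "integrable lborel (E \<sigma>)" if "0 < Re \<sigma>" for \<sigma>
      unfolding E_def by (rule integrable_exp_Ioi_bounded[OF that _ nR]) measurable
    have int\<nu>: "integrable lborel (\<lambda>u. w i s * E (of_real (\<nu> i)) u / (of_real ((1 + a) * \<nu> i) - s))" if "i \<in> I" for i
      using nu_pos[OF that] by (intro integrable_divide_zero integrable_mult_right int) simp
    show ?thesis
      unfolding E_def[symmetric] lap ksum_def
      by (subst Bochner_Integration.integral_diff)
         (auto intro!: integrable_mult_right Bochner_Integration.integrable_sum int s' int\<nu>
           simp only: integral_mult_right_zero integral_divide_zero Bochner_Integration.integral_sum[OF int\<nu>])
  qed
  finally show ?thesis by (simp add: H_def)
qed

end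

section \<open>The ruin probability\<close>

text \<open>The recursion unrolled from the front: after one gain the process restarts with shifted
  sequences. This matches the splitting of the sequence space into its first coordinate and the
  rest.\<close>

lemma post_gain_Suc_shift:
  "post_gain a x bs cs (Suc n) = post_gain a ((1 + a) * (x - bs 0) + cs 0) (\<lambda>n. bs (Suc n)) (\<lambda>n. cs (Suc n)) n"
  by (induction n) auto

text \<open>The nonnegative gains are dropped and the growth is discounted. An undershoot at the
  n-th stage thus forces the sum of B_i/(1+a)^i over i \<le> n to exceed x, a condition on the B_i
  alone.\<close>

lemma post_gain_ge:
  assumes "0 < a" "\<And>n. 0 \<le> cs n"
  shows "(1 + a) ^ n * (x - (\<Sum>i<n. bs i / (1 + a) ^ i)) \<le> post_gain a x bs cs n"
proof (induction n)
  case (Suc n)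
  have "(1 + a) ^ Suc n * (x - (\<Sum>i<Suc n. bs i / (1 + a) ^ i))
     = (1 + a) * ((1 + a) ^ n * (x - (\<Sum>i<n. bs i / (1 + a) ^ i)) - bs n)"
    using assms(1) by (simp add: field_simps)
  also have "\<dots> \<le> (1 + a) * (post_gain a x bs cs n - bs n)"
    using Suc assms(1) by (intro mult_left_mono) auto
  also have "\<dots> \<le> post_gain a x bs cs (Suc n)" using assms(2)[of n] by simp
  finally show ?case .
qed simp

lemma nn_integral_exp_Ioo:
  assumes t: "0 < (t::real)" and m: "0 \<le> m"
  shows "(\<integral>\<^sup>+x. indicator {0<..} x * ennreal (exp (- (t * x))) * indicator {x. x < m} x \<partial>lborel)
       = ennreal ((1 - exp (- (t * m))) / t)"
proof -
  have "(\<integral>\<^sup>+x. indicator {0<..} x * ennreal (exp (- (t * x))) * indicator {x. x < m} x \<partial>lborel)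
      = (\<integral>\<^sup>+x. ennreal (exp (- (t * x))) * indicator {0..m} x \<partial>lborel)"
    using AE_lborel_singleton[of "0::real"] AE_lborel_singleton[of m]
    by (intro nn_integral_cong_AE) (auto elim!: eventually_elim2 split: split_indicator)
  also have "\<dots> = ennreal (- exp (- (t * m)) / t - - exp (- (t * 0)) / t)"
    by (rule nn_integral_FTC_Icc) (use t m in \<open>auto intro!: derivative_eq_intros\<close>)
  finally show ?thesis by (simp add: diff_divide_distrib)
qed

section \<open>The embedded chain on the space of i.i.d. sequences\<close>

context dual_risk begin

sublocale Seq: sequence_space D
  unfolding sequence_space_def by (intro product_prob_spaceI prob_D)

text \<open>Ruin read off at the gains: the surplus runs out before the next gain comes. The
  inequality is strict because the gain counts at its own instant: a surplus that would reach 0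
  exactly then has already been raised to C_n > 0.\<close>

definition hit :: "real \<Rightarrow> (nat \<Rightarrow> real \<times> real) \<Rightarrow> bool" where
  "hit x z \<longleftrightarrow> (\<exists>n. post_gain a x (\<lambda>n. fst (z n)) (\<lambda>n. snd (z n)) n < fst (z n))"

definition hit_prob :: "real \<Rightarrow> real" where
  "hit_prob x = measure Seq.S {z \<in> space Seq.S. hit x z}"

lemma fst_measurable_S [measurable]: "(\<lambda>z. fst (z i)) \<in> borel_measurable Seq.S"
  and snd_measurable_S [measurable]: "(\<lambda>z. snd (z i)) \<in> borel_measurable Seq.S"
  by measurable

lemma post_gain_measurable [measurable]:
  assumes [measurable]: "f \<in> borel_measurable M" "g \<in> measurable M Seq.S"
  shows "(\<lambda>p. post_gain a (f p) (\<lambda>n. fst (g p n)) (\<lambda>n. snd (g p n)) n) \<in> borel_measurable M"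
proof -
  have [measurable]: "(\<lambda>p. fst (g p i)) \<in> borel_measurable M" "(\<lambda>p. snd (g p i)) \<in> borel_measurable M" for i
    using measurable_compose[OF assms(2) fst_measurable_S[of i]] measurable_compose[OF assms(2) snd_measurable_S[of i]]
    by auto
  show ?thesis by (induction n) simp_all
qed

lemma hit_measurable [measurable]:
  assumes [measurable]: "f \<in> borel_measurable M" "g \<in> measurable M Seq.S"
  shows "Measurable.pred M (\<lambda>p. hit (f p) (g p))"
proof -
  have [measurable]: "(\<lambda>p. fst (g p i)) \<in> borel_measurable M" for i
    using measurable_compose[OF assms(2) fst_measurable_S[of i]] by auto
  show ?thesis unfolding hit_def by measurable
qed

lemma hit_prob_eq_integral: "hit_prob x = (\<integral>z. (if hit x z then 1 else 0) \<partial>Seq.S)"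
proof -
  have "(\<integral>z. (if hit x z then 1 else 0) \<partial>Seq.S) = (\<integral>z. indicator {z \<in> space Seq.S. hit x z} z \<partial>Seq.S)"
    by (intro Bochner_Integration.integral_cong) auto
  also have "\<dots> = hit_prob x"
    unfolding hit_prob_def by (subst Bochner_Integration.integral_indicator) (auto intro: arg_cong)
  finally show ?thesis ..
qed

lemma hit_prob_measurable [measurable]: "hit_prob \<in> borel_measurable borel"
  unfolding hit_prob_eq_integral[abs_def] by measurable

lemma hit_case_nat:
  "hit x (case_nat s z) \<longleftrightarrow> x < fst s \<or> hit ((1 + a) * (x - fst s) + snd s) z"
proof -
  have ex_nat: "(\<exists>n. P n) \<longleftrightarrow> P 0 \<or> (\<exists>n. P (Suc n))" for P :: "nat \<Rightarrow> bool" by (metis not0_implies_Suc)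
  show ?thesis
    unfolding hit_def by (subst ex_nat) (simp add: post_gain_Suc_shift del: post_gain.simps(2))
qed

text \<open>An i.i.d. sequence has the law of one pair put in front of an independent copy of the
  sequence (\<open>PiM_iter\<close>), so conditioning on the first gain is an instance of
  Fubini.\<close>

lemma hit_prob_rec:
  "hit_prob x = (\<integral>s. (if x < fst s then 1 else hit_prob ((1 + a) * (x - fst s) + snd s)) \<partial>D)"
proof -
  interpret DS: pair_sigma_finite D Seq.S ..
  interpret P: pair_prob_space D Seq.S ..
  let ?h = "\<lambda>s z. if hit x (case_nat s z) then 1 else 0 :: real"
  have [measurable]: "(\<lambda>p. case_nat (fst p) (snd p)) \<in> measurable (D \<Otimes>\<^sub>M Seq.S) Seq.S"
    by measurable
  have "hit_prob x = (\<integral>z. (if hit x z then 1 else 0) \<partial>distr (D \<Otimes>\<^sub>M Seq.S) Seq.S (\<lambda>(s, \<omega>). case_nat s \<omega>))"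
    unfolding Seq.PiM_iter hit_prob_eq_integral ..
  also have "\<dots> = (\<integral>p. (if hit x (case_nat (fst p) (snd p)) then 1 else 0) \<partial>(D \<Otimes>\<^sub>M Seq.S))"
    by (subst integral_distr) (auto simp: case_prod_beta')
  also have "\<dots> = (\<integral>s. (\<integral>z. ?h s z \<partial>Seq.S) \<partial>D)"
    by (subst DS.integral_fst'[symmetric]) (auto intro!: P.integrable_const_bound[where B = 1])
  also have "\<dots> = (\<integral>s. (if x < fst s then 1 else hit_prob ((1 + a) * (x - fst s) + snd s)) \<partial>D)"
    by (intro Bochner_Integration.integral_cong refl) (auto simp: hit_case_nat hit_prob_eq_integral Seq.P.prob_space)
  finally show ?thesis .
qed

lemma hit_prob_bounds: "0 \<le> hit_prob x" "hit_prob x \<le> 1"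
  unfolding hit_prob_def by (auto intro: Seq.P.prob_le_1)

lemma S_pos: "AE z in Seq.S. \<forall>n. 0 < fst (z n) \<and> 0 < snd (z n)"
  unfolding AE_all_countable by (intro allI AE_PiM_component prob_D D_pos) auto

text \<open>Independence, by splitting off the first coordinate. The weights are generalised in the
  induction because the remaining sequence sees them shifted by one.\<close>

lemma nn_integral_exp_sum:
  assumes "\<And>i. 0 < \<kappa> i"
  shows "(\<integral>\<^sup>+z. ennreal (exp (- (\<Sum>i<n. \<kappa> i * fst (z i)))) \<partial>Seq.S) = ennreal (\<Prod>i<n. phir (\<kappa> i))"
  using assms
proof (induction n arbitrary: \<kappa>)
  case 0 show ?case by (simp add: Seq.P.emeasure_space_1)
next
  case (Suc n)
  interpret DS: pair_sigma_finite D Seq.S ..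
  have [measurable]: "(\<lambda>p. case_nat (fst p) (snd p)) \<in> measurable (D \<Otimes>\<^sub>M Seq.S) Seq.S"
    by measurable
  have "(\<integral>\<^sup>+z. ennreal (exp (- (\<Sum>i<Suc n. \<kappa> i * fst (z i)))) \<partial>Seq.S)
      = (\<integral>\<^sup>+z. ennreal (exp (- (\<Sum>i<Suc n. \<kappa> i * fst (z i)))) \<partial>distr (D \<Otimes>\<^sub>M Seq.S) Seq.S (\<lambda>(s, \<omega>). case_nat s \<omega>))"
    unfolding Seq.PiM_iter ..
  also have "\<dots> = (\<integral>\<^sup>+p. ennreal (exp (- (\<kappa> 0 * fst (fst p)))) *
       ennreal (exp (- (\<Sum>i<n. \<kappa> (Suc i) * fst (snd p i)))) \<partial>(D \<Otimes>\<^sub>M Seq.S))"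
    by (subst nn_integral_distr)
       (auto simp: case_prod_beta' sum.lessThan_Suc_shift ennreal_mult[symmetric] exp_add[symmetric]
         simp del: sum.lessThan_Suc intro!: nn_integral_cong)
  also have "\<dots> = (\<integral>\<^sup>+s. \<integral>\<^sup>+z. ennreal (exp (- (\<kappa> 0 * fst s))) *
       ennreal (exp (- (\<Sum>i<n. \<kappa> (Suc i) * fst (z i)))) \<partial>Seq.S \<partial>D)"
    by (subst Seq.P.nn_integral_fst[symmetric]) auto
  also have "\<dots> = (\<integral>\<^sup>+s. ennreal (exp (- (\<kappa> 0 * fst s))) * ennreal (\<Prod>i<n. phir (\<kappa> (Suc i))) \<partial>D)"
    using Suc.IH[of "\<lambda>i. \<kappa> (Suc i)"] Suc.prems by (simp add: nn_integral_cmult)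
  also have "\<dots> = ennreal (phir (\<kappa> 0)) * ennreal (\<Prod>i<n. phir (\<kappa> (Suc i)))"
  proof (subst nn_integral_multc)
    have "(\<integral>\<^sup>+s. ennreal (exp (- (\<kappa> 0 * fst s))) \<partial>D) = ennreal (phir (\<kappa> 0))"
      using phir_integrable[OF Suc.prems[of 0]] unfolding phir_def by (subst nn_integral_eq_integral) auto
    thus "(\<integral>\<^sup>+s. ennreal (exp (- (\<kappa> 0 * fst s))) \<partial>D) * ennreal (\<Prod>i<n. phir (\<kappa> (Suc i)))
      = ennreal (phir (\<kappa> 0)) * ennreal (\<Prod>i<n. phir (\<kappa> (Suc i)))" by simp
  qed auto
  also have "\<dots> = ennreal (\<Prod>i<Suc n. phir (\<kappa> i))"
    unfolding prod.lessThan_Suc_shift using Suc.prems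
    by (intro ennreal_mult[symmetric] prod_nonneg) (auto intro: less_imp_le[OF phir_pos])
  finally show ?case .
qed

text \<open>An exponential Markov inequality: the n-th gain time is at most k with probability at
  most e^k phir(1)^n, and phir 1 < 1 because B > 0. No moment of B is involved.\<close>

lemma gain_time_unbounded:
  "AE z in Seq.S. \<forall>K. \<exists>n. K < gain_time (\<lambda>n. fst (z n)) n"
proof -
  have "AE z in Seq.S. \<exists>n. real k < gain_time (\<lambda>n. fst (z n)) n" for k :: nat
  proof -
    define A where "A = {z \<in> space Seq.S. \<forall>n. gain_time (\<lambda>n. fst (z n)) n \<le> real k}"
    have [measurable]: "A \<in> sets Seq.S" unfolding A_def gain_time_def by measurable
    have bound: "emeasure Seq.S A \<le> ennreal (exp (real k) * phir 1 ^ n)" for n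
    proof -
      have "emeasure Seq.S A = (\<integral>\<^sup>+z. indicator A z \<partial>Seq.S)" by simp
      also have "\<dots> \<le> (\<integral>\<^sup>+z. ennreal (exp (real k)) * ennreal (exp (- (\<Sum>i<n. 1 * fst (z i)))) \<partial>Seq.S)"
        by (intro nn_integral_mono)
           (auto simp: A_def gain_time_def ennreal_mult[symmetric] exp_add[symmetric] split: split_indicator)
      also have "\<dots> = ennreal (exp (real k)) * ennreal (\<Prod>i<n. phir 1)"
        by (subst nn_integral_cmult) (auto simp only: nn_integral_exp_sum zero_less_one, measurable)
      finally show ?thesis by (simp add: ennreal_mult[symmetric] phir_pos less_imp_le)
    qed
    have "(\<lambda>n. ennreal (exp (real k) * phir 1 ^ n)) \<longlonglongrightarrow> ennreal (exp (real k) * 0)"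
      using phir_less_1[of 1] phir_pos[of 1]
      by (intro tendsto_ennrealI tendsto_mult tendsto_const LIMSEQ_power_zero) auto
    hence "emeasure Seq.S A \<le> 0"
      by (intro tendsto_lowerbound[where F = sequentially]) (use bound in auto)
    hence "A \<in> null_sets Seq.S" by auto
    hence "AE z in Seq.S. z \<notin> A" by (rule AE_not_in)
    thus ?thesis by (rule AE_mp) (auto simp: A_def not_le)
  qed
  hence "AE z in Seq.S. \<forall>k::nat. \<exists>n. real k < gain_time (\<lambda>n. fst (z n)) n" by (simp add: AE_all_countable)
  thus ?thesis
  proof eventually_elim
    case (elim z)
    show ?case
    proof
      fix K :: real
      obtain k where "K < real k" using reals_Archimedean2 by blast
      with elim show "\<exists>n. K < gain_time (\<lambda>n. fst (z n)) n" by (meson less_trans)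
    qed
  qed
qed

text \<open>Ruin from x forces x < T, where T is the limit of the discounted sums, so the transform
  is at most the mean of the integral of exp(-t x) over (0,T), that is (1 - E exp(-t T))/t. Any
  common lower bound P of the q_n(t) may stand for E exp(-t T), which avoids handling the limit at
  each rescaled argument.\<close>

lemma norm_laplace_hit_prob_le:
  assumes s: "0 < Re s" and P: "\<And>n. P \<le> pprod n (Re s)"
  shows "norm (laplace hit_prob s) \<le> (1 - P) / Re s"
proof -
  define t where "t = Re s"
  have t: "0 < t" using s by (simp add: t_def)
  have P1: "P \<le> 1" using P[of 0] by (simp add: pprod_def)
  \<comment> \<open>The cut \<open>max 0\<close> makes T n nonnegative and increasing in n at every
    point, not just almost surely, as the monotone limits below require.\<close>
  define T where "T n z = (\<Sum>i<n. max 0 (fst (z i)) / (1 + a) ^ i)" for n and z :: "nat \<Rightarrow> real \<times> real"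
  define f where "f x = indicator {0<..} x * ennreal (exp (- (t * x)))" for x
  have [measurable]: "T n \<in> borel_measurable Seq.S" for n unfolding T_def by measurable
  have [measurable]: "f \<in> borel_measurable borel" unfolding f_def by measurable
  have T0: "0 \<le> T n z" for n z unfolding T_def using a_pos by (intro sum_nonneg) auto
  have Tmono: "incseq (\<lambda>n. T n z)" for z
    unfolding T_def using a_pos by (intro incseq_SucI) simp
  interpret LS: pair_sigma_finite "lborel :: real measure" Seq.S ..
  have hit_le: "ennreal (hit_prob x) \<le> (SUP n. emeasure Seq.S {z \<in> space Seq.S. x < T n z})" for x
  proof -
    have "ennreal (hit_prob x) = emeasure Seq.S {z \<in> space Seq.S. hit x z}"
      unfolding hit_prob_def by (simp add: Seq.P.emeasure_eq_measure)
    also have "\<dots> \<le> emeasure Seq.S (\<Union>n. {z \<in> space Seq.S. x < T n z})"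
    proof (rule emeasure_mono_AE)
      show "AE z in Seq.S. z \<in> {z \<in> space Seq.S. hit x z} \<longrightarrow> z \<in> (\<Union>n. {z \<in> space Seq.S. x < T n z})"
        using S_pos
      proof eventually_elim
        case (elim z)
        show ?case
        proof
          assume "z \<in> {z \<in> space Seq.S. hit x z}"
          then obtain n where z: "z \<in> space Seq.S"
            and n: "post_gain a x (\<lambda>n. fst (z n)) (\<lambda>n. snd (z n)) n < fst (z n)" by (auto simp: hit_def)
          have "(1 + a) ^ n * (x - (\<Sum>i<n. fst (z i) / (1 + a) ^ i)) < fst (z n)"
            using post_gain_ge[OF a_pos, of "\<lambda>n. snd (z n)" n x "\<lambda>n. fst (z n)"] n elim by (force simp: less_imp_le)
          hence "x - (\<Sum>i<n. fst (z i) / (1 + a) ^ i) < fst (z n) / (1 + a) ^ n"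
            using a_pos by (simp add: pos_less_divide_eq mult.commute)
          moreover have "T (Suc n) z = (\<Sum>i<Suc n. fst (z i) / (1 + a) ^ i)"
            unfolding T_def using elim by (intro sum.cong) (auto simp: max_def less_imp_le not_le)
          ultimately have "x < T (Suc n) z" by simp
          with z show "z \<in> (\<Union>n. {z \<in> space Seq.S. x < T n z})" by blast
        qed
      qed
    qed measurable
    also have "\<dots> = (SUP n. emeasure Seq.S {z \<in> space Seq.S. x < T n z})"
      by (rule SUP_emeasure_incseq[symmetric])
         (use incseqD[OF Tmono] in \<open>auto simp: incseq_def intro: less_le_trans\<close>)
    finally show ?thesis .
  qed
  have each: "(\<integral>\<^sup>+x. f x * emeasure Seq.S {z \<in> space Seq.S. x < T n z} \<partial>lborel) \<le> ennreal ((1 - P) / t)" for n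
  proof -
    have exp_T: "(\<integral>\<^sup>+z. ennreal (exp (- (t * T n z))) \<partial>Seq.S) = ennreal (pprod n t)"
    proof -
      have "(\<integral>\<^sup>+z. ennreal (exp (- (t * T n z))) \<partial>Seq.S)
         = (\<integral>\<^sup>+z. ennreal (exp (- (\<Sum>i<n. (t / (1 + a) ^ i) * fst (z i)))) \<partial>Seq.S)"
      proof (rule nn_integral_cong_AE)
        show "AE z in Seq.S. ennreal (exp (- (t * T n z))) = ennreal (exp (- (\<Sum>i<n. (t / (1 + a) ^ i) * fst (z i))))"
          using S_pos
        proof eventually_elim
          case (elim z)
          hence "t * T n z = (\<Sum>i<n. (t / (1 + a) ^ i) * fst (z i))"
            unfolding T_def sum_distrib_left by (intro sum.cong) (auto simp: max_def less_imp_le not_le)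
          thus ?case by simp
        qed
      qed
      also have "\<dots> = ennreal (pprod n t)"
        unfolding pprod_def using t a_pos by (intro nn_integral_exp_sum) auto
      finally show ?thesis .
    qed
    have int: "integrable Seq.S (\<lambda>z. exp (- (t * T n z)))"
      using exp_T by (intro integrableI_nonneg) auto
    have exp_T': "(\<integral>z. exp (- (t * T n z)) \<partial>Seq.S) = pprod n t"
      using exp_T pprod_bounds[OF t, of n] by (subst integral_eq_nn_integral) auto
    have "(\<integral>\<^sup>+x. f x * emeasure Seq.S {z \<in> space Seq.S. x < T n z} \<partial>lborel)
       = (\<integral>\<^sup>+x. \<integral>\<^sup>+z. f x * indicator {x. x < T n z} x \<partial>Seq.S \<partial>lborel)"
    proof (intro nn_integral_cong)
      fix x
      have "f x * emeasure Seq.S {z \<in> space Seq.S. x < T n z}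
          = (\<integral>\<^sup>+z. f x * indicator {z \<in> space Seq.S. x < T n z} z \<partial>Seq.S)"
        by (subst nn_integral_cmult_indicator) auto
      also have "\<dots> = (\<integral>\<^sup>+z. f x * indicator {x. x < T n z} x \<partial>Seq.S)"
        by (intro nn_integral_cong) (auto split: split_indicator)
      finally show "f x * emeasure Seq.S {z \<in> space Seq.S. x < T n z} = \<dots>" .
    qed
    also have "\<dots> = (\<integral>\<^sup>+z. \<integral>\<^sup>+x. f x * indicator {x. x < T n z} x \<partial>lborel \<partial>Seq.S)"
      by (rule LS.Fubini'[symmetric]) (simp add: indicator_def of_bool_def)
    also have "\<dots> = (\<integral>\<^sup>+z. ennreal ((1 - exp (- (t * T n z))) / t) \<partial>Seq.S)"
      unfolding f_def by (intro nn_integral_cong nn_integral_exp_Ioo t T0)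
    also have "\<dots> = ennreal (\<integral>z. (1 - exp (- (t * T n z))) / t \<partial>Seq.S)"
      using t T0 int by (intro nn_integral_eq_integral) auto
    also have "(\<integral>z. (1 - exp (- (t * T n z))) / t \<partial>Seq.S) = (1 - pprod n t) / t"
      using int exp_T' by (simp add: Seq.P.prob_space)
    also have "ennreal ((1 - pprod n t) / t) \<le> ennreal ((1 - P) / t)"
      using P[of n] t by (intro ennreal_leI divide_right_mono) (auto simp: t_def)
    finally show ?thesis .
  qed
  have "ennreal (norm (laplace hit_prob s)) \<le> (\<integral>\<^sup>+x. norm (indicator {0<..} x *\<^sub>R
      (exp (- s * complex_of_real x) * complex_of_real (hit_prob x))) \<partial>lborel)"
    unfolding laplace_def set_lebesgue_integral_def using hit_prob_bounds
    by (intro integral_norm_bound_ennreal integrable_exp_Ioi_bounded[where K = 1] s) auto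
  also have "\<dots> = (\<integral>\<^sup>+x. f x * ennreal (hit_prob x) \<partial>lborel)"
    using hit_prob_bounds
    by (intro nn_integral_cong) (auto simp: f_def norm_mult ennreal_mult[symmetric] t_def split: split_indicator)
  also have "\<dots> \<le> (\<integral>\<^sup>+x. (SUP n. f x * emeasure Seq.S {z \<in> space Seq.S. x < T n z}) \<partial>lborel)"
    by (intro nn_integral_mono) (auto simp: SUP_mult_left_ennreal[symmetric] intro!: mult_left_mono hit_le)
  \<comment> \<open>Monotone convergence moves the supremum outside, so the estimate
    \<open>each\<close> for a single \<open>T n\<close> suffices.\<close>
  also have "\<dots> = (SUP n. \<integral>\<^sup>+x. f x * emeasure Seq.S {z \<in> space Seq.S. x < T n z} \<partial>lborel)"
  proof (rule nn_integral_monotone_convergence_SUP)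
    show "incseq (\<lambda>n x. f x * emeasure Seq.S {z \<in> space Seq.S. x < T n z})"
      using incseqD[OF Tmono] by (auto simp: incseq_def le_fun_def intro!: mult_left_mono emeasure_mono intro: less_le_trans)
    show "(\<lambda>x. f x * emeasure Seq.S {z \<in> space Seq.S. x < T n z}) \<in> borel_measurable lborel" for n
      by measurable
  qed
  also have "\<dots> \<le> ennreal ((1 - P) / t)" by (intro SUP_least each)
  finally show ?thesis using P1 t by (simp add: t_def)
qed

end

text \<open>While the number of gains is n, the surplus can vanish only at time
  \<open>post_gain n + gain_time n\<close>. The uncountable quantifier over t thereby becomes a
  countable one, which yields measurability. The argument is algebraic and covers realisations in
  which \<open>LEAST\<close> is arbitrary as well.\<close>

lemma ever_ruined_iff:
  "(\<exists>t\<ge>0. surplus a x bs cs t = 0) \<longleftrightarrow>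
   (\<exists>n. 0 \<le> post_gain a x bs cs n + gain_time bs n \<and> num_gains bs (post_gain a x bs cs n + gain_time bs n) = n)"
proof
  assume "\<exists>t\<ge>0. surplus a x bs cs t = 0"
  then obtain t where t: "0 \<le> t" "surplus a x bs cs t = 0" by blast
  define n where "n = num_gains bs t"
  have "post_gain a x bs cs n + gain_time bs n = t" using t(2) by (simp add: surplus_def n_def Let_def)
  hence "0 \<le> post_gain a x bs cs n + gain_time bs n \<and> num_gains bs (post_gain a x bs cs n + gain_time bs n) = n"
    using t(1) by (simp add: n_def)
  thus "\<exists>n. 0 \<le> post_gain a x bs cs n + gain_time bs n \<and> num_gains bs (post_gain a x bs cs n + gain_time bs n) = n"
    by blast
next
  assume "\<exists>n. 0 \<le> post_gain a x bs cs n + gain_time bs n \<and> num_gains bs (post_gain a x bs cs n + gain_time bs n) = n"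
  then obtain n where n: "0 \<le> post_gain a x bs cs n + gain_time bs n"
    "num_gains bs (post_gain a x bs cs n + gain_time bs n) = n" by blast
  have "surplus a x bs cs (post_gain a x bs cs n + gain_time bs n) = 0"
    unfolding surplus_def Let_def n(2) by simp
  with n(1) show "\<exists>t\<ge>0. surplus a x bs cs t = 0" by blast
qed

lemma ever_ruined_measurable:
  assumes [measurable]: "\<And>n. B n \<in> borel_measurable M" "\<And>n. C n \<in> borel_measurable M"
  shows "Measurable.pred M (\<lambda>\<omega>. \<exists>t\<ge>0. surplus a x (\<lambda>n. B n \<omega>) (\<lambda>n. C n \<omega>) t = 0)"
proof -
  have [measurable]: "(\<lambda>\<omega>. post_gain a x (\<lambda>n. B n \<omega>) (\<lambda>n. C n \<omega>) n) \<in> borel_measurable M" for n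
    by (induction n) simp_all
  have [measurable]: "(\<lambda>\<omega>. gain_time (\<lambda>n. B n \<omega>) n) \<in> borel_measurable M" for n
    unfolding gain_time_def by measurable
  have [measurable]: "(\<lambda>\<omega>. num_gains (\<lambda>n. B n \<omega>) (f \<omega>)) \<in> measurable M (count_space UNIV)"
    if [measurable]: "f \<in> borel_measurable M" for f
    unfolding num_gains_def by measurable
  show ?thesis unfolding ever_ruined_iff by measurable
qed

lemma ever_ruined_iff_undershoot:
  assumes a: "0 < a" and x: "0 < x" and b: "\<And>n. 0 < bs n" and c: "\<And>n. 0 < cs n"
    and unb: "\<And>K. \<exists>n. K < gain_time bs n"
  shows "(\<exists>t\<ge>0. surplus a x bs cs t = 0) \<longleftrightarrow> (\<exists>n. post_gain a x bs cs n < bs n)"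
proof
  assume "\<exists>t\<ge>0. surplus a x bs cs t = 0"
  then obtain t where t: "0 \<le> t" "surplus a x bs cs t = 0" by blast
  obtain m where "t < gain_time bs m" using unb by blast
  with t(1) obtain k where "t < gain_time bs (Suc k)" by (cases m) (auto simp: gain_time_def)
  \<comment> \<open>Unboundedness of the gain times supplied the witness \<open>k\<close> that makes
    \<open>LEAST\<close> meaningful.\<close>
  hence "t < gain_time bs (Suc (num_gains bs t))" unfolding num_gains_def by (rule LeastI)
  with t(2) have "post_gain a x bs cs (num_gains bs t) < bs (num_gains bs t)"
    by (simp add: surplus_def Let_def gain_time_def)
  thus "\<exists>n. post_gain a x bs cs n < bs n" by blast
next
  assume "\<exists>n. post_gain a x bs cs n < bs n"
  \<comment> \<open>The least undershoot is taken: up to it the post-gain surplus is nonnegative.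
    Later it may be negative, and the candidate time would then precede the n-th gain.\<close>
  then obtain n where n: "post_gain a x bs cs n < bs n"
    and least: "\<And>m. m < n \<Longrightarrow> \<not> post_gain a x bs cs m < bs m"
    using exists_least_iff[of "\<lambda>n. post_gain a x bs cs n < bs n"] by blast
  have pos: "0 \<le> post_gain a x bs cs n"
  proof (cases n)
    case (Suc m)
    with least[of m] show ?thesis using a c[of m] by (simp add: not_less add_nonneg_nonneg less_imp_le)
  qed (use x in simp)
  define t where "t = post_gain a x bs cs n + gain_time bs n"
  have mono: "gain_time bs i \<le> gain_time bs j" if "i \<le> j" for i j
    unfolding gain_time_def using that b by (intro sum_mono2) (auto intro: less_imp_le)
  have "num_gains bs t = n"
    unfolding num_gains_def
  proof (rule Least_equality)
    show "t < gain_time bs (Suc n)" using n by (simp add: t_def gain_time_def)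
    fix m assume "t < gain_time bs (Suc m)"
    thus "n \<le> m" using mono[of "Suc m" n] pos by (auto simp: t_def not_le[symmetric] Suc_le_eq)
  qed
  moreover have "0 \<le> t" using pos mono[of 0 n] by (simp add: t_def gain_time_def)
  ultimately show "\<exists>t\<ge>0. surplus a x bs cs t = 0"
    unfolding ever_ruined_iff t_def by blast
qed

context dual_risk begin

lemma hit_prob_eq_ever_ruined:
  assumes x: "0 < x"
  shows "measure Seq.S {z \<in> space Seq.S. \<exists>t\<ge>0. surplus a x (\<lambda>n. fst (z n)) (\<lambda>n. snd (z n)) t = 0} = hit_prob x"
  unfolding hit_prob_def
proof (rule measure_eq_AE)
  show "AE z in Seq.S. (z \<in> {z \<in> space Seq.S. \<exists>t\<ge>0. surplus a x (\<lambda>n. fst (z n)) (\<lambda>n. snd (z n)) t = 0})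
      \<longleftrightarrow> (z \<in> {z \<in> space Seq.S. hit x z})"
    using S_pos gain_time_unbounded
  proof eventually_elim
    case (elim z)
    thus ?case
      using ever_ruined_iff_undershoot[OF a_pos x, of "\<lambda>n. fst (z n)" "\<lambda>n. snd (z n)"] by (simp add: hit_def)
  qed
  have [measurable]: "Measurable.pred Seq.S (\<lambda>z. \<exists>t\<ge>0. surplus a x (\<lambda>n. fst (z n)) (\<lambda>n. snd (z n)) t = 0)"
    by (rule ever_ruined_measurable) measurable
  show "{z \<in> space Seq.S. \<exists>t\<ge>0. surplus a x (\<lambda>n. fst (z n)) (\<lambda>n. snd (z n)) t = 0} \<in> sets Seq.S"
    by measurable
qed measurable

theorem laplace_hit_prob_sums:
  assumes s: "0 < Re s" and reg: "regular s"
  shows "(\<lambda>n. coef n s * H (laplace hit_prob) (s / of_real ((1 + a) ^ n))) sums laplace hit_prob s"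
proof -
  let ?\<rho> = "laplace hit_prob" and ?s = "\<lambda>n. s / of_real ((1 + a) ^ n)"
  define t where "t = Re s"
  have t: "0 < t" using s by (simp add: t_def)
  have eq: "?\<rho> (?s n) = J (?s n) * ?\<rho> (?s (Suc n)) + H ?\<rho> (?s n)" for n
  proof -
    have "0 < Re (?s n)" unfolding Re_scaled using s by simp
    from laplace_functional_equation[OF this regular_ne[OF reg] hit_prob_measurable hit_prob_bounds hit_prob_rec]
    show ?thesis by (simp add: mult.commute)
  qed
  have partial: "(\<Sum>k<n. coef k s * H ?\<rho> (?s k)) = ?\<rho> s - coef n s * ?\<rho> (?s n)" for n
  proof (induction n)
    case (Suc n)
    show ?case
      unfolding sum.lessThan_Suc Suc coef_Suc using eq[of n] by (simp add: algebra_simps del: of_real_power)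
  qed (simp add: coef_def)
  obtain M where M: "0 \<le> M" "\<And>n. norm (coef n s) \<le> M * pprod n t / (1 + a) ^ n"
    using norm_coef_le[OF s reg] unfolding t_def by blast
  have pprod_add: "pprod (n + m) t = pprod n t * pprod m (t / (1 + a) ^ n)" for n m
    unfolding pprod_def by (induction m) (simp_all add: power_add mult_ac)
  have dec: "decseq (\<lambda>n. pprod n t)"
    by (intro decseq_SucI) (use pprod_bounds(1)[OF t] phir_less_1 t in
      \<open>simp add: pprod_def mult_le_cancel_left1 less_imp_le\<close>)
  have nonneg: "\<forall>n. 0 \<le> pprod n t" by (intro allI less_imp_le pprod_bounds t)
  obtain L where L: "(\<lambda>n. pprod n t) \<longlonglongrightarrow> L" and L': "\<forall>n. L \<le> pprod n t"
    by (rule decseq_convergent[OF dec nonneg])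
  have bound: "norm (coef n s * ?\<rho> (?s n)) \<le> M / t * (pprod n t - L)" for n
  proof -
    have p: "0 < pprod n t" by (rule pprod_bounds[OF t])
    have "norm (?\<rho> (?s n)) \<le> (1 - L / pprod n t) / Re (?s n)"
    proof (rule norm_laplace_hit_prob_le)
      show "0 < Re (?s n)" unfolding Re_scaled using s by simp
      \<comment> \<open>By \<open>pprod_add\<close>, q_n(t) q_m(t/(1+a)^n) = q_(n+m)(t) \<ge> L, so
        L/q_n(t) can serve as the lower bound P at the rescaled argument.\<close>
      show "L / pprod n t \<le> pprod m (Re (?s n))" for m
        using L'[rule_format, of "n + m"] p unfolding Re_scaled t_def[symmetric] pprod_add
        by (simp add: divide_le_eq mult.commute)
    qed
    \<comment> \<open>The decay (1+a)^(-n) of \<open>coef\<close> cancels against the growth of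
      1/Re(s/(1+a)^n), and q_n (1 - L/q_n) = q_n - L remains.\<close>
    hence "norm (coef n s * ?\<rho> (?s n)) \<le> (M * pprod n t / (1 + a) ^ n) * ((1 - L / pprod n t) / (t / (1 + a) ^ n))"
      unfolding norm_mult Re_scaled t_def[symmetric]
      using M(1) p by (intro mult_mono M(2)) (auto intro!: divide_nonneg_nonneg mult_nonneg_nonneg less_imp_le[OF pow_pos])
    also have "\<dots> = M / t * (pprod n t - L)"
    proof -
      have "(M * p / q) * ((1 - L / p) / (t / q)) = M / t * (p - L)" if "0 < p" "0 < q" for p q :: real
        using that t by (simp add: field_simps)
      from this[OF p pow_pos] show ?thesis .
    qed
    finally show ?thesis .
  qed
  have "(\<lambda>n. M / t * (pprod n t - L)) \<longlonglongrightarrow> M / t * (L - L)" by (intro tendsto_intros L)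
  hence "(\<lambda>n. coef n s * ?\<rho> (?s n)) \<longlonglongrightarrow> 0"
    by (intro Lim_null_comparison[OF always_eventually[OF allI[OF bound]]]) simp
  hence "(\<lambda>n. ?\<rho> s - coef n s * ?\<rho> (?s n)) \<longlonglongrightarrow> ?\<rho> s - 0" by (intro tendsto_intros)
  thus ?thesis unfolding sums_def partial by (simp only: diff_zero)
qed

end

section \<open>Joint laws given by a copula\<close>

text \<open>Explicit derivatives take the place of \<open>deriv\<close>: they are Borel on the whole
  line and bounded on the open unit interval, because the lowered exponents are still
  nonnegative.\<close>

definition fgm_p' :: "real \<Rightarrow> real \<Rightarrow> real \<Rightarrow> real" where
  "fgm_p' k b u = k * u powr (k - 1) * (1 - u) powr b - b * u powr k * (1 - u) powr (b - 1)"

definition fgm_g' :: "nat \<Rightarrow> real \<Rightarrow> real \<Rightarrow> real" where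
  "fgm_g' c d v = c * v ^ (c - 1) * (1 - v) powr d - d * v ^ c * (1 - v) powr (d - 1)"

lemma fgm_p_has_derivative:
  assumes "0 < u" "u < 1"
  shows "(fgm_p k b has_real_derivative fgm_p' k b u) (at u)"
proof -
  have "((\<lambda>u. u powr k * (1 - u) powr b) has_real_derivative fgm_p' k b u) (at u)"
    using assms by (auto intro!: derivative_eq_intros simp: fgm_p'_def powr_diff field_simps)
  thus ?thesis by (simp add: fgm_p_def[abs_def])
qed

lemma fgm_g_has_derivative:
  assumes "0 < v" "v < 1"
  shows "(fgm_g c d has_real_derivative fgm_g' c d v) (at v)"
proof -
  have "((\<lambda>v. v ^ c * (1 - v) powr d) has_real_derivative fgm_g' c d v) (at v)"
    using assms by (auto intro!: derivative_eq_intros simp: fgm_g'_def powr_diff field_simps)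
  thus ?thesis by (simp add: fgm_g_def[abs_def])
qed

lemma fgm_p'_bounded:
  assumes "1 \<le> k" "1 \<le> b" "0 < u" "u < 1"
  shows "\<bar>fgm_p' k b u\<bar> \<le> k + b"
proof -
  have "\<bar>k * u powr (k - 1) * (1 - u) powr b\<bar> \<le> k * 1 * 1"
    unfolding abs_mult using assms by (intro mult_mono) (auto simp: powr_le1)
  moreover have "\<bar>b * u powr k * (1 - u) powr (b - 1)\<bar> \<le> b * 1 * 1"
    unfolding abs_mult using assms by (intro mult_mono) (auto simp: powr_le1)
  ultimately show ?thesis unfolding fgm_p'_def by linarith
qed

lemma fgm_g'_bounded:
  assumes "1 \<le> d" "0 < v" "v < 1"
  shows "\<bar>fgm_g' c d v\<bar> \<le> c + d"
proof -
  have "\<bar>c * v ^ (c - 1) * (1 - v) powr d\<bar> \<le> real c * 1 * 1"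
    unfolding abs_mult using assms by (intro mult_mono) (auto simp: powr_le1 power_le_one power_abs)
  moreover have "\<bar>d * v ^ c * (1 - v) powr (d - 1)\<bar> \<le> d * 1 * 1"
    unfolding abs_mult using assms by (intro mult_mono) (auto simp: powr_le1 power_le_one power_abs)
  ultimately show ?thesis unfolding fgm_g'_def by linarith
qed

lemma continuous_on_fgm_p: "1 \<le> k \<Longrightarrow> 1 \<le> b \<Longrightarrow> continuous_on {0..1} (fgm_p k b)"
  unfolding fgm_p_def[abs_def] by (intro continuous_on_mult continuous_on_powr') (auto intro!: continuous_intros)

lemma continuous_on_fgm_g: "1 \<le> d \<Longrightarrow> continuous_on {0..1} (fgm_g c d)"
  unfolding fgm_g_def[abs_def] by (intro continuous_on_mult continuous_on_powr') (auto intro!: continuous_intros)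

lemma fgm_p'_measurable [measurable]: "fgm_p' k b \<in> borel_measurable borel"
  unfolding fgm_p'_def[abs_def] by measurable

lemma fgm_g'_measurable [measurable]: "fgm_g' c d \<in> borel_measurable borel"
  unfolding fgm_g'_def[abs_def] by measurable

text \<open>A copula gives nonnegative mass to the square with corner (u,v) and side h; divided by
  h^2 this mass tends to the density as h decreases to 0. Pointwise nonnegativity keeps
  \<open>ennreal\<close> from cutting the density off later.\<close>

lemma fgm_density_nonneg:
  assumes cop: "is_copula (fgm_copula \<theta> k b c d)" and u: "0 < u" "u < 1" and v: "0 < v" "v < 1"
  shows "0 \<le> 1 + \<theta> * (fgm_p' k b u * fgm_g' c d v)"
proof (rule tendsto_lowerbound)
  let ?p = "\<lambda>h. (fgm_p k b (u + h) - fgm_p k b u) / h" and ?g = "\<lambda>h. (fgm_g c d (v + h) - fgm_g c d v) / h"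
  have "(?p \<longlongrightarrow> fgm_p' k b u) (at 0)" "(?g \<longlongrightarrow> fgm_g' c d v) (at 0)"
    using fgm_p_has_derivative[OF u, of k b] fgm_g_has_derivative[OF v, of c d] by (simp_all only: DERIV_def)
  hence "(?p \<longlongrightarrow> fgm_p' k b u) (at_right 0)" "(?g \<longlongrightarrow> fgm_g' c d v) (at_right 0)"
    by (auto intro: tendsto_mono[OF at_le[OF subset_UNIV]])
  thus "((\<lambda>h. 1 + \<theta> * (?p h * ?g h)) \<longlongrightarrow> 1 + \<theta> * (fgm_p' k b u * fgm_g' c d v)) (at_right 0)"
    by (intro tendsto_intros)
  have "\<forall>\<^sub>F h in at_right 0. h < min (1 - u) (1 - v)"
    using eventually_at_right_real[of 0 "min (1 - u) (1 - v)"] u v by (auto elim!: eventually_mono)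
  moreover have "\<forall>\<^sub>F h in at_right (0::real). 0 < h" by (rule eventually_at_right_less)
  ultimately show "\<forall>\<^sub>F h in at_right 0. 0 \<le> 1 + \<theta> * (?p h * ?g h)"
  proof eventually_elim
    case (elim h)
    let ?K = "fgm_copula \<theta> k b c d"
    have "0 \<le> ?K (u + h) (v + h) - ?K (u + h) v - ?K u (v + h) + ?K u v"
      using cop elim u v unfolding is_copula_def by auto
    also have "\<dots> = h\<^sup>2 * (1 + \<theta> * (?p h * ?g h))"
      using elim by (simp add: fgm_copula_def power2_eq_square field_simps)
    finally show ?case using elim by (simp add: zero_le_mult_iff)
  qed
qed simp

locale atomless_distribution = cdf_distribution +
  assumes atomless: "measure M {x} = 0"
begin

text \<open>The quantile function always satisfies \<omega> \<le> C(I \<omega>). To the left of I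
  \<omega> the cdf is below \<omega>, and without atoms it is continuous, which gives the converse
  inequality.\<close>

lemma cdf_quantile:
  assumes "0 < \<omega>" "\<omega> < 1"
  shows "C (I \<omega>) = \<omega>"
proof (rule antisym)
  show "\<omega> \<le> C (I \<omega>)" using pseudoinverse[OF assms, of "I \<omega>"] by simp
  have "isCont C (I \<omega>)" using atomless isCont_cdf by simp
  hence "(C \<longlongrightarrow> C (I \<omega>)) (at_left (I \<omega>))"
    by (auto simp: isCont_def intro: tendsto_within_subset)
  moreover have "\<forall>\<^sub>F x in at_left (I \<omega>). C x \<le> \<omega>"
    unfolding eventually_at_filter
  proof (intro always_eventually allI impI)
    fix x assume "x \<in> {..<I \<omega>}"
    thus "C x \<le> \<omega>" using pseudoinverse[OF assms, of x] by (auto simp: not_le[symmetric])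
  qed
  ultimately show "C (I \<omega>) \<le> \<omega>" by (intro tendsto_upperbound[where F = "at_left (I \<omega>)"]) auto
qed

text \<open>Setting the value to 0 where the cdf is 0 or 1 changes it on a null set only and makes
  bounds known on the open unit interval valid everywhere.\<close>

definition of_cdf :: "(real \<Rightarrow> real) \<Rightarrow> real \<Rightarrow> real" where
  "of_cdf q y = (if 0 < C y \<and> C y < 1 then q (C y) else 0)"

lemma of_cdf_measurable [measurable]:
  assumes [measurable]: "q \<in> borel_measurable borel"
  shows "of_cdf q \<in> borel_measurable borel"
  unfolding of_cdf_def[abs_def] by measurable

lemma AE_cdf_interior: "AE y in M. 0 < C y \<and> C y < 1"
proof (subst distr_I_eq_M[symmetric], subst AE_distr_iff)
  show "AE \<omega> in restrict_space lborel {0<..<1}. 0 < C (I \<omega>) \<and> C (I \<omega>) < 1"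
    by (rule AE_I2) (simp add: space_restrict_space cdf_quantile)
qed measurable

text \<open>The quantile function \<open>I\<close> turns the integral over \<open>M\<close> into one over the unit interval.\<close>

lemma integral_of_cdf:
  assumes q_cont: "continuous_on {0..1} q" and q0: "q 0 = 0"
    and q': "\<And>u. 0 < u \<Longrightarrow> u < 1 \<Longrightarrow> (q has_real_derivative q' u) (at u)"
    and [measurable]: "q' \<in> borel_measurable borel"
    and K: "\<And>u. 0 < u \<Longrightarrow> u < 1 \<Longrightarrow> \<bar>q' u\<bar> \<le> K"
  shows "(\<integral>y. indicator {..x} y * of_cdf q' y \<partial>M) = q (C x)"
proof -
  have C01: "0 \<le> C x" "C x \<le> 1" using cdf_nonneg cdf_bounded_prob by auto
  have "(\<integral>y. indicator {..x} y * of_cdf q' y \<partial>M)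
     = (\<integral>\<omega>. indicator {..x} (I \<omega>) * of_cdf q' (I \<omega>) \<partial>restrict_space lborel {0<..<1})"
    by (subst distr_I_eq_M[symmetric], subst integral_distr) auto
  also have "\<dots> = (\<integral>\<omega>. indicator {..C x} \<omega> * q' \<omega> \<partial>restrict_space lborel {0<..<1})"
  proof (rule Bochner_Integration.integral_cong[OF refl])
    fix \<omega> assume "\<omega> \<in> space (restrict_space lborel {0<..<1::real})"
    hence w: "0 < \<omega>" "\<omega> < 1" by (auto simp: space_restrict_space)
    show "indicator {..x} (I \<omega>) * of_cdf q' (I \<omega>) = indicator {..C x} \<omega> * q' \<omega>"
      using pseudoinverse[OF w, of x] w by (simp add: of_cdf_def cdf_quantile[OF w] split: split_indicator)
  qed
  also have "\<dots> = (\<integral>\<omega>. indicator {0<..<1} \<omega> *\<^sub>R (indicator {..C x} \<omega> * q' \<omega>) \<partial>lborel)"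
    by (subst integral_restrict_space) auto
  also have "\<dots> = (\<integral>\<omega>. indicator {0<..<C x} \<omega> *\<^sub>R q' \<omega> \<partial>lborel)"
    using C01 AE_lborel_singleton[of "C x"]
    by (intro integral_cong_AE) (auto elim!: eventually_mono split: split_indicator)
  also have "\<dots> = q (C x)"
  proof -
    have int: "set_integrable lborel {0<..<C x} q'"
      unfolding set_integrable_def
    proof (rule Bochner_Integration.integrable_bound)
      have "emeasure lborel {0<..<C x} < \<infinity>" using C01 by (subst emeasure_lborel_Ioo) auto
      thus "integrable lborel (\<lambda>\<omega>. indicator {0<..<C x} \<omega> *\<^sub>R K)"
        by (intro integrable_scaleR_left integrable_real_indicator) auto
      show "AE \<omega> in lborel. norm (indicator {0<..<C x} \<omega> *\<^sub>R q' \<omega>) \<le> norm (indicator {0<..<C x} \<omega> *\<^sub>R K)"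
        using K C01 by (intro AE_I2) (force split: split_indicator)
    qed measurable
    have "(q' has_integral q (C x) - q 0) {0..C x}"
    proof (rule fundamental_theorem_of_calculus_interior)
      show "continuous_on {0..C x} q" using C01 by (intro continuous_on_subset[OF q_cont]) auto
      show "(q has_vector_derivative q' u) (at u)" if "u \<in> {0<..<C x}" for u
        using q'[of u] that C01 by (simp add: has_real_derivative_iff_has_vector_derivative)
    qed (use C01 in simp)
    hence "(q' has_integral q (C x)) {0<..<C x}"
      using q0 by (simp add: has_integral_Icc_iff_Ioo)
    thus ?thesis
      using set_borel_integral_eq_integral(2)[OF int] unfolding set_lebesgue_integral_def by (simp add: integral_unique)
  qed
  finally show ?thesis .
qed

lemma of_cdf_bounded:
  assumes "\<And>u. 0 < u \<Longrightarrow> u < 1 \<Longrightarrow> \<bar>q u\<bar> \<le> K"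
  shows "\<bar>of_cdf q y\<bar> \<le> K"
  using assms[of "C y"] assms[of "1/2"] by (auto simp: of_cdf_def)

end

lemma (in pair_prob_space) integral_mult_bounded:
  fixes f :: "'a \<Rightarrow> 'c::{real_normed_field, banach, second_countable_topology}"
  assumes [measurable]: "f \<in> borel_measurable M1" "g \<in> borel_measurable M2"
    and K: "\<And>x. norm (f x) \<le> K" and L: "\<And>y. norm (g y) \<le> L"
  shows "integrable (M1 \<Otimes>\<^sub>M M2) (\<lambda>p. f (fst p) * g (snd p))"
    and "(\<integral>p. f (fst p) * g (snd p) \<partial>(M1 \<Otimes>\<^sub>M M2)) = (\<integral>x. f x \<partial>M1) * (\<integral>y. g y \<partial>M2)"
proof -
  have "0 \<le> K" by (rule order_trans[OF norm_ge_zero K])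
  thus int: "integrable (M1 \<Otimes>\<^sub>M M2) (\<lambda>p. f (fst p) * g (snd p))"
    by (intro integrable_const_bound[where B = "K * L"] AE_I2) (auto simp: norm_mult intro!: mult_mono K L)
  show "(\<integral>p. f (fst p) * g (snd p) \<partial>(M1 \<Otimes>\<^sub>M M2)) = (\<integral>x. f x \<partial>M1) * (\<integral>y. g y \<partial>M2)"
    using integral_fst'[OF int] by simp
qed

text \<open>Only the joint cdf is prescribed; the joint density is derived from it. Of p and g, just
  what the fundamental theorem of calculus and the integrability of the density call for is
  kept.\<close>

locale copula_pair = P: atomless_distribution P + Q: atomless_distribution Q
  for P Q :: "real measure" +
  fixes D :: "(real \<times> real) measure" and \<theta> :: real and p p' g g' :: "real \<Rightarrow> real" and Kp Kg :: real
  assumes prob_D: "prob_space D" and sets_D [measurable_cong]: "sets D = sets (borel \<Otimes>\<^sub>M borel)"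
    and p: "continuous_on {0..1} p" "p 0 = 0" "\<And>u. 0 < u \<Longrightarrow> u < 1 \<Longrightarrow> (p has_real_derivative p' u) (at u)"
    and g: "continuous_on {0..1} g" "g 0 = 0" "\<And>u. 0 < u \<Longrightarrow> u < 1 \<Longrightarrow> (g has_real_derivative g' u) (at u)"
    and p'_measurable [measurable]: "p' \<in> borel_measurable borel"
    and g'_measurable [measurable]: "g' \<in> borel_measurable borel"
    and p'_bound: "\<And>u. 0 < u \<Longrightarrow> u < 1 \<Longrightarrow> \<bar>p' u\<bar> \<le> Kp" and g'_bound: "\<And>u. 0 < u \<Longrightarrow> u < 1 \<Longrightarrow> \<bar>g' u\<bar> \<le> Kg"
    and density_nonneg: "\<And>u v. 0 < u \<Longrightarrow> u < 1 \<Longrightarrow> 0 < v \<Longrightarrow> v < 1 \<Longrightarrow> 0 \<le> 1 + \<theta> * (p' u * g' v)"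
    and joint: "\<And>x y. measure D ({..x} \<times> {..y}) = P.C x * Q.C y + \<theta> * (p (P.C x) * g (Q.C y))"
begin

sublocale D: prob_space D by (rule prob_D)
sublocale PQ: pair_prob_space P Q ..

abbreviation "\<alpha> \<equiv> P.of_cdf p'"
abbreviation "\<beta> \<equiv> Q.of_cdf g'"

definition dens :: "real \<times> real \<Rightarrow> real" where
  "dens z = 1 + \<theta> * (\<alpha> (fst z) * \<beta> (snd z))"

lemma dens_nonneg: "0 \<le> dens z"
  unfolding dens_def P.of_cdf_def Q.of_cdf_def using density_nonneg by auto

lemma alpha_bound: "\<bar>\<alpha> x\<bar> \<le> Kp" and beta_bound: "\<bar>\<beta> x\<bar> \<le> Kg"
  using P.of_cdf_bounded[OF p'_bound] Q.of_cdf_bounded[OF g'_bound] by auto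

lemma fst_borel [measurable]: "fst \<in> borel_measurable (P \<Otimes>\<^sub>M Q)" and snd_borel [measurable]: "snd \<in> borel_measurable (P \<Otimes>\<^sub>M Q)"
  by (simp_all cong: measurable_cong_sets)

lemma dens_measurable [measurable]: "dens \<in> borel_measurable (P \<Otimes>\<^sub>M Q)"
  unfolding dens_def by measurable

lemma integral_dens_mult:
  fixes f h :: "real \<Rightarrow> 'c::{real_normed_field, banach, second_countable_topology}"
  assumes [measurable]: "f \<in> borel_measurable borel" "h \<in> borel_measurable borel"
    and K: "\<And>x. norm (f x) \<le> K" and L: "\<And>x. norm (h x) \<le> L"
  shows "integrable (P \<Otimes>\<^sub>M Q) (\<lambda>z. of_real (dens z) * (f (fst z) * h (snd z)))"
    and "(\<integral>z. of_real (dens z) * (f (fst z) * h (snd z)) \<partial>(P \<Otimes>\<^sub>M Q))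
      = (\<integral>x. f x \<partial>P) * (\<integral>y. h y \<partial>Q) + of_real \<theta> * ((\<integral>x. f x * of_real (\<alpha> x) \<partial>P) * (\<integral>y. h y * of_real (\<beta> y) \<partial>Q))"
proof -
  have 0: "0 \<le> K" "0 \<le> L" by (rule order_trans[OF norm_ge_zero K], rule order_trans[OF norm_ge_zero L])
  have eq: "of_real (dens z) * (f (fst z) * h (snd z)) = f (fst z) * h (snd z)
      + of_real \<theta> * ((f (fst z) * of_real (\<alpha> (fst z))) * (h (snd z) * of_real (\<beta> (snd z))))" for z
    by (simp add: dens_def algebra_simps)
  have b: "norm (f x * of_real (\<alpha> x)) \<le> K * Kp" "norm (h x * of_real (\<beta> x)) \<le> L * Kg" for x
    unfolding norm_mult norm_of_real using 0 K L alpha_bound beta_bound by (auto intro!: mult_mono)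
  note 1 = PQ.integral_mult_bounded[of f h K L]
  note 2 = PQ.integral_mult_bounded[of "\<lambda>x. f x * of_real (\<alpha> x)" "\<lambda>x. h x * of_real (\<beta> x)" "K * Kp" "L * Kg"]
  have i1: "integrable (P \<Otimes>\<^sub>M Q) (\<lambda>z. f (fst z) * h (snd z))" by (rule 1(1)) (use K L in auto)
  have i2: "integrable (P \<Otimes>\<^sub>M Q) (\<lambda>z. of_real \<theta> * ((f (fst z) * of_real (\<alpha> (fst z))) * (h (snd z) * of_real (\<beta> (snd z)))))"
    by (intro integrable_mult_right 2(1)) (use b in auto)
  have e1: "(\<integral>z. f (fst z) * h (snd z) \<partial>(P \<Otimes>\<^sub>M Q)) = (\<integral>x. f x \<partial>P) * (\<integral>y. h y \<partial>Q)"
    by (rule 1(2)) (use K L in auto)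
  have e2: "(\<integral>z. (f (fst z) * of_real (\<alpha> (fst z))) * (h (snd z) * of_real (\<beta> (snd z))) \<partial>(P \<Otimes>\<^sub>M Q))
      = (\<integral>x. f x * of_real (\<alpha> x) \<partial>P) * (\<integral>y. h y * of_real (\<beta> y) \<partial>Q)"
    by (rule 2(2)) (use b in auto)
  show "integrable (P \<Otimes>\<^sub>M Q) (\<lambda>z. of_real (dens z) * (f (fst z) * h (snd z)))"
    unfolding eq by (intro Bochner_Integration.integrable_add i1 i2)
  show "(\<integral>z. of_real (dens z) * (f (fst z) * h (snd z)) \<partial>(P \<Otimes>\<^sub>M Q))
      = (\<integral>x. f x \<partial>P) * (\<integral>y. h y \<partial>Q) + of_real \<theta> * ((\<integral>x. f x * of_real (\<alpha> x) \<partial>P) * (\<integral>y. h y * of_real (\<beta> y) \<partial>Q))"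
    unfolding eq Bochner_Integration.integral_add[OF i1 i2] integral_mult_right_zero
    by (simp only: e1 e2)
qed

text \<open>The sets {..a}, lower left quadrants in the product order, are an intersection-stable
  generator of the Borel sets of the plane. On them the density integrates to the prescribed joint
  cdf, by \<open>integral_of_cdf\<close> in each variable.\<close>

lemma D_eq_density: "D = density (P \<Otimes>\<^sub>M Q) (\<lambda>z. ennreal (dens z))"
proof (rule measure_eqI_generator_eq)
  let ?E = "range (\<lambda>a::real \<times> real. {..a})"
  show "Int_stable ?E"
  proof (rule Int_stableI)
    fix X Y assume "X \<in> ?E" "Y \<in> ?E"
    then obtain a b c d :: real where XY: "X = {..(a, b)}" "Y = {..(c, d)}" by auto
    have "X \<inter> Y = {..(min a c, min b d)}" unfolding XY by (auto simp: less_eq_prod_def)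
    thus "X \<inter> Y \<in> ?E" by blast
  qed
  show "?E \<subseteq> Pow UNIV" by simp
  have borel: "sets (borel \<Otimes>\<^sub>M borel :: (real \<times> real) measure) = sigma_sets UNIV ?E"
    unfolding borel_prod by (subst borel_eq_atMost) (simp add: sets_measure_of)
  show "sets D = sigma_sets UNIV ?E" using sets_D borel by simp
  have "sets (P \<Otimes>\<^sub>M Q) = sets (borel \<Otimes>\<^sub>M borel :: (real \<times> real) measure)" by (intro sets_pair_measure_cong) auto
  thus "sets (density (P \<Otimes>\<^sub>M Q) (\<lambda>z. ennreal (dens z))) = sigma_sets UNIV ?E" using borel by simp
  show "range (\<lambda>n. {..(real n, real n)}) \<subseteq> ?E" by auto
  show "(\<Union>n. {..(real n, real n)}) = UNIV"
  proof safe
    fix x y :: real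
    obtain n where "max x y \<le> real n" using real_arch_simple by blast
    thus "(x, y) \<in> (\<Union>n. {..(real n, real n)})" by auto
  qed simp
  show "emeasure D {..(real n, real n)} \<noteq> \<infinity>" for n by simp
  fix X assume "X \<in> ?E"
  then obtain x y where "X = {..(x, y)}" by auto
  hence X: "X = {..x} \<times> {..y}" by auto
  have X_sets: "X \<in> sets (P \<Otimes>\<^sub>M Q)" unfolding X by (intro pair_measureI) auto
  have ind: "dens z * (indicator {..x} (fst z) * indicator {..y} (snd z)) = dens z * indicator X z" for z
    by (cases z) (auto simp: X split: split_indicator)
  note I = integral_dens_mult[where 'c = real and f = "indicator {..x}" and h = "indicator {..y}" and K = 1 and L = 1]
  have "emeasure (density (P \<Otimes>\<^sub>M Q) (\<lambda>z. ennreal (dens z))) X = (\<integral>\<^sup>+z. ennreal (dens z * indicator X z) \<partial>(P \<Otimes>\<^sub>M Q))"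
    by (subst emeasure_density[OF _ X_sets]) (auto intro!: nn_integral_cong split: split_indicator)
  also have "\<dots> = ennreal (\<integral>z. dens z * indicator X z \<partial>(P \<Otimes>\<^sub>M Q))"
    using I(1) dens_nonneg by (intro nn_integral_eq_integral) (auto simp: ind)
  also have "(\<integral>z. dens z * indicator X z \<partial>(P \<Otimes>\<^sub>M Q)) = P.C x * Q.C y + \<theta> * (p (P.C x) * g (Q.C y))"
    using I(2) P.integral_of_cdf[OF p p'_measurable p'_bound, of x] Q.integral_of_cdf[OF g g'_measurable g'_bound, of y]
    by (simp add: ind cdf_def)
  also have "ennreal \<dots> = emeasure D X" unfolding X by (simp add: D.emeasure_eq_measure joint)
  finally show "emeasure D X = emeasure (density (P \<Otimes>\<^sub>M Q) (\<lambda>z. ennreal (dens z))) X" ..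
qed

text \<open>The density 1 + \<theta> \<alpha> \<beta> is a sum of two products, so the expectation
  of f(B) h(C) is one as well. With f an exponential, this is where \<open>kernel\<close> comes
  from.\<close>

lemma integral_joint_law:
  fixes f h :: "real \<Rightarrow> complex"
  assumes [measurable]: "f \<in> borel_measurable borel" "h \<in> borel_measurable borel"
    and K: "\<And>x. norm (f x) \<le> K" and L: "\<And>x. norm (h x) \<le> L"
  shows "(\<integral>z. f (fst z) * h (snd z) \<partial>D)
      = (\<integral>x. f x \<partial>P) * (\<integral>y. h y \<partial>Q) + of_real \<theta> * ((\<integral>x. f x * of_real (\<alpha> x) \<partial>P) * (\<integral>y. h y * of_real (\<beta> y) \<partial>Q))"
proof -
  have "(\<integral>z. f (fst z) * h (snd z) \<partial>D) = (\<integral>z. of_real (dens z) * (f (fst z) * h (snd z)) \<partial>(P \<Otimes>\<^sub>M Q))"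
    using dens_nonneg by (subst D_eq_density, subst integral_density) (auto simp: scaleR_conv_of_real)
  thus ?thesis using integral_dens_mult(2)[OF assms] by simp
qed

end

section \<open>The generalized Farlie--Gumbel--Morgenstern model\<close>

text \<open>
  \<open>None\<close> stands for the exponential of the independent part, \<open>Some (i, True)\<close> and \<open>Some (i, False)\<close>
  for the two exponentials in the \<open>i\<close>-th summand of the expansion of \<open>g'\<close>.
\<close>

definition fgm_index :: "nat \<Rightarrow> (nat \<times> bool) option set" where
  "fgm_index c = insert None (Some ` ({..<c} \<times> UNIV))"

definition fgm_exponent :: "real \<Rightarrow> nat \<Rightarrow> real \<Rightarrow> (nat \<times> bool) option \<Rightarrow> real" where
  "fgm_exponent \<mu> c d j = (case j of None \<Rightarrow> \<mu> | Some (i, hi) \<Rightarrow> \<mu> * (real c + d - real i - (if hi then 0 else 1)))"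

definition fgm_weight ::
  "real \<Rightarrow> real \<Rightarrow> nat \<Rightarrow> real \<Rightarrow> (complex \<Rightarrow> complex) \<Rightarrow> (complex \<Rightarrow> complex) \<Rightarrow> (nat \<times> bool) option \<Rightarrow> complex \<Rightarrow> complex" where
  "fgm_weight \<mu> \<theta> c d \<phi> gZs j s = (case j of None \<Rightarrow> of_real \<mu> * \<phi> s | Some (i, hi) \<Rightarrow>
     of_real \<theta> * (\<phi> s - gZs s) * of_real \<mu> *
       (of_nat ((c - 1) choose i) * (- 1) ^ (c - 1 - i) * (if hi then of_real (real c + d) else - of_real d)))"

lemma finite_fgm_index: "finite (fgm_index c)"
  by (simp add: fgm_index_def)

lemma sum_fgm_index:
  "(\<Sum>j\<in>fgm_index c. f j) = f None + (\<Sum>i<c. f (Some (i, True)) + f (Some (i, False)))"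
proof -
  have "(\<Sum>j\<in>fgm_index c. f j) = f None + (\<Sum>(i, hi)\<in>{..<c} \<times> UNIV. f (Some (i, hi)))"
    unfolding fgm_index_def by (subst sum.insert) (auto simp: sum.reindex intro!: sum.cong)
  thus ?thesis unfolding sum.cartesian_product[symmetric] by (simp add: UNIV_bool add.commute)
qed

text \<open>X stays arbitrary because the same regrouping serves \<open>J_fun\<close>,
  \<open>H_fun\<close> and the exponential integrals in \<open>kernel\<close>.\<close>

lemma sum_fgm_weight:
  "(\<Sum>j\<in>fgm_index c. fgm_weight \<mu> \<theta> c d \<phi> gZs j s * X (fgm_exponent \<mu> c d j)) =
     of_real \<mu> * \<phi> s * X \<mu> + of_real \<theta> * (\<phi> s - gZs s) * of_real \<mu> *
       (\<Sum>i<c. of_nat ((c - 1) choose i) * (- 1) ^ (c - 1 - i) *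
          (of_real (real c + d) * X (\<mu> * (real c + d - real i)) - of_real d * X (\<mu> * (real c + d - real i - 1))))"
  unfolding sum_fgm_index sum_distrib_left
  by (intro arg_cong2[where f = "(+)"] sum.cong)
     (auto simp: fgm_weight_def fgm_exponent_def right_diff_distrib mult_ac simp del: of_real_add)

lemma fgm_exponent_pos:
  assumes "0 < \<mu>" "1 \<le> d" "j \<in> fgm_index c"
  shows "0 < fgm_exponent \<mu> c d j"
  using assms by (auto simp: fgm_index_def fgm_exponent_def split: option.splits)

lemma fgm_exponent_image:
  assumes "1 \<le> c"
  shows "(\<lambda>j. complex_of_real (fgm_exponent \<mu> c d j)) ` fgm_index c = nodes \<mu> c d"
proof
  show "(\<lambda>j. complex_of_real (fgm_exponent \<mu> c d j)) ` fgm_index c \<subseteq> nodes \<mu> c d"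
  proof
    fix z assume "z \<in> (\<lambda>j. complex_of_real (fgm_exponent \<mu> c d j)) ` fgm_index c"
    then obtain j where j: "j \<in> fgm_index c" and z: "z = complex_of_real (fgm_exponent \<mu> c d j)" by blast
    show "z \<in> nodes \<mu> c d"
    proof (cases j)
      case None thus ?thesis by (simp add: z fgm_exponent_def nodes_def)
    next
      case (Some it)
      then obtain i hi where it: "j = Some (i, hi)" by (cases it) auto
      with j have "i < c" by (auto simp: fgm_index_def)
      moreover have "z = of_real (\<mu> * (real c + d - real (if hi then i else Suc i)))"
        by (simp add: z it fgm_exponent_def algebra_simps)
      ultimately show ?thesis
        unfolding nodes_def by (intro insertI2 image_eqI[where x = "if hi then i else Suc i"]) auto
    qed
  qed
  show "nodes \<mu> c d \<subseteq> (\<lambda>j. complex_of_real (fgm_exponent \<mu> c d j)) ` fgm_index c"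
  proof
    fix z assume "z \<in> nodes \<mu> c d"
    then consider "z = of_real \<mu>" | i where "i \<le> c" "z = of_real (\<mu> * (real c + d - real i))"
      unfolding nodes_def by auto
    thus "z \<in> (\<lambda>j. complex_of_real (fgm_exponent \<mu> c d j)) ` fgm_index c"
    proof cases
      case 1 thus ?thesis by (intro image_eqI[of _ _ None]) (auto simp: fgm_exponent_def fgm_index_def)
    next
      case 2
      show ?thesis
      proof (cases "i < c")
        case True
        thus ?thesis using 2 by (intro image_eqI[of _ _ "Some (i, True)"]) (auto simp: fgm_exponent_def fgm_index_def)
      next
        case False
        \<comment> \<open>The node with i = c comes from the second exponential of the last summand,
          whose index is c - 1.\<close>
        thus ?thesis using 2 assms
          by (intro image_eqI[of _ _ "Some (i - 1, False)"]) (auto simp: fgm_exponent_def fgm_index_def of_nat_diff)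
      qed
    qed
  qed
qed

text \<open>With e = exp(-\<mu> t) = 1 - F_C(t), g' is (1-e)^(c-1) times a combination of e^d and
  e^(d-1). Its i-th binomial term carries (-e)^(c-1-i), the origin of the sign. The extra factor e
  belongs to the exponential density and raises every power by one.\<close>

lemma fgm_g'_exp:
  assumes "0 < \<mu>" "0 < t" and c: "1 \<le> c"
  shows "exp (- \<mu> * t) * fgm_g' c d (1 - exp (- \<mu> * t)) =
    (\<Sum>i<c. real ((c - 1) choose i) * (- 1) ^ (c - 1 - i) *
       ((real c + d) * exp (- (\<mu> * (real c + d - real i)) * t) - d * exp (- (\<mu> * (real c + d - real i - 1)) * t)))"
proof -
  define e where "e = exp (- \<mu> * t)"
  have e: "0 < e" "e < 1" using assms by (auto simp: e_def)
  have powr: "e powr x = exp (- (\<mu> * x) * t)" for x unfolding e_def powr_def by simp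
  have "fgm_g' c d (1 - e) = (1 - e) ^ (c - 1) * ((real c + d) * e powr d - d * e powr (d - 1))"
  proof -
    have pc: "(1 - e) ^ c = (1 - e) * (1 - e) ^ (c - 1)" using c by (cases c) auto
    have pd: "e powr d = e * e powr (d - 1)" using e by (simp add: powr_diff)
    have 1: "1 - (1 - e) = e" by simp
    show ?thesis unfolding fgm_g'_def 1 pc pd by (simp add: algebra_simps)
  qed
  also have "(1 - e) ^ (c - 1) = (\<Sum>i<c. real ((c - 1) choose i) * (- 1) ^ (c - 1 - i) * e ^ (c - 1 - i))"
  proof -
    have "(1 + - e) ^ (c - 1) = (\<Sum>i\<le>c - 1. real ((c - 1) choose i) * 1 ^ i * (- e) ^ (c - 1 - i))"
      by (rule binomial_ring)
    also have "{..c - 1} = {..<c}" using c by auto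
    finally show ?thesis by (simp add: power_minus[of e] mult.assoc)
  qed
  finally have "e * fgm_g' c d (1 - e) = (\<Sum>i<c. real ((c - 1) choose i) * (- 1) ^ (c - 1 - i) *
      ((real c + d) * (e * e ^ (c - 1 - i) * e powr d) - d * (e * e ^ (c - 1 - i) * e powr (d - 1))))"
    by (simp add: sum_distrib_right sum_distrib_left algebra_simps)
  also have "\<dots> = (\<Sum>i<c. real ((c - 1) choose i) * (- 1) ^ (c - 1 - i) *
       ((real c + d) * e powr (real c + d - real i) - d * e powr (real c + d - real i - 1)))"
  proof (intro sum.cong refl)
    fix i assume i: "i \<in> {..<c}"
    have "e * e ^ (c - 1 - i) * e powr x = e powr (1 + real (c - 1 - i) + x)" for x
      using e by (simp add: powr_add powr_realpow)
    moreover have "1 + real (c - 1 - i) = real c - real i" using i c by (simp add: of_nat_diff)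
    ultimately have pw: "e * e ^ (c - 1 - i) * e powr x = e powr (real c - real i + x)" for x by simp
    show "real ((c - 1) choose i) * (- 1) ^ (c - 1 - i) *
      ((real c + d) * (e * e ^ (c - 1 - i) * e powr d) - d * (e * e ^ (c - 1 - i) * e powr (d - 1))) =
      real ((c - 1) choose i) * (- 1) ^ (c - 1 - i) *
       ((real c + d) * e powr (real c + d - real i) - d * e powr (real c + d - real i - 1))"
      unfolding pw by (simp add: algebra_simps)
  qed
  finally show ?thesis unfolding powr e_def[symmetric] .
qed

lemma (in prob_space) atomless_distribution_distr:
  assumes X: "distributed M lborel X f"
  shows "atomless_distribution (distr M borel X)"
proof -
  have [measurable]: "X \<in> borel_measurable M" using distributed_measurable[OF X] by simp
  have "distr M borel X = density lborel f"
    using distributed_distr_eq_density[OF X] by (metis distr_cong sets_lborel)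
  moreover have "emeasure (density lborel f) {x} = 0" for x
    using distributed_borel_measurable[OF X] AE_lborel_singleton[of x]
    by (subst emeasure_density) (auto intro!: nn_integral_0_iff_AE[THEN iffD2] elim!: eventually_mono split: split_indicator)
  ultimately have "measure (distr M borel X) {x} = 0" for x by (simp add: measure_def)
  moreover have "real_distribution (distr M borel X)" by (rule real_distribution_distr) simp
  ultimately show ?thesis
    by (simp add: atomless_distribution_def cdf_distribution_def atomless_distribution_axioms_def)
qed

lemma fgm_weight_bounded:
  assumes K1: "\<And>s. 0 < Re s \<Longrightarrow> norm (\<phi> s) \<le> K1" and K2: "\<And>s. 0 < Re s \<Longrightarrow> norm (\<phi> s - gZs s) \<le> K2"
  shows "\<exists>W. \<forall>j\<in>fgm_index c. \<forall>s. 0 < Re s \<longrightarrow> norm (fgm_weight \<mu> \<theta> c d \<phi> gZs j s) \<le> W"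
proof -
  have "\<exists>W. \<forall>s. 0 < Re s \<longrightarrow> norm (fgm_weight \<mu> \<theta> c d \<phi> gZs j s) \<le> W" for j
  proof (cases j)
    case None
    show ?thesis
      by (rule exI[of _ "\<bar>\<mu>\<bar> * K1"]) (auto simp: None fgm_weight_def norm_mult intro!: mult_left_mono K1)
  next
    case (Some it)
    obtain i hi where it: "it = (i, hi)" by (cases it)
    let ?C = "of_nat ((c - 1) choose i) * (- 1) ^ (c - 1 - i) * (if hi then of_real (real c + d) else - of_real d) :: complex"
    show ?thesis
    proof (intro exI[of _ "(\<bar>\<theta>\<bar> * K2 * \<bar>\<mu>\<bar>) * norm ?C"] allI impI)
      fix s :: complex assume "0 < Re s"
      show "norm (fgm_weight \<mu> \<theta> c d \<phi> gZs j s) \<le> (\<bar>\<theta>\<bar> * K2 * \<bar>\<mu>\<bar>) * norm ?C"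
        unfolding Some it fgm_weight_def option.case prod.case norm_mult[of _ ?C] norm_mult[of _ "of_real \<mu>"] norm_mult[of "of_real \<theta>"] norm_of_real
        using K2[OF \<open>0 < Re s\<close>] by (intro mult_right_mono mult_left_mono) auto
    qed
  qed
  then obtain W where W: "\<And>j s. 0 < Re s \<Longrightarrow> norm (fgm_weight \<mu> \<theta> c d \<phi> gZs j s) \<le> W j" by metis
  show ?thesis
  proof (intro exI[of _ "\<Sum>j\<in>fgm_index c. \<bar>W j\<bar>"] ballI allI impI)
    fix j and s :: complex assume j: "j \<in> fgm_index c" and s: "0 < Re s"
    have "\<bar>W j\<bar> \<le> (\<Sum>j\<in>fgm_index c. \<bar>W j\<bar>)" by (rule member_le_sum[OF j]) (auto simp: finite_fgm_index)
    with W[OF s, of j] show "norm (fgm_weight \<mu> \<theta> c d \<phi> gZs j s) \<le> (\<Sum>j\<in>fgm_index c. \<bar>W j\<bar>)" by linarith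
  qed
qed

lemma J_fun_eq_sum:
  "J_fun a \<mu> \<theta> c d \<phi> gZs s = (\<Sum>j\<in>fgm_index c. fgm_weight \<mu> \<theta> c d \<phi> gZs j s / (of_real ((1 + a) * fgm_exponent \<mu> c d j) - s))"
proof -
  have e: "(1 + a) * (\<mu> * x) = \<mu> * (1 + a) * x" "(1 + a) * \<mu> = \<mu> * (1 + a)" for x by auto
  show ?thesis
    using sum_fgm_weight[of \<mu> \<theta> c d \<phi> gZs s "\<lambda>n. 1 / (of_real ((1 + a) * n) - s)"]
    unfolding J_fun_def e by (simp only: times_divide_eq_right mult_1_right)
qed

text \<open>The denominators in \<open>H_fun\<close> have opposite orientations inside and outside
  its sum. Bringing them to one orientation puts a single minus sign in front of all terms that
  contain r.\<close>

lemma H_fun_eq_sum: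
  "H_fun a \<mu> \<theta> c d \<phi> gZs r s = (1 - \<phi> s) / s -
     (\<Sum>j\<in>fgm_index c. fgm_weight \<mu> \<theta> c d \<phi> gZs j s * r (of_real (fgm_exponent \<mu> c d j)) / (of_real ((1 + a) * fgm_exponent \<mu> c d j) - s))"
proof -
  have e: "(1 + a) * (\<mu> * x) = \<mu> * (1 + a) * x" "(1 + a) * \<mu> = \<mu> * (1 + a)" for x by auto
  have m: "x / (s - y) = - (x / (y - s))" for x y :: complex by (metis minus_diff_eq minus_divide_right)
  show ?thesis
    using sum_fgm_weight[of \<mu> \<theta> c d \<phi> gZs s "\<lambda>n. r (of_real n) / (of_real ((1 + a) * n) - s)"]
    unfolding H_fun_def m e
    by (simp only: times_divide_eq_right sum_subtractf[symmetric] minus_diff_minus mult_minus_right sum_negf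
        add_uminus_conv_diff diff_diff_eq)
qed

text \<open>In the second half r ranges over all functions, because the series at the nodes involves
  r only through its values there; the equivalence combines existence and uniqueness of the
  solution. Regularity of the nodes excludes resonances \<sigma> = (1+a)^(j+1) \<tau> between nodes,
  at which a denominator would vanish.\<close>

theorem mainTheorem6:
  fixes M :: "'w measure"
    and B C :: "nat \<Rightarrow> 'w \<Rightarrow> real"
    and a \<mu> \<theta> k b d :: real and c :: nat
    and fB FB FC R :: "real \<Rightarrow> real"
    and \<phi> gZs \<rho> J :: "complex \<Rightarrow> complex"
    and H :: "(complex \<Rightarrow> complex) \<Rightarrow> complex \<Rightarrow> complex"
  assumes prob: "prob_space M"
    and params: "a > 0" "\<mu> > 0" "k \<ge> 1" "b \<ge> 1" "c \<ge> 1" "d \<ge> 1"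
    and indep: "prob_space.indep_vars M (\<lambda>_. borel \<Otimes>\<^sub>M borel) (\<lambda>n \<omega>. (B n \<omega>, C n \<omega>)) UNIV"
    and ident: "\<And>n. distr M (borel \<Otimes>\<^sub>M borel) (\<lambda>\<omega>. (B n \<omega>, C n \<omega>))
                  = distr M (borel \<Otimes>\<^sub>M borel) (\<lambda>\<omega>. (B 0 \<omega>, C 0 \<omega>))"
    and B_pos: "AE \<omega> in M. 0 < B 0 \<omega>"
    and fB_nonneg: "\<And>t. 0 \<le> fB t"
    and B_density: "distributed M lborel (B 0) (\<lambda>t. ennreal (fB t))"
    and C_exp: "distributed M lborel (C 0) (\<lambda>t. ennreal (exponential_density \<mu> t))"
    and FB: "FB = cdf (distr M borel (B 0))"
    and FC: "FC = cdf (distr M borel (C 0))"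
    and copula: "is_copula (fgm_copula \<theta> k b c d)"
    and joint: "\<And>x t. measure M {\<omega> \<in> space M. B 0 \<omega> \<le> x \<and> C 0 \<omega> \<le> t}
                        = fgm_copula \<theta> k b c d (FB x) (FC t)"
    and R: "R = ruin_prob M a B C"
    and \<rho>: "\<rho> = laplace R"
    and \<phi>: "\<phi> = laplace_stieltjes M (B 0)"
    and gZs: "gZs = laplace (g_Z k b fB FB)"
    and J: "J = J_fun a \<mu> \<theta> c d \<phi> gZs"
    and H: "H = H_fun a \<mu> \<theta> c d \<phi> gZs"
  shows "(\<forall>s. 0 < Re s \<and> regular_point a \<mu> c d s \<longrightarrow>
            (\<lambda>n. (\<Prod>j<n. J (s / of_real ((1 + a) ^ j))) * H \<rho> (s / of_real ((1 + a) ^ n))) sums \<rho> s)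
       \<and> ((\<forall>\<sigma>\<in>nodes \<mu> c d. regular_point a \<mu> c d \<sigma>) \<longrightarrow>
            (\<forall>r. (\<forall>\<sigma>\<in>nodes \<mu> c d.
                    (\<lambda>n. (\<Prod>j<n. J (\<sigma> / of_real ((1 + a) ^ j))) * H r (\<sigma> / of_real ((1 + a) ^ n)))
                      sums r \<sigma>)
                 \<longleftrightarrow> (\<forall>\<sigma>\<in>nodes \<mu> c d. r \<sigma> = \<rho> \<sigma>)))"
proof -
  interpret M: prob_space M by (rule prob)
  define Z where "Z n \<omega> = (B n \<omega>, C n \<omega>)" for n \<omega>
  have Z_measurable [measurable]: "Z n \<in> M \<rightarrow>\<^sub>M borel \<Otimes>\<^sub>M borel" for n
    using indep unfolding M.indep_vars_def Z_def by auto
  have [measurable]: "B n \<in> borel_measurable M" "C n \<in> borel_measurable M" for n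
    using measurable_compose[OF Z_measurable[of n] measurable_fst] measurable_compose[OF Z_measurable[of n] measurable_snd]
    by (simp_all add: Z_def)
  define P where "P = distr M borel (B 0)"
  define Q where "Q = distr M borel (C 0)"
  define D where "D = distr M (borel \<Otimes>\<^sub>M borel) (Z 0)"
  have sets_D: "sets D = sets (borel \<Otimes>\<^sub>M borel)" by (simp add: D_def)
  have prob_D: "prob_space D" unfolding D_def by (rule M.prob_space_distr) measurable
  interpret PQ: copula_pair P Q D \<theta> "fgm_p k b" "fgm_p' k b" "fgm_g c d" "fgm_g' c d" "k + b" "real c + d"
  proof (intro copula_pair.intro copula_pair_axioms.intro prob_D sets_D)
    show "atomless_distribution P" "atomless_distribution Q"
      unfolding P_def Q_def using M.atomless_distribution_distr B_density C_exp by auto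
    show "measure D ({..x} \<times> {..y}) = cdf P x * cdf Q y + \<theta> * (fgm_p k b (cdf P x) * fgm_g c d (cdf Q y))" for x y
    proof -
      have "measure D ({..x} \<times> {..y}) = measure M {\<omega> \<in> space M. B 0 \<omega> \<le> x \<and> C 0 \<omega> \<le> y}"
        unfolding D_def by (subst measure_distr) (auto simp: Z_def intro!: arg_cong[where f = "measure M"])
      thus ?thesis unfolding joint FB FC P_def Q_def by (simp add: fgm_copula_def)
    qed
    show "fgm_p k b 0 = 0" "fgm_g c d 0 = 0" using params by (auto simp: fgm_p_def fgm_g_def)
  qed (use params copula in \<open>auto intro: continuous_on_fgm_p continuous_on_fgm_g fgm_p_has_derivative fgm_g_has_derivative
         fgm_p'_bounded fgm_g'_bounded fgm_density_nonneg\<close>)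
  have fB_measurable [measurable]: "fB \<in> borel_measurable borel"
    using distributed_real_measurable[OF _ B_density] fB_nonneg by simp
  have P_eq: "P = density lborel (\<lambda>t. ennreal (fB t))"
    using distributed_distr_eq_density[OF B_density] unfolding P_def by (metis distr_cong sets_lborel)
  have Q_eq: "Q = density lborel (\<lambda>t. ennreal (exponential_density \<mu> t))"
    using distributed_distr_eq_density[OF C_exp] unfolding Q_def by (metis distr_cong sets_lborel)
  have integral_P: "(\<integral>x. h x \<partial>P) = (\<integral>x. fB x *\<^sub>R h x \<partial>lborel)"
    if "h \<in> borel_measurable borel" for h :: "real \<Rightarrow> complex"
    unfolding P_eq using that fB_nonneg by (subst integral_density) auto
  have integral_Q: "(\<integral>t. h t \<partial>Q) = of_real \<mu> * (LINT t:{0<..}|lborel. of_real (exp (- \<mu> * t)) * h t)"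
    if [measurable]: "h \<in> borel_measurable borel" for h :: "real \<Rightarrow> complex"
  proof -
    have "(\<integral>t. h t \<partial>Q) = (\<integral>t. exponential_density \<mu> t *\<^sub>R h t \<partial>lborel)"
      unfolding Q_eq using params by (subst integral_density) (auto simp: erlang_density_nonneg)
    also have "\<dots> = (\<integral>t. of_real \<mu> * (indicator {0<..} t *\<^sub>R (of_real (exp (- \<mu> * t)) * h t)) \<partial>lborel)"
      using AE_lborel_singleton[of "0::real"]
      by (intro integral_cong_AE) (auto elim!: eventually_mono simp: exponential_density_def scaleR_conv_of_real mult.commute split: split_indicator)
    finally show ?thesis unfolding set_lebesgue_integral_def integral_mult_right_zero .
  qed
  have cdf_Q: "cdf Q t = 1 - exp (- \<mu> * t)" if "0 < t" for t
  proof -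
    have "cdf Q t = measure M {\<omega> \<in> space M. C 0 \<omega> \<le> t}"
      unfolding Q_def cdf_def by (subst measure_distr) (auto intro!: arg_cong[where f = "measure M"])
    thus ?thesis using M.exponential_distributedD_le[OF C_exp _ params(2), of t] that by (simp add: mult.commute)
  qed
  have C_pos: "AE \<omega> in M. 0 < C 0 \<omega>"
  proof -
    have "measure M {\<omega> \<in> space M. C 0 \<omega> \<le> 0} = 0"
      using M.exponential_distributedD_le[OF C_exp _ params(2), of 0] by simp
    hence "AE \<omega> in M. \<omega> \<notin> {\<omega> \<in> space M. C 0 \<omega> \<le> 0}" by (subst M.prob_eq_0[symmetric]) auto
    thus ?thesis by (rule AE_mp) (auto simp: not_le)
  qed
  have D_pos: "AE z in D. 0 < fst z \<and> 0 < snd z"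
    unfolding D_def by (subst AE_distr_iff) (use B_pos C_pos in \<open>auto simp: Z_def\<close>)
  \<comment> \<open>The cut to x > 0 bounds f by 1 on the whole line, as
    \<open>integral_joint_law\<close> demands; it leaves expectations unchanged because B > 0 almost
    surely.\<close>
  define f where "f s x = indicator {0<..} x *\<^sub>R exp (- s * complex_of_real x)" for s x
  have f_measurable [measurable]: "f s \<in> borel_measurable borel" for s unfolding f_def by measurable
  have f_bound: "norm (f s x) \<le> 1" if "0 < Re s" for s x
    using that by (auto simp: f_def split: split_indicator)
  have int_f: "(\<integral>x. f s x \<partial>P) = \<phi> s" for s
  proof -
    have "(\<integral>x. f s x \<partial>P) = (\<integral>\<omega>. f s (B 0 \<omega>) \<partial>M)" unfolding P_def by (subst integral_distr) auto
    also have "\<dots> = \<phi> s" unfolding \<phi> laplace_stieltjes_def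
      by (rule integral_cong_AE) (use B_pos in \<open>auto simp: f_def elim!: eventually_mono\<close>)
    finally show ?thesis .
  qed
  \<comment> \<open>Since g_Z subtracts f_B p'(F_B) from f_B, the difference \<phi> - gZs is
    E(exp(-s B) p'(F_B(B))). Almost everywhere that F_B is 0 or 1 the density f_B vanishes, so junk
    values of \<open>deriv\<close> do not contribute.\<close>
  have int_f\<alpha>: "(\<integral>x. f s x * of_real (PQ.P.of_cdf (fgm_p' k b) x) \<partial>P) = \<phi> s - gZs s" if s: "0 < Re s" for s
  proof -
    let ?\<alpha> = "PQ.P.of_cdf (fgm_p' k b)"
    have i1: "integrable P (f s)" by (rule PQ.P.integrable_const_bound[of _ 1]) (use f_bound[OF s] in auto)
    have i2: "integrable P (\<lambda>x. f s x * of_real (?\<alpha> x))"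
    proof (rule PQ.P.integrable_const_bound[of _ "1 * (k + b)"])
      show "AE x in P. norm (f s x * of_real (?\<alpha> x)) \<le> 1 * (k + b)"
        unfolding norm_mult norm_of_real using f_bound[OF s] PQ.alpha_bound by (intro AE_I2 mult_mono) auto
    qed measurable
    have "AE x in density lborel (\<lambda>t. ennreal (fB t)). 0 < cdf P x \<and> cdf P x < 1"
      using PQ.P.AE_cdf_interior by (simp only: P_eq[symmetric])
    hence "AE x in lborel. 0 < ennreal (fB x) \<longrightarrow> 0 < cdf P x \<and> cdf P x < 1"
      by (subst (asm) AE_density) auto
    hence ae: "AE x in lborel. indicator {0<..} x *\<^sub>R (exp (- s * complex_of_real x) * complex_of_real (g_Z k b fB FB x))
        = fB x *\<^sub>R (f s x - f s x * of_real (?\<alpha> x))"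
    proof eventually_elim
      case (elim x)
      show ?case
      proof (cases "fB x = 0")
        case False
        hence "0 < cdf P x \<and> cdf P x < 1" using elim fB_nonneg[of x] by simp
        hence "deriv (fgm_p k b) (FB x) = ?\<alpha> x"
          unfolding FB P_def[symmetric] PQ.P.of_cdf_def by (simp add: DERIV_imp_deriv[OF fgm_p_has_derivative])
        thus ?thesis
          by (simp add: f_def g_Z_def scaleR_conv_of_real algebra_simps)
      qed (simp add: g_Z_def)
    qed
    have "gZs s = (\<integral>x. fB x *\<^sub>R (f s x - f s x * of_real (?\<alpha> x)) \<partial>lborel)"
      unfolding gZs laplace_def set_lebesgue_integral_def
    proof (rule integral_cong_AE[OF _ _ ae])
      \<comment> \<open>At \<open>0\<close> and \<open>1\<close> \<open>deriv\<close> may be junk, but it is a constant there, so measurability survives.\<close>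
      have "0 \<le> cdf P x \<and> cdf P x \<le> 1" for x using PQ.P.cdf_nonneg PQ.P.cdf_bounded_prob by simp
      hence "deriv (fgm_p k b) (FB x) = (if cdf P x = 0 then deriv (fgm_p k b) 0
          else if cdf P x = 1 then deriv (fgm_p k b) 1 else fgm_p' k b (cdf P x))" for x
        unfolding FB P_def[symmetric]
        by (auto simp: less_le intro!: DERIV_imp_deriv fgm_p_has_derivative)
      hence [measurable]: "(\<lambda>x. deriv (fgm_p k b) (FB x)) \<in> borel_measurable borel" by simp
      show "(\<lambda>x. indicator {0<..} x *\<^sub>R (exp (- s * complex_of_real x) * complex_of_real (g_Z k b fB FB x)))
          \<in> borel_measurable lborel"
        unfolding g_Z_def by measurable
    qed measurable
    also have "\<dots> = (\<integral>x. f s x - f s x * of_real (?\<alpha> x) \<partial>P)" by (rule integral_P[symmetric]) measurable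
    also have "\<dots> = \<phi> s - (\<integral>x. f s x * of_real (?\<alpha> x) \<partial>P)"
      unfolding Bochner_Integration.integral_diff[OF i1 i2] int_f ..
    finally show ?thesis by simp
  qed
  let ?w = "fgm_weight \<mu> \<theta> c d \<phi> gZs" and ?\<nu> = "fgm_exponent \<mu> c d"
  interpret DR: dual_risk D a "fgm_index c" ?\<nu> ?w
  proof (rule dual_risk.intro)
    show "prob_space D" "sets D = sets (borel \<Otimes>\<^sub>M borel)" by (fact prob_D sets_D)+
    show "0 < ?\<nu> i" if "i \<in> fgm_index c" for i using fgm_exponent_pos params that by blast
    show "\<exists>W. \<forall>i\<in>fgm_index c. \<forall>s. 0 < Re s \<longrightarrow> norm (?w i s) \<le> W"
    proof (rule fgm_weight_bounded[where ?K1.0 = 1 and ?K2.0 = "1 * (k + b)"])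
      fix s :: complex assume s: "0 < Re s"
      have "norm (\<integral>x. f s x \<partial>P) \<le> (\<integral>x. norm (f s x) \<partial>P)" by (rule Bochner_Integration.integral_norm_bound)
      also have "\<dots> \<le> 1"
        by (rule PQ.P.integral_le_const)
           (use f_bound[OF s] in \<open>auto intro!: PQ.P.integrable_const_bound[of _ 1]\<close>)
      finally show "norm (\<phi> s) \<le> 1" unfolding int_f .
      let ?h = "\<lambda>x. f s x * of_real (PQ.P.of_cdf (fgm_p' k b) x)"
      have h: "norm (?h x) \<le> 1 * (k + b)" for x
        unfolding norm_mult norm_of_real using f_bound[OF s] PQ.alpha_bound by (intro mult_mono) auto
      have "norm (\<integral>x. ?h x \<partial>P) \<le> (\<integral>x. norm (?h x) \<partial>P)" by (rule Bochner_Integration.integral_norm_bound)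
      also have "\<dots> \<le> 1 * (k + b)"
        by (rule PQ.P.integral_le_const)
           (use h in \<open>auto intro!: PQ.P.integrable_const_bound[of _ "1 * (k + b)"]\<close>)
      finally show "norm (\<phi> s - gZs s) \<le> 1 * (k + b)" unfolding int_f\<alpha>[OF s] .
    qed
    fix s :: complex and F :: "real \<Rightarrow> complex" and K :: real
    assume s: "0 < Re s" and F [measurable]: "F \<in> borel_measurable borel" and K: "\<And>t. norm (F t) \<le> K"
    define X where "X n = (LINT t:{0<..}|lborel. exp (- complex_of_real n * complex_of_real t) * F t)" for n
    have X_int: "integrable lborel (\<lambda>t. indicator {0<..} t *\<^sub>R (exp (- complex_of_real n * complex_of_real t) * F t))"
      if "0 < n" for n by (rule integrable_exp_Ioi_bounded[OF _ F K]) (use that in simp)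
    have "(\<integral>z. exp (- s * complex_of_real (fst z)) * F (snd z) \<partial>D) = (\<integral>z. f s (fst z) * F (snd z) \<partial>D)"
      by (rule integral_cong_AE) (use D_pos in \<open>auto simp: f_def elim!: eventually_mono\<close>)
    also have "\<dots> = \<phi> s * (\<integral>t. F t \<partial>Q) + of_real \<theta> * ((\<phi> s - gZs s) * (\<integral>t. F t * of_real (PQ.Q.of_cdf (fgm_g' c d) t) \<partial>Q))"
      unfolding PQ.integral_joint_law[OF f_measurable F f_bound[OF s] K] int_f int_f\<alpha>[OF s] ..
    also have "(\<integral>t. F t \<partial>Q) = of_real \<mu> * X \<mu>"
      unfolding integral_Q[OF F] X_def by (simp add: exp_of_real[symmetric])
    also have "(\<integral>t. F t * of_real (PQ.Q.of_cdf (fgm_g' c d) t) \<partial>Q) = of_real \<mu> *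
       (\<Sum>i<c. of_nat ((c - 1) choose i) * (- 1) ^ (c - 1 - i) *
          (of_real (real c + d) * X (\<mu> * (real c + d - real i)) - of_real d * X (\<mu> * (real c + d - real i - 1))))"
    proof -
      define E where "E n t = indicator {0<..} t *\<^sub>R (exp (- complex_of_real n * complex_of_real t) * F t)" for n t
      have XE: "X n = (\<integral>t. E n t \<partial>lborel)" for n unfolding X_def E_def set_lebesgue_integral_def ..
      have E_int: "integrable lborel (E n)" if "0 < n" for n using X_int[OF that] unfolding E_def .
      have "(LINT t:{0<..}|lborel. of_real (exp (- \<mu> * t)) * (F t * of_real (PQ.Q.of_cdf (fgm_g' c d) t)))
        = (\<integral>t. (\<Sum>i<c. of_nat ((c - 1) choose i) * (- 1) ^ (c - 1 - i) *
             (of_real (real c + d) * E (\<mu> * (real c + d - real i)) t - of_real d * E (\<mu> * (real c + d - real i - 1)) t)) \<partial>lborel)"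
        unfolding set_lebesgue_integral_def
      proof (intro Bochner_Integration.integral_cong refl)
        fix t :: real
        show "indicator {0<..} t *\<^sub>R (of_real (exp (- \<mu> * t)) * (F t * of_real (PQ.Q.of_cdf (fgm_g' c d) t)))
          = (\<Sum>i<c. of_nat ((c - 1) choose i) * (- 1) ^ (c - 1 - i) *
             (of_real (real c + d) * E (\<mu> * (real c + d - real i)) t - of_real d * E (\<mu> * (real c + d - real i - 1)) t))"
        proof (cases "0 < t")
          case True
          \<comment> \<open>For t > 0 the value 1 - exp(-\<mu> t) lies strictly between 0 and 1, so
            the cut in \<open>of_cdf\<close> is inactive and \<open>fgm_g'_exp\<close>
            applies.\<close>
          hence q: "PQ.Q.of_cdf (fgm_g' c d) t = fgm_g' c d (1 - exp (- \<mu> * t))"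
            unfolding PQ.Q.of_cdf_def cdf_Q[OF True] using params by simp
          have "of_real (exp (- \<mu> * t)) * (F t * of_real (PQ.Q.of_cdf (fgm_g' c d) t))
            = F t * complex_of_real (exp (- \<mu> * t) * fgm_g' c d (1 - exp (- \<mu> * t)))"
            unfolding q by simp
          also have "\<dots> = (\<Sum>i<c. of_nat ((c - 1) choose i) * (- 1) ^ (c - 1 - i) *
             (of_real (real c + d) * E (\<mu> * (real c + d - real i)) t - of_real d * E (\<mu> * (real c + d - real i - 1)) t))"
            unfolding fgm_g'_exp[OF params(2) True params(5)] of_real_sum sum_distrib_left
            using True by (intro sum.cong refl) (simp add: E_def exp_of_real[symmetric] algebra_simps)
          finally show ?thesis using True by simp
        qed (simp add: E_def)
      qed
      also have "\<dots> = (\<Sum>i<c. of_nat ((c - 1) choose i) * (- 1) ^ (c - 1 - i) *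
          (of_real (real c + d) * X (\<mu> * (real c + d - real i)) - of_real d * X (\<mu> * (real c + d - real i - 1))))"
      proof -
        have i1: "integrable lborel (\<lambda>t. of_real (real c + d) * E (\<mu> * (real c + d - real i)) t)"
          and i2: "integrable lborel (\<lambda>t. of_real d * E (\<mu> * (real c + d - real i - 1)) t)" if "i < c" for i
          using that params by (auto intro!: integrable_mult_right E_int)
        show ?thesis
          by (subst Bochner_Integration.integral_sum)
             (auto intro!: integrable_mult_right Bochner_Integration.integrable_diff i1 i2 sum.cong
               simp only: integral_mult_right_zero Bochner_Integration.integral_diff[OF i1 i2] XE lessThan_iff)
      qed
      finally show ?thesis by (subst integral_Q) auto
    qed
    finally show "(\<integral>z. exp (- s * complex_of_real (fst z)) * F (snd z) \<partial>D)
       = (\<Sum>i\<in>fgm_index c. ?w i s * (LINT t:{0<..}|lborel. exp (- complex_of_real (?\<nu> i) * complex_of_real t) * F t))"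
      unfolding X_def[symmetric] sum_fgm_weight by (simp add: algebra_simps)
  qed (use params D_pos finite_fgm_index in auto)
  have phi_eq: "DR.phi = \<phi>"
  proof
    fix s
    have "(\<integral>z. exp (- s * complex_of_real (fst z)) \<partial>D) = (\<integral>\<omega>. exp (- s * complex_of_real (B 0 \<omega>)) \<partial>M)"
      unfolding D_def by (subst integral_distr) (auto simp: Z_def)
    thus "DR.phi s = \<phi> s" by (simp only: DR.phi_def \<phi> laplace_stieltjes_def)
  qed
  have J_eq: "J = DR.J"
    unfolding J DR.J_def[abs_def] DR.ksum_def J_fun_eq_sum[abs_def] by simp
  have H_eq: "H = DR.H"
    unfolding H DR.H_def[abs_def] DR.ksum_def H_fun_eq_sum[abs_def] phi_eq ..
  have N_eq: "DR.N = nodes \<mu> c d"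
    unfolding DR.N_def by (rule fgm_exponent_image) (use params in simp)
  have regular_eq: "regular_point a \<mu> c d = DR.regular"
    unfolding regular_point_def[abs_def] DR.regular_def[abs_def] fgm_exponent_image[OF params(5), symmetric] by simp
  \<comment> \<open>By independence and equality of the laws, the whole sequence (B_n, C_n) has the
    law of the canonical product. Ruin is an event of that sequence, so its probability can be
    computed there.\<close>
  have S_eq: "distr M (\<Pi>\<^sub>M i\<in>UNIV. borel \<Otimes>\<^sub>M borel) (\<lambda>\<omega> n. Z n \<omega>) = DR.Seq.S"
  proof -
    have "distr M (\<Pi>\<^sub>M i\<in>UNIV. borel \<Otimes>\<^sub>M borel) (\<lambda>\<omega>. \<lambda>n\<in>UNIV. Z n \<omega>)
        = (\<Pi>\<^sub>M n\<in>UNIV. distr M (borel \<Otimes>\<^sub>M borel) (Z n))"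
      using indep unfolding Z_def[symmetric]
      by (subst (asm) M.indep_vars_iff_distr_eq_PiM) auto
    also have "\<dots> = DR.Seq.S"
      using ident unfolding D_def Z_def by (intro PiM_cong) auto
    finally show ?thesis by (simp add: restrict_def)
  qed
  have R_eq: "R x = DR.hit_prob x" if x: "0 < x" for x
  proof -
    let ?A = "{z \<in> space DR.Seq.S. \<exists>t\<ge>0. surplus a x (\<lambda>n. fst (z n)) (\<lambda>n. snd (z n)) t = 0}"
    have [measurable]: "Measurable.pred DR.Seq.S (\<lambda>z. \<exists>t\<ge>0. surplus a x (\<lambda>n. fst (z n)) (\<lambda>n. snd (z n)) t = 0)"
      by (rule ever_ruined_measurable) measurable
    have Z_seq: "(\<lambda>\<omega> n. Z n \<omega>) \<in> M \<rightarrow>\<^sub>M (\<Pi>\<^sub>M i\<in>UNIV. borel \<Otimes>\<^sub>M borel)"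
      by (rule measurable_PiM_single') (auto simp: space_pair_measure)
    have sp: "space DR.Seq.S = UNIV"
      unfolding S_eq[symmetric] by (auto simp: space_PiM space_pair_measure)
    have A_sets: "?A \<in> sets (\<Pi>\<^sub>M i\<in>UNIV. borel \<Otimes>\<^sub>M borel)"
      using S_eq[THEN arg_cong[where f = sets]] by (simp, measurable)
    have "measure DR.Seq.S ?A = measure M {\<omega> \<in> space M. \<exists>t\<ge>0. surplus a x (\<lambda>n. B n \<omega>) (\<lambda>n. C n \<omega>) t = 0}"
      unfolding S_eq[symmetric]
      by (subst measure_distr[OF Z_seq A_sets[unfolded S_eq[symmetric]]]) (auto simp: Z_def sp space_PiM space_pair_measure intro!: arg_cong[where f = "measure M"])
    thus ?thesis using DR.hit_prob_eq_ever_ruined[OF x] by (simp add: R ruin_prob_def)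
  qed
  have \<rho>_eq: "\<rho> = laplace DR.hit_prob"
    unfolding \<rho> laplace_def[abs_def] by (intro ext set_lebesgue_integral_cong) (auto simp: R_eq)
  have series: "(\<lambda>n. (\<Prod>j<n. J (s / of_real ((1 + a) ^ j))) * H \<rho> (s / of_real ((1 + a) ^ n))) sums \<rho> s"
    if "0 < Re s" "regular_point a \<mu> c d s" for s
    using DR.laplace_hit_prob_sums[of s] that unfolding J_eq H_eq \<rho>_eq regular_eq DR.coef_def .
  \<comment> \<open>H reads its function argument at the nodes only, so agreement there carries the
    whole series over from \<rho> to r.\<close>
  have H_cong: "H r s = H r' s" if "\<forall>\<sigma>\<in>nodes \<mu> c d. r \<sigma> = r' \<sigma>" for r r' s
    using that unfolding H H_fun_eq_sum fgm_exponent_image[OF params(5), symmetric]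
    by (intro arg_cong2[where f = "(-)"] sum.cong refl) auto
  have node_system: "(\<forall>\<sigma>\<in>nodes \<mu> c d. (\<lambda>n. (\<Prod>j<n. J (\<sigma> / of_real ((1 + a) ^ j))) * H r (\<sigma> / of_real ((1 + a) ^ n))) sums r \<sigma>)
      \<longleftrightarrow> (\<forall>\<sigma>\<in>nodes \<mu> c d. r \<sigma> = \<rho> \<sigma>)"
    if reg: "\<forall>\<sigma>\<in>nodes \<mu> c d. regular_point a \<mu> c d \<sigma>" for r
  proof -
    have at_nodes: "(\<lambda>n. (\<Prod>j<n. J (\<sigma> / of_real ((1 + a) ^ j))) * H \<rho> (\<sigma> / of_real ((1 + a) ^ n))) sums \<rho> \<sigma>"
      if "\<sigma> \<in> nodes \<mu> c d" for \<sigma>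
      using series[of \<sigma>] reg that DR.N_cases[of \<sigma>] unfolding N_eq by blast
    show ?thesis
    proof
      assume r: "\<forall>\<sigma>\<in>nodes \<mu> c d. (\<lambda>n. (\<Prod>j<n. J (\<sigma> / of_real ((1 + a) ^ j))) * H r (\<sigma> / of_real ((1 + a) ^ n))) sums r \<sigma>"
      show "\<forall>\<sigma>\<in>nodes \<mu> c d. r \<sigma> = \<rho> \<sigma>"
      proof
        fix \<sigma> assume "\<sigma> \<in> nodes \<mu> c d"
        show "r \<sigma> = \<rho> \<sigma>"
        proof (rule DR.node_system_unique[of r \<rho>])
          show "DR.regular \<tau>" if "\<tau> \<in> DR.N" for \<tau> using reg that unfolding N_eq regular_eq by blast
          show "(\<lambda>n. DR.coef n \<tau> * DR.H r (\<tau> / of_real ((1 + a) ^ n))) sums r \<tau>" if "\<tau> \<in> DR.N" for \<tau>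
            using r that unfolding N_eq J_eq H_eq DR.coef_def by blast
          show "(\<lambda>n. DR.coef n \<tau> * DR.H \<rho> (\<tau> / of_real ((1 + a) ^ n))) sums \<rho> \<tau>" if "\<tau> \<in> DR.N" for \<tau>
            using at_nodes that unfolding N_eq J_eq H_eq DR.coef_def by blast
          show "\<sigma> \<in> DR.N" unfolding N_eq by fact
        qed
      qed
    next
      assume r: "\<forall>\<sigma>\<in>nodes \<mu> c d. r \<sigma> = \<rho> \<sigma>"
      show "\<forall>\<sigma>\<in>nodes \<mu> c d. (\<lambda>n. (\<Prod>j<n. J (\<sigma> / of_real ((1 + a) ^ j))) * H r (\<sigma> / of_real ((1 + a) ^ n))) sums r \<sigma>"
        using at_nodes r unfolding H_cong[OF r] by simp
    qed
  qed
  show ?thesis using series node_system by blast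
qed

end
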